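(* Let $W$ be the Wiener measure on $(\Omega,\mathcal{F})$. Each $A\in\mathcal{F}$ is $\overline{\mathbb{P}}$-measurable, i.e. $\overline{\mathbb{P}}(E)=\overline{\mathbb{P}}(E\cap A)+\overline{\mathbb{P}}(E\cap A^c)$ for every $E\subseteq\Omega$, and the restriction of $\overline{\mathbb{P}}$ to $\mathcal{F}$ coincides with $W$. In particular, $\overline{\mathbb{P}}(A)=\underline{\mathbb{P}}(A)=W(A)$ for each $A\in\mathcal{F}$.
   Context: Let $\Omega$ be the set of all continuous functions $\omega:[0,\infty)\to\mathbb{R}$ with $\omega(0)=0$. For $t\in[0,\infty)$, $\mathcal{F}_t$ is the $\sigma$-algebra on $\Omega$ generated by the maps $\omega\mapsto\omega(s)$, $s\in[0,t]$, and $\mathcal{F}=\mathcal{F}_\infty:=\bigvee_t\mathcal{F}_t$. Stopping times $\tau:\Omega\to[0,\infty]$ with respect to the (raw) filtration $(\mathcal{F}_t)$ and the $\sigma$-algebras $\mathcal{F}_\tau$ are defined as usual. The Wiener measure $W$ is the law on $(\Omega,\mathcal{F})$ of standard Brownian motion started at $0$. Lévy game. An elementary betting strategy $G$ consists of an increasing (i.e. nondecreasing) sequence of stopping times $\tau_1\le\tau_2\le\cdots$ with $\lim_{n\to\infty}\tau_n(\omega)=\infty$ for every $\omega\in\Omega$, and, for each $n=1,2,\ldots$, a pair of bounded $\mathcal{F}_{\tau_n}$-measurable functions $M_n,V_n:\Omega\to\mathbb{R}$. To $G$ and an initial capital $c\in\mathbb{R}$ corresponds the elementary capital process $$\mathcal{K}^{G,c}_t(\omega):=c+\sum_{n=1}^\infty\Bigl(M_n(\omega)\bigl(\omega(\tau_{n+1}\wedge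 t)-\omega(\tau_n\wedge t)\bigr)+V_n(\omega)\bigl((\omega^2(\tau_{n+1}\wedge t)-(\tau_{n+1}\wedge t))-(\omega^2(\tau_n\wedge t)-(\tau_n\wedge t))\bigr)\Bigr),\quad t\in[0,\infty)$$ (only finitely many terms are nonzero for each $t,\omega$; $\tau_n$ means $\tau_n(\omega)$). A positive capital process is any process $S$ of the form $S_t(\omega)=\sum_{n=1}^\infty\mathcal{K}^{G_n,c_n}_t(\omega)$, where each $G_n$ is an elementary betting strategy, $\mathcal{K}^{G_n,c_n}_t(\omega)\ge0$ for all $n,t,\omega$, and $\sum_n c_n<\infty$; $S$ may take the value $\infty$. Its initial value $S_0=\sum_n c_n$ does not depend on $\omega$. The upper probability of $E\subseteq\Omega$ is $\overline{\mathbb{P}}(E):=\inf\{S_0 : \forall\omega\in\Omega,\ \liminf_{t\to\infty}S_t(\omega)\ge\mathbb{I}_E(\omega)\}$, where $S$ ranges over the positive capital processes and $\mathbb{I}_E$ is the indicator function of $E$. The lower probability is $\underline{\mathbb{P}}(E):=1-\overline{\mathbb{P}}(E^c)$, where $E^c:=\Omega\setminus E$. *)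

theory Defs
  imports "HOL-Probability.Probability"
begin

section \<open>The path space and its raw filtration\<close>

text \<open>Functions on \<open>[0,\<infinity>)\<close> are represented by functions on \<^typ>\<open>real\<close> that
  are \<^const>\<open>undefined\<close> at negative times, so that a path is determined by its values on
  \<open>[0,\<infinity>)\<close>.\<close>

type_synonym path = "real \<Rightarrow> real"

definition paths :: "path set" where
  "paths = {\<omega> \<in> extensional {0..}. continuous_on {0..} \<omega> \<and> \<omega> 0 = 0}"

text \<open>Time is indexed by \<^typ>\<open>ennreal\<close>, so that the library's \<^const>\<open>stopping_time\<close> covers
  stopping times with values in \<open>[0,\<infinity>]\<close>. The member at \<^term>\<open>\<top> :: ennreal\<close> is the
  \<open>\<sigma>\<close>-algebra generated by the whole path.\<close>

definition path_filtration :: "ennreal \<Rightarrow> path measure" where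
  "path_filtration t =
     sigma paths {(\<lambda>\<omega>. \<omega> s) -` B \<inter> paths | s B. 0 \<le> s \<and> ennreal s \<le> t \<and> B \<in> sets borel}"

abbreviation path_sigma :: "path measure" where
  "path_sigma \<equiv> path_filtration \<top>"

lemma space_path_filtration [simp]: "space (path_filtration t) = paths"
  unfolding path_filtration_def by (rule space_measure_of) auto

lemma sets_path_filtration:
  "sets (path_filtration t) = sigma_sets paths
     {(\<lambda>\<omega>. \<omega> s) -` B \<inter> paths | s B. 0 \<le> s \<and> ennreal s \<le> t \<and> B \<in> sets borel}"
  unfolding path_filtration_def by (rule sets_measure_of) auto

lemma filtration_path_filtration: "filtration paths path_filtration"
proof
  fix i j :: ennreal
  assume "i \<le> j"
  then show "sets (path_filtration i) \<le> sets (path_filtration j)"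
    unfolding sets_path_filtration by (intro sigma_sets_mono') (blast intro: order_trans)
qed simp

lemma sets_path_sigma_eq_join:
  "sets path_sigma = sigma_sets paths (\<Union>t\<in>{0..}. sets (path_filtration (ennreal t)))"
proof
  show "sets path_sigma \<subseteq> sigma_sets paths (\<Union>t\<in>{0..}. sets (path_filtration (ennreal t)))"
    unfolding sets_path_filtration[of \<top>]
  proof (rule sigma_sets_mono', safe)
    fix s :: real and B :: "real set"
    assume "0 \<le> s" "B \<in> sets borel"
    then have "(\<lambda>\<omega>. \<omega> s) -` B \<inter> paths \<in> sets (path_filtration (ennreal s))"
      unfolding sets_path_filtration by (intro sigma_sets.Basic) auto
    then show "(\<lambda>\<omega>. \<omega> s) -` B \<inter> paths \<in> (\<Union>t\<in>{0..}. sets (path_filtration (ennreal t)))"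
      using \<open>0 \<le> s\<close> by auto
  qed
  have "(\<Union>t\<in>{0..}. sets (path_filtration (ennreal t))) \<subseteq> sets path_sigma"
    using filtration.sets_F_mono[OF filtration_path_filtration, of _ \<top>] by auto
  then show "sigma_sets paths (\<Union>t\<in>{0..}. sets (path_filtration (ennreal t))) \<subseteq> sets path_sigma"
    using sets.sigma_sets_subset[of _ path_sigma] by simp
qed

section \<open>Brownian motion and Wiener measure\<close>

definition standard_brownian_motion :: "'a measure \<Rightarrow> (real \<Rightarrow> 'a \<Rightarrow> real) \<Rightarrow> bool" where
  "standard_brownian_motion M B \<longleftrightarrow>
     prob_space M \<and>
     (\<forall>t\<ge>0. B t \<in> borel_measurable M) \<and>
     (\<forall>x\<in>space M. B 0 x = 0 \<and> continuous_on {0..} (\<lambda>t. B t x)) \<and>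
     (\<forall>s t. 0 \<le> s \<and> s < t \<longrightarrow>
        distributed M lborel (\<lambda>x. B t x - B s x) (normal_density 0 (sqrt (t - s)))) \<and>
     (\<forall>n (t :: nat \<Rightarrow> real). 0 \<le> t 0 \<and> (\<forall>i<n. t i \<le> t (Suc i)) \<longrightarrow>
        prob_space.indep_vars M (\<lambda>_. borel) (\<lambda>i x. B (t (Suc i)) x - B (t i) x) {..<n})"

definition path_law :: "'a measure \<Rightarrow> (real \<Rightarrow> 'a \<Rightarrow> real) \<Rightarrow> path measure" where
  "path_law M B = distr M path_sigma (\<lambda>x. restrict (\<lambda>t. B t x) {0..})"

text \<open>By the following lemma \<^const>\<open>distr\<close> is applied to a measurable map when \<open>B\<close> is a
  Brownian motion.\<close>

lemma measurable_brownian_path: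
  assumes "standard_brownian_motion M B"
  shows "(\<lambda>x. restrict (\<lambda>t. B t x) {0..}) \<in> M \<rightarrow>\<^sub>M path_sigma"
proof -
  have path: "restrict (\<lambda>t. B t x) {0..} \<in> paths" if "x \<in> space M" for x
  proof -
    have "continuous_on {0..} (\<lambda>t. B t x)" "B 0 x = 0"
      using assms that by (auto simp: standard_brownian_motion_def)
    moreover from this(1) have "continuous_on {0..} (restrict (\<lambda>t. B t x) {0..})"
      by (rule continuous_on_eq) simp
    ultimately show ?thesis
      by (simp add: paths_def)
  qed
  show ?thesis
    unfolding path_filtration_def
  proof (rule measurable_measure_of)
    show "(\<lambda>x. restrict (\<lambda>t. B t x) {0..}) \<in> space M \<rightarrow> paths"
      using path by auto
    fix Y
    assume "Y \<in> {(\<lambda>\<omega>. \<omega> s) -` A \<inter> paths | s A. 0 \<le> s \<and> ennreal s \<le> \<top> \<and> A \<in> sets borel}"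
    then obtain s A where Y: "Y = (\<lambda>\<omega>. \<omega> s) -` A \<inter> paths" and s: "0 \<le> s" and A: "A \<in> sets borel"
      by auto
    have "(\<lambda>x. restrict (\<lambda>t. B t x) {0..}) -` Y \<inter> space M = B s -` A \<inter> space M"
      using path s by (auto simp: Y)
    moreover have "B s \<in> borel_measurable M"
      using assms s by (simp add: standard_brownian_motion_def)
    ultimately show "(\<lambda>x. restrict (\<lambda>t. B t x) {0..}) -` Y \<inter> space M \<in> sets M"
      using A by (simp add: measurable_sets)
  qed auto
qed

section \<open>The L\'evy game\<close>

text \<open>Sequences are indexed from \<open>0\<close> instead of \<open>1\<close>.\<close>

record strategy =
  stop_time :: "nat \<Rightarrow> path \<Rightarrow> ennreal"
  stake_M :: "nat \<Rightarrow> path \<Rightarrow> real"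
  stake_V :: "nat \<Rightarrow> path \<Rightarrow> real"

definition elementary_strategy :: "strategy \<Rightarrow> bool" where
  "elementary_strategy G \<longleftrightarrow>
     (\<forall>n. stopping_time path_filtration (stop_time G n)) \<and>
     (\<forall>\<omega>\<in>paths. incseq (\<lambda>n. stop_time G n \<omega>) \<and> (\<lambda>n. stop_time G n \<omega>) \<longlonglongrightarrow> \<top>) \<and>
     (\<forall>n. stake_M G n \<in> borel_measurable (filtration.pre_sigma paths path_filtration (stop_time G n)) \<and>
          bounded (stake_M G n ` paths)) \<and>
     (\<forall>n. stake_V G n \<in> borel_measurable (filtration.pre_sigma paths path_filtration (stop_time G n)) \<and>
          bounded (stake_V G n ` paths))"

definition truncated_time :: "strategy \<Rightarrow> nat \<Rightarrow> real \<Rightarrow> path \<Rightarrow> real" where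
  "truncated_time G n t \<omega> = enn2real (min (stop_time G n \<omega>) (ennreal t))"

text \<open>Only finitely many terms of the series defining \<open>capital\<close> are nonzero.\<close>

lemma eventually_truncated_time:
  assumes "elementary_strategy G" "\<omega> \<in> paths" "0 \<le> t"
  shows "eventually (\<lambda>n. truncated_time G n t \<omega> = t \<and> truncated_time G (Suc n) t \<omega> = t) sequentially"
proof -
  have "(\<lambda>n. stop_time G n \<omega>) \<longlonglongrightarrow> \<top>"
    using assms by (auto simp: elementary_strategy_def)
  then have "eventually (\<lambda>n. ennreal t < stop_time G n \<omega>) sequentially"
    by (rule order_tendstoD) simp
  then have "eventually (\<lambda>n. truncated_time G n t \<omega> = t) sequentially"
    by eventually_elim (use assms in \<open>simp add: truncated_time_def min_absorb2\<close>)
  moreover from this have "eventually (\<lambda>n. truncated_time G (Suc n) t \<omega> = t) sequentially"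
    by (subst eventually_sequentially_Suc)
  ultimately show ?thesis
    by (rule eventually_conj)
qed

definition capital :: "strategy \<Rightarrow> real \<Rightarrow> real \<Rightarrow> path \<Rightarrow> real" where
  "capital G c t \<omega> = c + (\<Sum>n.
     (let r = truncated_time G n t \<omega>; r' = truncated_time G (Suc n) t \<omega>
      in stake_M G n \<omega> * (\<omega> r' - \<omega> r) +
         stake_V G n \<omega> * (((\<omega> r')\<^sup>2 - r') - ((\<omega> r)\<^sup>2 - r))))"

text \<open>\<open>s\<close> is the initial value of the process \<open>S\<close>. As the capital at time \<open>0\<close> is the initial
  capital, all \<open>c n\<close> are nonnegative, and \<^const>\<open>ennreal\<close> is only applied to nonnegative
  numbers.\<close>

definition positive_capital_process :: "real \<Rightarrow> (real \<Rightarrow> path \<Rightarrow> ennreal) \<Rightarrow> bool" where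
  "positive_capital_process s S \<longleftrightarrow>
     (\<exists>G c. (\<forall>n. elementary_strategy (G n)) \<and>
        (\<forall>n. \<forall>t\<ge>0. \<forall>\<omega>\<in>paths. 0 \<le> capital (G n) (c n) t \<omega>) \<and>
        summable c \<and> s = (\<Sum>n. c n) \<and>
        (\<forall>t\<ge>0. \<forall>\<omega>\<in>paths. S t \<omega> = (\<Sum>n. ennreal (capital (G n) (c n) t \<omega>))))"

definition superhedges :: "(real \<Rightarrow> path \<Rightarrow> ennreal) \<Rightarrow> path set \<Rightarrow> bool" where
  "superhedges S E \<longleftrightarrow> (\<forall>\<omega>\<in>paths. Liminf at_top (\<lambda>t. S t \<omega>) \<ge> indicator E \<omega>)"

definition upper_prob :: "path set \<Rightarrow> real" where
  "upper_prob E = Inf {s. \<exists>S. positive_capital_process s S \<and> superhedges S E}"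

definition lower_prob :: "path set \<Rightarrow> real" where
  "lower_prob E = 1 - upper_prob (paths - E)"

definition upper_prob_measurable :: "path set \<Rightarrow> bool" where
  "upper_prob_measurable A \<longleftrightarrow>
     (\<forall>E\<subseteq>paths. upper_prob E = upper_prob (E \<inter> A) + upper_prob (E \<inter> (paths - A)))"

text \<open>The real infimum defining \<^const>\<open>upper_prob\<close> is taken over a nonempty set that is bounded
  below by \<open>0\<close>.\<close>

lemma capital_0: "capital G c 0 \<omega> = c"
  by (simp add: capital_def truncated_time_def)

lemma positive_capital_process_nonneg:
  assumes "positive_capital_process s S"
  shows "0 \<le> s"
proof -
  obtain G c where *: "\<forall>n. \<forall>t\<ge>0. \<forall>\<omega>\<in>paths. 0 \<le> capital (G n) (c n) t \<omega>"
    and s: "summable c" "s = (\<Sum>n. c n)"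
    using assms unfolding positive_capital_process_def by blast
  have "restrict (\<lambda>_. 0) {0..} \<in> paths"
    using continuous_on_eq[of "{0..}" "\<lambda>_::real. 0::real" "restrict (\<lambda>_. 0) {0..}"]
    by (simp add: paths_def)
  then have "0 \<le> c n" for n
    using *[rule_format, of 0 "restrict (\<lambda>_. 0) {0..}" n] by (simp add: capital_0)
  then show ?thesis
    using s by (simp add: suminf_nonneg)
qed

lemma positive_capital_process_one:
  "positive_capital_process 1 (\<lambda>_ _. 1)" "superhedges (\<lambda>_ _. 1) E"
proof -
  let ?G = "\<lambda>_::nat. \<lparr>stop_time = \<lambda>n _. of_nat n, stake_M = \<lambda>_ _. 0, stake_V = \<lambda>_ _. 0\<rparr>"
  let ?c = "\<lambda>n::nat. if n = 0 then 1 else 0 :: real"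
  have G: "elementary_strategy (?G n)" for n
  proof -
    have "(\<lambda>n. of_nat n :: ennreal) \<longlonglongrightarrow> \<top>"
      by (rule of_nat_tendsto_top_ennreal)
    then show ?thesis
      by (auto simp: elementary_strategy_def stopping_time_const mono_def image_constant_conv)
  qed
  have c: "?c sums 1"
    using sums_single[of 0 "\<lambda>_. 1::real"] by simp
  have cap: "capital (?G n) a t \<omega> = a" for n a t \<omega>
    by (simp add: capital_def)
  have "(\<lambda>n. ennreal (?c n)) sums 1"
    using sums_single[of 0 "\<lambda>_. 1::ennreal"] by (simp add: if_distrib cong: if_cong)
  then have "(\<Sum>n. ennreal (?c n)) = 1"
    by (rule sums_unique[symmetric])
  then show "positive_capital_process 1 (\<lambda>_ _. 1)"
    unfolding positive_capital_process_def
    using G c by (intro exI[of _ ?G] exI[of _ ?c]) (auto simp: cap sums_iff)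
  show "superhedges (\<lambda>_ _. 1) E"
    by (auto simp: superhedges_def Liminf_const indicator_def)
qed

end

theory Submission
  imports Defs
begin

text \<open>Under \<open>W\<close> an elementary capital process has constant expectation by optional stopping, so by
  Fatou's lemma a superhedge of \<open>E\<close> costs at least \<open>W B\<close> for some measurable \<open>B \<supseteq> E\<close>. Once
  \<open>upper_prob\<close> is known to be at most \<open>W\<close> on measurable sets, this gives equality there, and it
  gives measurability: a superhedge of \<open>E\<close> costs at least
  \<open>W B = W (B \<inter> A) + W (B - A)\<close>, which dominates the upper probabilities of \<open>E \<inter> A\<close> and \<open>E - A\<close>.

  For the upper bound, let \<open>X\<close> be a nonnegative trigonometric polynomial in finitely many values
  \<open>w(s)\<close>, \<open>s\<close> dyadic. The conditional expectations \<open>Z\<^sub>t\<close> of \<open>X\<close> are explicit smooth functions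
  of time and path. Rebalancing whenever the path has moved by \<open>h\<close> or a grid point of mesh \<open>h\<close> is
  reached replicates \<open>Z\<close> up to an error of at most
  \<open>C h \<Sum> ((\<Delta>w)\<^sup>2 + \<Delta>t)\<close> on every path, which is covered by an additional stake \<open>C h\<close> on
  \<open>(\<Delta>w)\<^sup>2 - \<Delta>t\<close> and \<open>2 C h T\<close> extra capital. The Stone-Weierstrass theorem on a compact cube
  of cosines extends the bound to continuous functions, countable subadditivity to open sets, and
  outer regularity to measurable sets.\<close>

section \<open>Paths and Galmarino's test\<close>

text \<open>The upper bound has to hold on every path and for the raw filtration, so almost sure
  arguments of stochastic calculus cannot be used there. The rebalancing times are therefore
  entrance times into closed sets, which Galmarino's test recognizes as raw stopping times; the
  replication error is bounded path by path by a Taylor expansion; and positivity of the hedge comes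
  from a mean value property valid along every path. Cosines are chosen because their conditional
  expectations are explicit with bounded derivatives, so that one constant \<open>C\<close> serves
  all meshes, and because products of cosines are sums of cosines. The times are dyadic so that they
  lie on every sufficiently fine grid of mesh \<open>1 / 2 ^ k\<close>: no marked time is interior
  to a cell, and the integrand is constant there. The lower bound works in L2, where orthogonality
  relations replace conditional expectations and a second moment bound replaces uniform
  integrability.\<close>

abbreviation adapted_at :: "real \<Rightarrow> (path \<Rightarrow> real) set" where
  "adapted_at t \<equiv> borel_measurable (path_filtration (ennreal t))"

lemma measurable_coordinate:
  assumes "0 \<le> s" "ennreal s \<le> t"
  shows "(\<lambda>w. w s) \<in> borel_measurable (path_filtration t)"
proof (rule measurableI)
  fix B :: "real set" assume "B \<in> sets borel"
  then show "(\<lambda>w. w s) -` B \<inter> space (path_filtration t) \<in> sets (path_filtration t)"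
    using assms unfolding sets_path_filtration space_path_filtration
    by (intro sigma_sets.Basic) auto
qed simp

lemma measurable_into_path_sigma:
  assumes "\<And>x. x \<in> space N \<Longrightarrow> f x \<in> paths"
    and "\<And>s. 0 \<le> s \<Longrightarrow> (\<lambda>x. f x s) \<in> borel_measurable N"
  shows "f \<in> N \<rightarrow>\<^sub>M path_sigma"
  unfolding path_filtration_def[of \<top>]
proof (rule measurable_measure_of)
  fix Y assume "Y \<in> {(\<lambda>w. w s) -` A \<inter> paths | s A. 0 \<le> s \<and> ennreal s \<le> \<top> \<and> A \<in> sets borel}"
  then obtain s A where Y: "Y = (\<lambda>w. w s) -` A \<inter> paths" "0 \<le> s" "A \<in> sets borel"
    by auto
  have "f -` Y \<inter> space N = (\<lambda>x. f x s) -` A \<inter> space N"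
    using assms(1) Y by auto
  then show "f -` Y \<inter> space N \<in> sets N"
    using measurable_sets[OF assms(2)] Y by simp
qed (use assms(1) in auto)

lemma sets_path_filtration_subset: "sets (path_filtration t) \<subseteq> sets path_sigma"
  using filtration.sets_F_mono[OF filtration_path_filtration, of t \<top>] by simp

lemma path_continuous: "w \<in> paths \<Longrightarrow> continuous_on {0..} w"
  by (simp add: paths_def)

lemma path_0: "w \<in> paths \<Longrightarrow> w 0 = 0"
  by (simp add: paths_def)

lemma restrict_in_paths:
  assumes "continuous_on {0..} f" "f 0 = 0"
  shows "restrict f {0..} \<in> paths"
proof -
  have "continuous_on {0..} (restrict f {0..})"
    by (rule continuous_on_eq[OF assms(1)]) simp
  then show ?thesis
    using assms(2) by (simp add: paths_def)
qed

lemma floor_quotient_tendsto: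
  fixes a :: "nat \<Rightarrow> real"
  assumes a: "\<And>k. 0 < a k" and lim: "(\<lambda>k. 1 / a k) \<longlonglongrightarrow> 0"
  shows "(\<lambda>k. real_of_int \<lfloor>a k * r\<rfloor> / a k) \<longlonglongrightarrow> r"
proof (rule tendsto_sandwich[of "\<lambda>k. r - 1 / a k" _ _ "\<lambda>_. r"])
  have "(a k * r - 1) / a k \<le> real_of_int \<lfloor>a k * r\<rfloor> / a k" for k
    using a[of k] by (intro divide_right_mono) linarith+
  then show "\<forall>\<^sub>F k in sequentially. r - 1 / a k \<le> real_of_int \<lfloor>a k * r\<rfloor> / a k"
    using a by (intro always_eventually allI) (simp add: diff_divide_distrib less_imp_neq[symmetric])
  have "real_of_int \<lfloor>a k * r\<rfloor> / a k \<le> (a k * r) / a k" for k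
    using a[of k] by (intro divide_right_mono) linarith+
  then show "\<forall>\<^sub>F k in sequentially. real_of_int \<lfloor>a k * r\<rfloor> / a k \<le> r"
    using a by (intro always_eventually allI) (simp add: less_imp_neq[symmetric])
  show "(\<lambda>k. r - 1 / a k) \<longlonglongrightarrow> r"
    using tendsto_diff[OF tendsto_const lim, of r] by simp
qed simp

lemma inverse_Suc_tendsto: "(\<lambda>k. 1 / real (Suc k)) \<longlonglongrightarrow> 0"
  using LIMSEQ_inverse_real_of_nat by (simp add: inverse_eq_divide)

text \<open>Rounding \<open>T\<close> down to multiples of \<open>1 / Suc k\<close> leaves countably
  many coordinate maps; continuity of the paths passes to the limit.\<close>

lemma measurable_coordinate_at:
  assumes X: "X \<in> N \<rightarrow>\<^sub>M path_sigma" and T: "T \<in> borel_measurable N"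
    and nonneg: "\<And>x. x \<in> space N \<Longrightarrow> 0 \<le> T x"
  shows "(\<lambda>x. X x (T x)) \<in> borel_measurable N"
proof (rule borel_measurable_LIMSEQ_real)
  define r where "r k x = real_of_int \<lfloor>real (Suc k) * T x\<rfloor> / real (Suc k)" for k x
  \<comment> \<open>The rounded time is never negative, but
    \<open>measurable_compose_countable\<close> asks for a measurable function at every integer,
    hence \<open>max 0\<close>.\<close>
  show "(\<lambda>x. X x (max 0 (r k x))) \<in> borel_measurable N" for k
  proof -
    have "(\<lambda>x. X x (max 0 (real_of_int i / real (Suc k)))) \<in> borel_measurable N" for i
      using measurable_compose[OF X measurable_coordinate[of "max 0 (real_of_int i / real (Suc k))" \<top>]]
      by simp
    moreover have "(\<lambda>x. \<lfloor>real (Suc k) * T x\<rfloor>) \<in> N \<rightarrow>\<^sub>M count_space UNIV"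
      using T by measurable
    ultimately show ?thesis
      unfolding r_def by (rule measurable_compose_countable)
  qed
  fix x assume x: "x \<in> space N"
  have cont: "continuous_on {0..} (X x)"
    using measurable_space[OF X x] by (simp add: path_continuous)
  have lim: "(\<lambda>k. r k x) \<longlonglongrightarrow> T x"
    unfolding r_def by (intro floor_quotient_tendsto inverse_Suc_tendsto) simp
  have "(\<lambda>k. max 0 (r k x)) \<longlonglongrightarrow> max 0 (T x)"
    by (intro tendsto_max tendsto_const lim)
  then show "(\<lambda>k. X x (max 0 (r k x))) \<longlonglongrightarrow> X x (T x)"
    using nonneg[OF x] by (intro continuous_on_tendsto_compose[OF cont]) auto
qed

definition stop_path :: "real \<Rightarrow> path \<Rightarrow> path" where
  "stop_path t w = restrict (\<lambda>r. w (min r t)) {0..}"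

lemma stop_path_in_paths: "0 \<le> t \<Longrightarrow> w \<in> paths \<Longrightarrow> stop_path t w \<in> paths"
  unfolding stop_path_def
proof (rule restrict_in_paths)
  assume "0 \<le> t" "w \<in> paths"
  then show "continuous_on {0..} (\<lambda>r. w (min r t))"
    by (intro continuous_on_compose2[OF path_continuous, of w _ "\<lambda>r. min r t"])
       (auto intro: continuous_on_min continuous_on_id continuous_on_const)
qed (simp add: path_0)

lemma measurable_stop_path:
  assumes "0 \<le> t"
  shows "stop_path t \<in> path_filtration (ennreal t) \<rightarrow>\<^sub>M path_sigma"
proof (rule measurable_into_path_sigma)
  fix s :: real assume "0 \<le> s"
  then show "(\<lambda>w. stop_path t w s) \<in> adapted_at t"
    using assms by (simp add: stop_path_def measurable_coordinate ennreal_leI)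
qed (use assms in \<open>simp add: stop_path_in_paths\<close>)

definition agree_upto :: "real \<Rightarrow> path \<Rightarrow> path \<Rightarrow> bool" where
  "agree_upto t w w' \<longleftrightarrow> (\<forall>r. 0 \<le> r \<and> r \<le> t \<longrightarrow> w r = w' r)"

lemma agree_uptoD: "agree_upto t w w' \<Longrightarrow> 0 \<le> r \<Longrightarrow> r \<le> t \<Longrightarrow> w r = w' r"
  by (simp add: agree_upto_def)

lemma agree_upto_mono: "agree_upto t w w' \<Longrightarrow> s \<le> t \<Longrightarrow> agree_upto s w w'"
  by (simp add: agree_upto_def)

lemma agree_upto_sym: "agree_upto t w w' \<Longrightarrow> agree_upto t w' w"
  by (simp add: agree_upto_def)

lemma agree_stop_path: "agree_upto t w (stop_path t w)"
  by (simp add: agree_upto_def stop_path_def)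

text \<open>Galmarino's test. An event that cannot distinguish paths agreeing up to \<open>t\<close>
  is its own preimage under \<open>stop_path t\<close>, and every coordinate of the stopped path is
  a coordinate at a time at most \<open>t\<close>.\<close>

lemma sets_path_filtrationI:
  assumes "0 \<le> t" "A \<in> sets path_sigma"
    and inv: "\<And>w w'. w \<in> paths \<Longrightarrow> w' \<in> paths \<Longrightarrow> agree_upto t w w' \<Longrightarrow> w \<in> A \<Longrightarrow> w' \<in> A"
  shows "A \<in> sets (path_filtration (ennreal t))"
proof -
  have sub: "A \<subseteq> paths"
    using sets.sets_into_space[OF assms(2)] by simp
  have "stop_path t -` A \<inter> space (path_filtration (ennreal t)) = A"
  proof -
    have "stop_path t w \<in> A \<longleftrightarrow> w \<in> A" if "w \<in> paths" for w
      using inv[OF that _ agree_stop_path] inv[OF _ that agree_upto_sym[OF agree_stop_path]]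
        stop_path_in_paths[OF assms(1) that] by (intro iffI)
    then show ?thesis
      using sub by auto
  qed
  then show ?thesis
    using measurable_sets[OF measurable_stop_path[OF assms(1)] assms(2)] by simp
qed

lemma sets_path_filtration_ennrealI:
  assumes "A \<in> sets path_sigma"
    and inv: "\<And>s w w'. t = ennreal s \<Longrightarrow> 0 \<le> s \<Longrightarrow> w \<in> paths \<Longrightarrow> w' \<in> paths \<Longrightarrow>
      agree_upto s w w' \<Longrightarrow> w \<in> A \<Longrightarrow> w' \<in> A"
  shows "A \<in> sets (path_filtration t)"
proof (cases t)
  case (real s)
  then show ?thesis
    using sets_path_filtrationI[of s A] assms by blast
qed (use assms in simp)

abbreviation stopped_sigma :: "(path \<Rightarrow> ennreal) \<Rightarrow> path measure" where
  "stopped_sigma \<equiv> filtration.pre_sigma paths path_filtration"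

text \<open>The last assumption makes \<open>{T \<le> s}\<close> insensitive to the path after
  \<open>s\<close>: a path that agrees up to \<open>s\<close> with one already stopped by
  \<open>s\<close> stops at the same time.\<close>

lemma stopping_time_pathI:
  assumes "T \<in> borel_measurable path_sigma" "\<And>w. w \<in> paths \<Longrightarrow> 0 \<le> T w"
    and "\<And>w w' s. w \<in> paths \<Longrightarrow> w' \<in> paths \<Longrightarrow> agree_upto s w w' \<Longrightarrow> T w \<le> s \<Longrightarrow> T w' = T w"
  shows "stopping_time path_filtration (\<lambda>w. ennreal (T w))"
proof
  fix t
  have "{w \<in> paths. ennreal (T w) \<le> t} \<in> sets (path_filtration t)"
  proof (rule sets_path_filtration_ennrealI)
    have "(\<lambda>w. ennreal (T w)) \<in> borel_measurable path_sigma"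
      using assms(1) by measurable
    then have "{w \<in> space path_sigma. ennreal (T w) \<le> t} \<in> sets path_sigma"
      by (intro borel_measurable_le) auto
    then show "{w \<in> paths. ennreal (T w) \<le> t} \<in> sets path_sigma"
      by simp
  next
    fix s w w' assume "t = ennreal s" "0 \<le> s" "w \<in> paths" "w' \<in> paths" "agree_upto s w w'"
      "w \<in> {w \<in> paths. ennreal (T w) \<le> t}"
    then show "w' \<in> {w \<in> paths. ennreal (T w) \<le> t}"
      using assms(3)[of w w' s] by (simp add: ennreal_le_iff)
  qed
  then show "Measurable.pred (path_filtration t) (\<lambda>w. ennreal (T w) \<le> t)"
    by (simp add: pred_def)
qed

text \<open>Two paths that agree up to \<open>s\<close>, where \<open>T \<le> s\<close> on one of
  them, agree up to \<open>T\<close>, so they share the values of both \<open>T\<close> and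
  \<open>f\<close>. Galmarino's test then applies to the part of a preimage under \<open>f\<close>
  on which \<open>T \<le> s\<close>.\<close>

lemma measurable_pre_sigma_pathI:
  assumes st: "stopping_time path_filtration (\<lambda>w. ennreal (T w))"
    and nonneg: "\<And>w. w \<in> paths \<Longrightarrow> 0 \<le> T w"
    and dep: "\<And>w w' s. w \<in> paths \<Longrightarrow> w' \<in> paths \<Longrightarrow> agree_upto s w w' \<Longrightarrow> T w \<le> s \<Longrightarrow> T w' = T w"
    and f: "f \<in> borel_measurable path_sigma"
    and f_dep: "\<And>w w'. w \<in> paths \<Longrightarrow> w' \<in> paths \<Longrightarrow> agree_upto (T w) w w' \<Longrightarrow> f w' = f w"
  shows "f \<in> borel_measurable (stopped_sigma (\<lambda>w. ennreal (T w)))"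
proof -
  interpret filtration paths path_filtration by (rule filtration_path_filtration)
  let ?P = "pre_sigma (\<lambda>w. ennreal (T w))"
  show ?thesis
  proof (rule measurableI)
    fix B :: "'a set" assume B: "B \<in> sets borel"
    show "f -` B \<inter> space ?P \<in> sets ?P"
    proof (rule sets_pre_sigmaI[OF st])
      fix t
      show "{w \<in> f -` B \<inter> space ?P. ennreal (T w) \<le> t} \<in> sets (path_filtration t)"
      proof (rule sets_path_filtration_ennrealI)
        have "(f -` B \<inter> space path_sigma) \<inter> {w \<in> space path_sigma. ennreal (T w) \<le> t} \<in> sets path_sigma"
        proof (rule sets.Int[OF measurable_sets[OF f B]])
          show "{w \<in> space path_sigma. ennreal (T w) \<le> t} \<in> sets path_sigma"
            using subsetD[OF sets_path_filtration_subset stopping_timeD[OF st, of t, unfolded pred_def]]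
            by simp
        qed
        then show "{w \<in> f -` B \<inter> space ?P. ennreal (T w) \<le> t} \<in> sets path_sigma"
          by (rule back_subst[of "\<lambda>A. A \<in> sets path_sigma"]) (auto simp: space_pre_sigma)
      next
        fix s w w' assume *: "t = ennreal s" "0 \<le> s" "w \<in> paths" "w' \<in> paths" "agree_upto s w w'"
          "w \<in> {w \<in> f -` B \<inter> space ?P. ennreal (T w) \<le> t}"
        then have "T w \<le> s" by (simp add: ennreal_le_iff)
        then have "agree_upto (T w) w w'" "T w' = T w"
          using agree_upto_mono[OF *(5)] dep[OF *(3-5)] by simp_all
        then show "w' \<in> {w \<in> f -` B \<inter> space ?P. ennreal (T w) \<le> t}"
          using * f_dep[of w w'] by (simp add: space_pre_sigma)
      qed
    qed
  qed simp
qed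

section \<open>Increments of Wiener measure\<close>

text \<open>The facts about Brownian motion from which everything later is derived. Independence is
  stated against the whole past, as adapted stakes require, whereas the definition of Brownian
  motion speaks of finitely many increments.\<close>

locale wiener = prob_space W for W :: "path measure" +
  assumes sets_W [measurable_cong]: "sets W = sets path_sigma"
    and increment_normal: "\<And>s t. 0 \<le> s \<Longrightarrow> s < t \<Longrightarrow>
      distributed W lborel (\<lambda>w. w t - w s) (normal_density 0 (sqrt (t - s)))"
    and increment_indep: "\<And>s t. 0 \<le> s \<Longrightarrow> s < t \<Longrightarrow>
      indep_set (sets (path_filtration (ennreal s))) {(\<lambda>w. w t - w s) -` C \<inter> paths | C. C \<in> sets borel}"

section \<open>Independence of a Brownian increment from the past\<close>

lemma finite_times_increasing:
  fixes J :: "real set"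
  assumes "finite J" "J \<subseteq> {0..s}" "0 \<le> s" "s \<le> t"
  obtains n and \<tau> :: "nat \<Rightarrow> real" where "\<tau> 0 = 0" "\<tau> n = s" "\<tau> (Suc n) = t"
    "\<forall>i<Suc n. \<tau> i \<le> \<tau> (Suc i)" "J \<subseteq> \<tau> ` {..n}"
proof -
  define L where "L = insert 0 (insert s J)"
  define l where "l = sorted_list_of_set L"
  have L: "finite L" "L \<noteq> {}" "\<And>x. x \<in> L \<Longrightarrow> 0 \<le> x \<and> x \<le> s"
    using assms by (auto simp: L_def)
  have set_l: "set l = L" and sorted: "sorted l"
    using L by (auto simp: l_def)
  define n where "n = length l - 1"
  have "l \<noteq> []" using set_l L by auto
  then have len: "length l = Suc n" by (simp add: n_def)
  define \<tau> where "\<tau> i = (if i \<le> n then l ! i else t)" for i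
  have img: "L \<subseteq> \<tau> ` {..n}"
  proof
    fix x assume "x \<in> L"
    then obtain i where "i < length l" "l ! i = x" using set_l by (metis in_set_conv_nth)
    then show "x \<in> \<tau> ` {..n}" using len by (intro image_eqI[of _ _ i]) (auto simp: \<tau>_def)
  qed
  have mem: "\<tau> i \<in> L" if "i \<le> n" for i
    using that len set_l nth_mem[of i l] by (simp add: \<tau>_def)
  have mono: "\<tau> i \<le> \<tau> j" if "i \<le> j" "j \<le> n" for i j
    using that len sorted_nth_mono[OF sorted, of i j] by (simp add: \<tau>_def)
  obtain i where i: "i \<le> n" "\<tau> i = 0" using img by (auto simp: L_def)
  have "\<tau> 0 = 0"
    using mono[of 0 i] i L(3)[OF mem[of 0]] by simp
  moreover obtain j where j: "j \<le> n" "\<tau> j = s" using img by (auto simp: L_def)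
  have "\<tau> n = s"
    using mono[of j n] j L(3)[OF mem[of n]] by simp
  moreover have "\<tau> (Suc n) = t" by (simp add: \<tau>_def)
  moreover have "\<forall>i<Suc n. \<tau> i \<le> \<tau> (Suc i)"
  proof (intro allI impI)
    fix i assume "i < Suc n"
    then show "\<tau> i \<le> \<tau> (Suc i)"
      using mono[of i "Suc i"] \<open>\<tau> n = s\<close> \<open>\<tau> (Suc n) = t\<close> assms by (cases "i = n") auto
  qed
  moreover have "J \<subseteq> \<tau> ` {..n}" using img by (auto simp: L_def)
  ultimately show ?thesis by (rule that)
qed

text \<open>As \<open>B 0\<close> vanishes, the values at times in \<open>J\<close> are partial sums
  of the increments along one sequence from \<open>0\<close> through \<open>J\<close> to
  \<open>s\<close>. The increment up to \<open>t\<close> is the next one in that sequence, so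
  independence of its increments suffices.\<close>

lemma brownian_increment_indep_cylinder:
  fixes D :: "real \<Rightarrow> real set"
  assumes bm: "standard_brownian_motion M B"
    and J: "finite J" "J \<subseteq> {0..s}" "0 \<le> s" "s \<le> t"
    and D: "\<And>r. r \<in> J \<Longrightarrow> D r \<in> sets borel" and C: "C \<in> sets borel"
  shows "measure M {x \<in> space M. (\<forall>r\<in>J. B r x \<in> D r) \<and> B t x - B s x \<in> C} =
    measure M {x \<in> space M. \<forall>r\<in>J. B r x \<in> D r} * measure M {x \<in> space M. B t x - B s x \<in> C}"
proof -
  interpret prob_space M using bm by (simp add: standard_brownian_motion_def)
  obtain n and \<tau> :: "nat \<Rightarrow> real" where \<tau>: "\<tau> 0 = 0" "\<tau> n = s" "\<tau> (Suc n) = t"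
    "\<forall>i<Suc n. \<tau> i \<le> \<tau> (Suc i)" "J \<subseteq> \<tau> ` {..n}"
    by (rule finite_times_increasing[OF J]) (rule that; assumption)
  define \<Delta> where "\<Delta> i x = B (\<tau> (Suc i)) x - B (\<tau> i) x" for i x
  let ?N = "PiM {..<n} (\<lambda>_. borel::real measure)"
  let ?past = "\<lambda>x. restrict (\<lambda>i. \<Delta> i x) {..<n}" and ?last = "\<lambda>x. restrict (\<lambda>i. \<Delta> i x) {n}"
  have "indep_vars (\<lambda>_. borel) \<Delta> {..<Suc n}"
    using bm \<tau>(1,4) unfolding standard_brownian_motion_def \<Delta>_def by simp
  then have ind: "indep_var ?N ?past
      (PiM {n} (\<lambda>_. borel)) ?last"
    by (rule indep_var_restrict) auto
  have "\<forall>r\<in>J. \<exists>i\<le>n. r = \<tau> i" using \<tau>(5) by auto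
  then obtain idx where idx: "\<And>r. r \<in> J \<Longrightarrow> idx r \<le> n \<and> r = \<tau> (idx r)"
    by metis
  have B_sum: "B r x = (\<Sum>i<idx r. \<Delta> i x)" if "r \<in> J" "x \<in> space M" for r x
    using sum_lessThan_telescope[of "\<lambda>i. B (\<tau> i) x" "idx r"] idx[OF that(1)] bm that \<tau>(1)
    by (simp add: \<Delta>_def standard_brownian_motion_def)
  define E where "E = {d \<in> space ?N. \<forall>r\<in>J. (\<Sum>i<idx r. d i) \<in> D r}"
  define F where "F = {d \<in> space (PiM {n} (\<lambda>_. borel::real measure)). d n \<in> C}"
  have "(\<lambda>d. \<Sum>i<idx r. d i) \<in> borel_measurable ?N" if "r \<in> J" for r
    using idx[OF that] by (intro borel_measurable_sum measurable_component_singleton) auto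
  then have meas: "(\<lambda>d. \<Sum>i<idx r. d i) -` D r \<inter> space ?N \<in> sets ?N"
    if "r \<in> J" for r
    using D that by (intro measurable_sets) auto
  have E: "E \<in> sets ?N"
  proof -
    have "E = space ?N \<inter> (\<Inter>r\<in>J. (\<lambda>d. \<Sum>i<idx r. d i) -` D r \<inter> space ?N)"
      if "J \<noteq> {}" using that by (auto simp: E_def)
    moreover have "E = space ?N" if "J = {}"
      using that by (simp add: E_def)
    ultimately show ?thesis
      by (cases "J = {}") (simp_all add: sets.Int sets.finite_INT J(1) meas del: INT_simps)
  qed
  have F: "F \<in> sets (PiM {n} (\<lambda>_. borel))"
    unfolding F_def using C by measurable
  have E_eq: "?past -` E \<inter> space M = {x \<in> space M. \<forall>r\<in>J. B r x \<in> D r}"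
  proof -
    have "(\<Sum>i<idx r. restrict (\<lambda>i. \<Delta> i x) {..<n} i) = B r x" if "r \<in> J" "x \<in> space M" for r x
      unfolding B_sum[OF that] using idx[OF that(1)] by (intro sum.cong) auto
    then show ?thesis
      by (auto simp: E_def space_PiM)
  qed
  have F_eq: "?last -` F \<inter> space M = {x \<in> space M. B t x - B s x \<in> C}"
    using \<tau> by (auto simp: F_def space_PiM \<Delta>_def)
  have "{x \<in> space M. (\<forall>r\<in>J. B r x \<in> D r) \<and> B t x - B s x \<in> C} =
      (?past -` E \<inter> space M) \<inter> (?last -` F \<inter> space M)"
    unfolding E_eq F_eq by auto
  also have "\<dots> = (\<lambda>x. (?past x, ?last x)) -` (E \<times> F) \<inter> space M"
    by auto
  also have "measure M \<dots> = measure M {x \<in> space M. \<forall>r\<in>J. B r x \<in> D r} * measure M {x \<in> space M. B t x - B s x \<in> C}"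
    unfolding indep_varD[OF ind E F] E_eq F_eq ..
  finally show ?thesis .
qed

text \<open>An intersection-stable generator of the past at time \<open>s\<close>, as needed to
  extend independence to the generated sigma-algebra.\<close>

definition cylinders :: "real \<Rightarrow> path set set" where
  "cylinders s = {{w \<in> paths. \<forall>r\<in>J. w r \<in> D r} | J D.
     finite J \<and> J \<subseteq> {0..s} \<and> (\<forall>r\<in>J. D r \<in> sets borel)}"

lemma Int_stable_cylinders: "Int_stable (cylinders s)"
proof (rule Int_stableI)
  fix a b assume "a \<in> cylinders s" "b \<in> cylinders s"
  then obtain J D J' D' where a: "a = {w \<in> paths. \<forall>r\<in>J. w r \<in> D r}" "finite J" "J \<subseteq> {0..s}" "\<forall>r\<in>J. D r \<in> sets borel"
    and b: "b = {w \<in> paths. \<forall>r\<in>J'. w r \<in> D' r}" "finite J'" "J' \<subseteq> {0..s}" "\<forall>r\<in>J'. D' r \<in> sets borel"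
    unfolding cylinders_def by blast
  let ?D = "\<lambda>r. (if r \<in> J then D r else UNIV) \<inter> (if r \<in> J' then D' r else UNIV)"
  have "a \<inter> b = {w \<in> paths. \<forall>r\<in>J \<union> J'. w r \<in> ?D r}"
    unfolding a b by (auto split: if_splits)
  moreover have "\<forall>r\<in>J \<union> J'. ?D r \<in> sets borel"
    using a b by auto
  ultimately show "a \<inter> b \<in> cylinders s"
    unfolding cylinders_def using a b by (intro CollectI exI[of _ "J \<union> J'"] exI[of _ ?D]) auto
qed

lemma cylinders_in_sets: "cylinders s \<subseteq> sets (path_filtration (ennreal s))"
proof
  fix a assume "a \<in> cylinders s"
  then obtain J D where a: "a = {w \<in> paths. \<forall>r\<in>J. w r \<in> D r}" "finite J" "J \<subseteq> {0..s}" "\<forall>r\<in>J. D r \<in> sets borel"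
    unfolding cylinders_def by blast
  have "(\<lambda>w. w r) -` D r \<inter> space (path_filtration (ennreal s)) \<in> sets (path_filtration (ennreal s))" if "r \<in> J" for r
    using that a by (intro measurable_sets[OF measurable_coordinate]) (auto intro: ennreal_leI)
  then have "{w \<in> space (path_filtration (ennreal s)). w r \<in> D r} \<in> sets (path_filtration (ennreal s))" if "r \<in> J" for r
    using that by (simp add: vimage_def Int_def conj_commute)
  then have "{w \<in> space (path_filtration (ennreal s)). \<forall>r\<in>J. w r \<in> D r} \<in> sets (path_filtration (ennreal s))"
    using a(2) by (intro sets.sets_Collect_finite_All) auto
  then show "a \<in> sets (path_filtration (ennreal s))"
    by (simp add: a)
qed

lemma sigma_cylinders:
  assumes "0 \<le> s"
  shows "sigma_sets paths (cylinders s) = sets (path_filtration (ennreal s))"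
proof
  show "sigma_sets paths (cylinders s) \<subseteq> sets (path_filtration (ennreal s))"
    using sets.sigma_sets_subset[OF cylinders_in_sets] by simp
  show "sets (path_filtration (ennreal s)) \<subseteq> sigma_sets paths (cylinders s)"
    unfolding sets_path_filtration
  proof (rule sigma_sets_mono', safe)
    fix r :: real and A :: "real set" assume *: "0 \<le> r" "ennreal r \<le> ennreal s" "A \<in> sets borel"
    then have "(\<lambda>w. w r) -` A \<inter> paths = {w \<in> paths. \<forall>r\<in>{r}. w r \<in> A}"
      by auto
    moreover have "r \<le> s" using * assms by (simp add: ennreal_le_iff)
    ultimately show "(\<lambda>w. w r) -` A \<inter> paths \<in> cylinders s"
      unfolding cylinders_def using * by (intro CollectI exI[of _ "{r}"] exI[of _ "\<lambda>_. A"]) auto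
  qed
qed

lemma Int_stable_vimage: "Int_stable {f -` C \<inter> A | C. C \<in> sets N}"
proof (rule Int_stableI)
  fix a b assume "a \<in> {f -` C \<inter> A | C. C \<in> sets N}" "b \<in> {f -` C \<inter> A | C. C \<in> sets N}"
  then obtain C C' where "a = f -` C \<inter> A" "C \<in> sets N" "b = f -` C' \<inter> A" "C' \<in> sets N" by blast
  then show "a \<inter> b \<in> {f -` C \<inter> A | C. C \<in> sets N}"
    by (intro CollectI exI[of _ "C \<inter> C'"]) auto
qed

text \<open>Under \<open>\<Phi>\<close> cylinder events become events on finitely many values of
  \<open>B\<close>, where probabilities factorize; intersection stability carries the factorization
  to the whole past.\<close>

lemma wiener_path_law:
  assumes bm: "standard_brownian_motion M B"
  shows "wiener (path_law M B)"
proof -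
  define \<Phi> where "\<Phi> x = restrict (\<lambda>t. B t x) {0..}" for x
  have \<Phi>: "\<Phi> \<in> M \<rightarrow>\<^sub>M path_sigma"
    using measurable_brownian_path[OF bm] by (simp add: \<Phi>_def[abs_def])
  let ?W = "path_law M B"
  have W: "?W = distr M path_sigma \<Phi>" by (simp add: path_law_def \<Phi>_def[abs_def])
  interpret M: prob_space M using bm by (simp add: standard_brownian_motion_def)
  interpret W: prob_space ?W unfolding W by (rule M.prob_space_distr[OF \<Phi>])
  have meas: "measure ?W A = measure M {x \<in> space M. \<Phi> x \<in> A}" if "A \<in> sets path_sigma" for A
    unfolding W using measure_distr[OF \<Phi> that] by (simp add: vimage_def Int_def conj_commute)
  have space: "space ?W = paths" and sets: "sets ?W = sets path_sigma" by (simp_all add: W)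
  have X: "(\<lambda>w. w t - w s) \<in> borel_measurable path_sigma" if "0 \<le> s" "s \<le> t" for s t
    using that by (intro borel_measurable_diff measurable_coordinate) auto
  have indep: "W.indep_set (sets (path_filtration (ennreal s))) {(\<lambda>w. w t - w s) -` C \<inter> paths | C. C \<in> sets borel}"
    if st: "0 \<le> s" "s \<le> t" for s t
  proof -
    let ?I = "{(\<lambda>w. w t - w s) -` C \<inter> paths | C. C \<in> sets (borel::real measure)}"
    have I_meas: "?I \<subseteq> sets path_sigma"
      using measurable_sets[OF X[OF st]] by auto
    have "W.indep_set (cylinders s) ?I"
      unfolding W.indep_sets2_eq
    proof (intro conjI ballI)
      show "cylinders s \<subseteq> W.events"
        using cylinders_in_sets sets_path_filtration_subset sets by blast
      show "?I \<subseteq> W.events"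
        using I_meas sets by simp
      fix a b assume a': "a \<in> cylinders s" and b': "b \<in> ?I"
      then obtain J D C where a: "a = {w \<in> paths. \<forall>r\<in>J. w r \<in> D r}" "finite J" "J \<subseteq> {0..s}" "\<forall>r\<in>J. D r \<in> sets borel"
        and b: "b = (\<lambda>w. w t - w s) -` C \<inter> paths" "C \<in> sets borel"
        unfolding cylinders_def by blast
      have ab: "a \<in> sets path_sigma" "b \<in> sets path_sigma"
        using a' b' cylinders_in_sets sets_path_filtration_subset I_meas by blast+
      have *: "\<Phi> x \<in> paths" "\<And>r. 0 \<le> r \<Longrightarrow> \<Phi> x r = B r x" if "x \<in> space M" for x
        using measurable_space[OF \<Phi> that] by (auto simp: \<Phi>_def)
      have J0: "0 \<le> r" if "r \<in> J" for r using that a by auto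
      have "{x \<in> space M. \<Phi> x \<in> a \<inter> b} = {x \<in> space M. (\<forall>r\<in>J. B r x \<in> D r) \<and> B t x - B s x \<in> C}"
        using * st J0 by (auto simp: a(1) b(1))
      moreover have "{x \<in> space M. \<Phi> x \<in> a} = {x \<in> space M. \<forall>r\<in>J. B r x \<in> D r}"
        using * st J0 by (auto simp: a(1))
      moreover have "{x \<in> space M. \<Phi> x \<in> b} = {x \<in> space M. B t x - B s x \<in> C}"
        using * st by (auto simp: b(1))
      ultimately show "W.prob (a \<inter> b) = W.prob a * W.prob b"
        using brownian_increment_indep_cylinder[OF bm a(2,3) st _ b(2), of D] a(4) ab
        by (simp add: meas)
    qed
    moreover have "Int_stable ?I"
      by (rule Int_stable_vimage)
    ultimately have "W.indep_set (sigma_sets paths (cylinders s)) (sigma_sets paths ?I)"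
      using W.indep_set_sigma_sets[of "cylinders s" ?I] Int_stable_cylinders space by simp
    then show ?thesis
      unfolding sigma_cylinders[OF st(1)] W.indep_sets2_eq by (auto intro: sigma_sets.Basic)
  qed
  show ?thesis
  proof
    show "sets ?W = sets path_sigma" by (rule sets)
    fix s t :: real assume st: "0 \<le> s" "s < t"
    then show "W.indep_set (sets (path_filtration (ennreal s))) {(\<lambda>w. w t - w s) -` C \<inter> paths | C. C \<in> sets borel}"
      using indep by simp
    have D: "distributed M lborel (\<lambda>x. B t x - B s x) (normal_density 0 (sqrt (t - s)))"
      using bm st by (simp add: standard_brownian_motion_def)
    have "distr ?W lborel (\<lambda>w. w t - w s) = distr M lborel ((\<lambda>w. w t - w s) \<circ> \<Phi>)"
      unfolding W using X st by (intro distr_distr \<Phi>) (simp add: measurable_lborel1)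
    also have "(\<lambda>w. w t - w s) \<circ> \<Phi> = (\<lambda>x. B t x - B s x)"
      using st by (auto simp: \<Phi>_def)
    finally show "distributed ?W lborel (\<lambda>w. w t - w s) (normal_density 0 (sqrt (t - s)))"
      using D X st by (simp add: distributed_def W measurable_lborel1)
  qed
qed

section \<open>Square-integrable martingales\<close>

text \<open>An L2 bound makes the sequence uniformly integrable. Fatou's lemma bounds the second
  moment of \<open>g\<close>, and \<open>h \<le> min h K + h\<^sup>2 / K\<close> splits the distance
  \<open>h\<close> of \<open>f k\<close> to \<open>g\<close> into a part for dominated convergence
  and a part that is small uniformly in \<open>k\<close>.\<close>

lemma (in prob_space) integral_tendsto_of_L2_bounded:
  fixes f :: "nat \<Rightarrow> 'a \<Rightarrow> real"
  assumes [measurable]: "\<And>k. f k \<in> borel_measurable M"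
    and lim: "\<And>x. x \<in> space M \<Longrightarrow> (\<lambda>k. f k x) \<longlonglongrightarrow> g x"
    and int: "\<And>k. integrable M (\<lambda>x. (f k x)\<^sup>2)"
    and bound: "\<And>k. (\<integral>x. (f k x)\<^sup>2 \<partial>M) \<le> D"
  shows "integrable M (\<lambda>x. (g x)\<^sup>2)" "(\<lambda>k. \<integral>x. f k x \<partial>M) \<longlonglongrightarrow> (\<integral>x. g x \<partial>M)"
proof -
  have g[measurable]: "g \<in> borel_measurable M"
    by (rule borel_measurable_LIMSEQ_real[OF lim]) auto
  have "(\<integral>\<^sup>+x. ennreal ((g x)\<^sup>2) \<partial>M) = (\<integral>\<^sup>+x. liminf (\<lambda>k. ennreal ((f k x)\<^sup>2)) \<partial>M)"
    by (intro nn_integral_cong lim_imp_Liminf[symmetric] tendsto_ennrealI tendsto_power lim) auto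
  also have "\<dots> \<le> liminf (\<lambda>k. \<integral>\<^sup>+x. ennreal ((f k x)\<^sup>2) \<partial>M)"
    by (intro nn_integral_liminf) auto
  also have "\<dots> \<le> limsup (\<lambda>k. \<integral>\<^sup>+x. ennreal ((f k x)\<^sup>2) \<partial>M)"
    by (intro Liminf_le_Limsup) simp
  also have "\<dots> \<le> ennreal D"
    using bound by (intro Limsup_bounded always_eventually allI)
      (simp add: nn_integral_eq_integral int ennreal_leI)
  finally have g2_le: "(\<integral>\<^sup>+x. ennreal ((g x)\<^sup>2) \<partial>M) \<le> ennreal D" .
  then show g2: "integrable M (\<lambda>x. (g x)\<^sup>2)"
    by (intro integrableI_bounded) (auto intro: le_less_trans)
  have D: "0 \<le> D"
    by (rule order_trans[OF _ bound[of 0]]) simp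
  have Eg: "(\<integral>x. (g x)\<^sup>2 \<partial>M) \<le> D"
    using g2_le D by (simp add: nn_integral_eq_integral g2)
  have f1: "integrable M (f k)" for k by (rule square_integrable_imp_integrable[OF _ int]) simp
  have g1: "integrable M g" by (rule square_integrable_imp_integrable[OF _ g2]) simp
  define h where "h k x = \<bar>f k x - g x\<bar>" for k x
  have h1: "integrable M (h k)" for k unfolding h_def using f1 g1 by (intro integrable_abs) auto
  have h_bound: "(h k x)\<^sup>2 \<le> 2 * (f k x)\<^sup>2 + 2 * (g x)\<^sup>2" for k x
    unfolding h_def using zero_le_power2[of "f k x + g x"] by (simp add: power2_eq_square algebra_simps)
  have h2: "integrable M (\<lambda>x. (h k x)\<^sup>2)" for k
    by (rule Bochner_Integration.integrable_bound[of _ "\<lambda>x. 2 * (f k x)\<^sup>2 + 2 * (g x)\<^sup>2"])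
       (use int g2 h_bound in \<open>auto simp: h_def\<close>)
  have Eh: "(\<integral>x. (h k x)\<^sup>2 \<partial>M) \<le> 4 * D" for k
  proof -
    have "(\<integral>x. (h k x)\<^sup>2 \<partial>M) \<le> (\<integral>x. 2 * (f k x)\<^sup>2 + 2 * (g x)\<^sup>2 \<partial>M)"
      using int g2 h2 h_bound by (intro integral_mono) auto
    also have "\<dots> = 2 * (\<integral>x. (f k x)\<^sup>2 \<partial>M) + 2 * (\<integral>x. (g x)\<^sup>2 \<partial>M)"
      using int g2 by simp
    finally show ?thesis using bound[of k] Eg by linarith
  qed
  have "(\<lambda>k. \<integral>x. h k x \<partial>M) \<longlonglongrightarrow> 0"
  proof (rule LIMSEQ_I)
    fix e :: real assume e: "0 < e"
    \<comment> \<open>Chosen to bring \<open>4 * D / K\<close> below \<open>e / 2\<close>; the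
      summand \<open>1\<close> keeps \<open>K\<close> positive when \<open>D = 0\<close>.\<close>
    define K where "K = (8 * D + 1) / e"
    have K: "0 < K" "4 * D / K < e / 2" using e D by (auto simp: K_def field_simps)
    have min_int: "integrable M (\<lambda>x. min (h k x) K)" for k
      using h1[of k] by (intro integrable_min) auto
    have "(\<lambda>k. \<integral>x. min (h k x) K \<partial>M) \<longlonglongrightarrow> (\<integral>x. 0 \<partial>M)"
    proof (rule integral_dominated_convergence[where w="\<lambda>_. K"])
      show "AE x in M. (\<lambda>k. min (h k x) K) \<longlonglongrightarrow> 0"
      proof (rule AE_I2)
        fix x assume "x \<in> space M"
        then have "(\<lambda>k. min (h k x) K) \<longlonglongrightarrow> min \<bar>g x - g x\<bar> K"
          unfolding h_def by (intro tendsto_intros lim)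
        then show "(\<lambda>k. min (h k x) K) \<longlonglongrightarrow> 0" using K by simp
      qed
    qed (use K in \<open>auto simp: h_def\<close>)
    then obtain k0 where k0: "\<And>k. k \<ge> k0 \<Longrightarrow> \<bar>\<integral>x. min (h k x) K \<partial>M\<bar> < e / 2"
      using LIMSEQ_D[of _ 0 "e/2"] e by fastforce
    show "\<exists>k0. \<forall>k\<ge>k0. norm ((\<integral>x. h k x \<partial>M) - 0) < e"
    proof (intro exI allI impI)
      fix k assume "k \<ge> k0"
      have "h k x \<le> min (h k x) K + (h k x)\<^sup>2 / K" for x
      proof (cases "h k x \<le> K")
        case False
        then have "h k x * K \<le> (h k x)\<^sup>2" using K by (simp add: power2_eq_square)
        then have "h k x \<le> (h k x)\<^sup>2 / K" using K by (simp add: pos_le_divide_eq)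
        then show ?thesis using False K by simp
      qed (use K in simp)
      then have "(\<integral>x. h k x \<partial>M) \<le> (\<integral>x. min (h k x) K + (h k x)\<^sup>2 / K \<partial>M)"
        using h1 h2 min_int by (intro integral_mono) auto
      also have "\<dots> = (\<integral>x. min (h k x) K \<partial>M) + (\<integral>x. (h k x)\<^sup>2 \<partial>M) / K"
        using h2 min_int by simp
      also have "(\<integral>x. (h k x)\<^sup>2 \<partial>M) / K \<le> 4 * D / K"
        using Eh K by (intro divide_right_mono) auto
      finally have "(\<integral>x. h k x \<partial>M) < e"
        using k0[OF \<open>k \<ge> k0\<close>] K by linarith
      moreover have "0 \<le> (\<integral>x. h k x \<partial>M)"
        by (intro integral_nonneg_AE AE_I2) (simp add: h_def)
      ultimately show "norm ((\<integral>x. h k x \<partial>M) - 0) < e" by simp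
    qed
  qed
  moreover have "\<forall>k. norm ((\<integral>x. f k x \<partial>M) - (\<integral>x. g x \<partial>M)) \<le> (\<integral>x. h k x \<partial>M)"
  proof
    fix k
    show "norm ((\<integral>x. f k x \<partial>M) - (\<integral>x. g x \<partial>M)) \<le> (\<integral>x. h k x \<partial>M)"
      using f1[of k] g1 integral_abs_bound[of M "\<lambda>x. f k x - g x"] by (simp add: h_def)
  qed
  ultimately have "(\<lambda>k. (\<integral>x. f k x \<partial>M) - (\<integral>x. g x \<partial>M)) \<longlonglongrightarrow> 0"
    by (rule Lim_null_comparison[OF always_eventually, rotated])
  then show "(\<lambda>k. \<integral>x. f k x \<partial>M) \<longlonglongrightarrow> (\<integral>x. g x \<partial>M)"
    by (rule LIM_zero_cancel)
qed

lemma integrable_mult_squares: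
  fixes f g :: "'a \<Rightarrow> real"
  assumes "f \<in> borel_measurable M" "g \<in> borel_measurable M"
    and "integrable M (\<lambda>x. (f x)\<^sup>2)" "integrable M (\<lambda>x. (g x)\<^sup>2)"
  shows "integrable M (\<lambda>x. f x * g x)"
proof (rule Bochner_Integration.integrable_bound[of _ "\<lambda>x. (f x)\<^sup>2 + (g x)\<^sup>2"])
  have "\<bar>a * b\<bar> \<le> a\<^sup>2 + b\<^sup>2" for a b :: real
    using sum_squares_bound[of "\<bar>a\<bar>" "\<bar>b\<bar>"] abs_ge_zero[of "a * b"]
    unfolding abs_mult power2_abs by linarith
  then show "AE x in M. norm (f x * g x) \<le> norm ((f x)\<^sup>2 + (g x)\<^sup>2)"
    by (intro AE_I2) (simp add: abs_of_nonneg)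
qed (use assms in auto)

section \<open>Moments and orthogonality of increments under Wiener measure\<close>

context wiener
begin

lemma space_W: "space W = paths"
  using sets_eq_imp_space_eq[OF sets_W] by simp

lemma measurable_filtration_W: "f \<in> borel_measurable (path_filtration t) \<Longrightarrow> f \<in> borel_measurable W"
  using sets_path_filtration_subset[of t] sets_W space_W
  by (auto simp: measurable_def)

lemma measurable_coordinate_W [measurable]: "0 \<le> t \<Longrightarrow> (\<lambda>w. w t) \<in> borel_measurable W"
  by (rule measurable_filtration_W[OF measurable_coordinate[of t \<top>]]) auto

lemma increment_power:
  assumes "0 \<le> s" "s \<le> t"
  shows "integrable W (\<lambda>w. (w t - w s) ^ k)"
proof (cases "s = t")
  case True
  then show ?thesis by simp
next
  case False
  then have D: "distributed W lborel (\<lambda>w. w t - w s) (normal_density 0 (sqrt (t - s)))"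
    using assms increment_normal by simp
  have "integrable lborel (\<lambda>x. normal_density 0 (sqrt (t - s)) x * x ^ k)"
    using integrable_normal_moment[of "sqrt (t - s)" 0 k] False assms by simp
  then show ?thesis
    using distributed_integrable[OF D, of "\<lambda>x. x ^ k"] by simp
qed

lemma increment_mean:
  assumes "0 \<le> s" "s \<le> t"
  shows "(\<integral>w. w t - w s \<partial>W) = 0"
proof (cases "s = t")
  case False
  then have "s < t" using assms by simp
  then show ?thesis
    using normal_distributed_expectation[OF _ increment_normal[OF assms(1) \<open>s < t\<close>]] by simp
qed simp

lemma increment_variance:
  assumes "0 \<le> s" "s \<le> t"
  shows "(\<integral>w. (w t - w s)\<^sup>2 \<partial>W) = t - s"
proof (cases "s = t")
  case False
  then have "s < t" using assms by simp
  then show ?thesis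
    using normal_distributed_variance[OF _ increment_normal[OF assms(1) \<open>s < t\<close>]]
      increment_mean[OF assms] by simp
qed simp

lemma increment_mult:
  assumes st: "0 \<le> s" "s \<le> t"
    and Y: "Y \<in> adapted_at s" "integrable W Y"
    and h: "h \<in> borel_measurable borel" "integrable W (\<lambda>w. h (w t - w s) :: real)"
  shows "integrable W (\<lambda>w. Y w * h (w t - w s))"
    "(\<integral>w. Y w * h (w t - w s) \<partial>W) = (\<integral>w. Y w \<partial>W) * (\<integral>w. h (w t - w s) \<partial>W)"
proof -
  have "integrable W (\<lambda>w. Y w * h (w t - w s)) \<and>
    (\<integral>w. Y w * h (w t - w s) \<partial>W) = (\<integral>w. Y w \<partial>W) * (\<integral>w. h (w t - w s) \<partial>W)"
  proof (cases "s = t")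
    case True
    then show ?thesis using Y by (simp add: prob_space)
  next
    case False
    let ?I = "{(\<lambda>w. w t - w s) -` C \<inter> paths | C. C \<in> sets (borel::real measure)}"
    have X: "(\<lambda>w. w t - w s) \<in> borel_measurable W" using st by (intro borel_measurable_diff measurable_coordinate_W) auto
    have "indep_set (sets (path_filtration (ennreal s))) ?I"
      using increment_indep st False by simp
    moreover have "Int_stable ?I"
      by (rule Int_stable_vimage)
    ultimately have ind: "indep_set (sigma_sets paths (sets (path_filtration (ennreal s)))) (sigma_sets paths ?I)"
      using indep_set_sigma_sets[of "sets (path_filtration (ennreal s))" ?I]
        sets.Int_stable[of "path_filtration (ennreal s)"]
      unfolding space_W by simp
    have "indep_var borel Y borel (\<lambda>w. w t - w s)"
      unfolding indep_var_eq space_W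
    proof (intro conjI measurable_filtration_W[OF Y(1)] X)
      have "sigma_sets paths {Y -` A \<inter> paths |A. A \<in> sets borel} \<subseteq> sigma_sets paths (sets (path_filtration (ennreal s)))"
        using measurable_sets[OF Y(1)] by (intro sigma_sets_mono') auto
      then show "indep_set (sigma_sets paths {Y -` A \<inter> paths |A. A \<in> sets borel}) (sigma_sets paths ?I)"
        using ind unfolding indep_sets2_eq by blast
    qed
    then have "indep_var borel ((\<lambda>x. x) \<circ> Y) borel (h \<circ> (\<lambda>w. w t - w s))"
      using h(1) by (intro indep_var_compose) auto
    then have iv: "indep_var borel Y borel (\<lambda>w. h (w t - w s))"
      by (simp add: comp_def)
    show ?thesis
      using indep_var_integrable[OF iv Y(2) h(2)] indep_var_lebesgue_integral[OF iv Y(2) h(2)] by simp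
  qed
  then show "integrable W (\<lambda>w. Y w * h (w t - w s))"
    "(\<integral>w. Y w * h (w t - w s) \<partial>W) = (\<integral>w. Y w \<partial>W) * (\<integral>w. h (w t - w s) \<partial>W)"
    by auto
qed

lemma increment_orthogonal:
  assumes st: "0 \<le> s" "s \<le> t"
    and Y: "Y \<in> adapted_at s" "integrable W Y"
  shows "integrable W (\<lambda>w. Y w * (w t - w s))" "(\<integral>w. Y w * (w t - w s) \<partial>W) = 0"
    and "integrable W (\<lambda>w. Y w * ((w t - w s)\<^sup>2 - (t - s)))"
    and "(\<integral>w. Y w * ((w t - w s)\<^sup>2 - (t - s)) \<partial>W) = 0"
proof -
  note 1 = increment_mult[OF st Y, of "\<lambda>x. x"] increment_mult[OF st Y, of "\<lambda>x. x\<^sup>2 - (t - s)"]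
  have i: "integrable W (\<lambda>w. w t - w s)" "integrable W (\<lambda>w. (w t - w s)\<^sup>2)"
    using increment_power[OF st, of 1] increment_power[OF st, of 2] by simp_all
  show "integrable W (\<lambda>w. Y w * (w t - w s))" "(\<integral>w. Y w * (w t - w s) \<partial>W) = 0"
    using 1(1,2) i increment_mean[OF st] by simp_all
  have "(\<integral>w. (w t - w s)\<^sup>2 - (t - s) \<partial>W) = 0"
    using i increment_variance[OF st] by (simp add: prob_space)
  then show "integrable W (\<lambda>w. Y w * ((w t - w s)\<^sup>2 - (t - s)))"
    "(\<integral>w. Y w * ((w t - w s)\<^sup>2 - (t - s)) \<partial>W) = 0"
    using 1(3,4) i by simp_all
qed

text \<open>The martingale property is tested against bounded adapted variables, which avoids
  conditional expectations. The test with \<open>Y w * N s w\<close> is listed separately because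
  this weight may be unbounded; it makes second moments increase with time.\<close>

definition L2_martingale :: "(real \<Rightarrow> path \<Rightarrow> real) \<Rightarrow> bool" where
  "L2_martingale N \<longleftrightarrow>
     (\<forall>t\<ge>0. N t \<in> adapted_at t \<and> integrable W (\<lambda>w. (N t w)\<^sup>2)) \<and>
     (\<forall>w\<in>paths. continuous_on {0..} (\<lambda>t. N t w)) \<and>
     (\<forall>s t Y b. 0 \<le> s \<and> s \<le> t \<and> Y \<in> adapted_at s \<and> (\<forall>w\<in>paths. \<bar>Y w\<bar> \<le> b) \<longrightarrow>
        (\<integral>w. Y w * (N t w - N s w) \<partial>W) = 0 \<and> (\<integral>w. Y w * N s w * (N t w - N s w) \<partial>W) = 0)"

lemma integrable_bounded_mult:
  assumes "integrable W f" "Y \<in> borel_measurable W" "\<forall>w\<in>paths. \<bar>Y w\<bar> \<le> b"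
  shows "integrable W (\<lambda>w. Y w * f w :: real)"
proof (rule Bochner_Integration.integrable_bound[of _ "\<lambda>w. b * f w"])
  show "AE w in W. norm (Y w * f w) \<le> norm (b * f w)"
  proof (rule AE_I2)
    fix w assume "w \<in> space W"
    then have "\<bar>Y w\<bar> \<le> \<bar>b\<bar>" using assms(3) space_W by force
    then show "norm (Y w * f w) \<le> norm (b * f w)" by (simp add: abs_mult mult_right_mono)
  qed
qed (use assms in auto)

lemma coordinate_power: "0 \<le> t \<Longrightarrow> integrable W (\<lambda>w. (w t) ^ k)"
  using increment_power[of 0 t k] by (rule Bochner_Integration.integrable_cong[THEN iffD1, rotated -1])
    (auto simp: space_W path_0)

lemma L2_martingale_coordinate: "L2_martingale (\<lambda>t w. w t)"
  unfolding L2_martingale_def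
proof (intro conjI allI impI ballI)
  fix t :: real assume "0 \<le> t"
  then show "(\<lambda>w. w t) \<in> adapted_at t"
    "integrable W (\<lambda>w. (w t)\<^sup>2)"
    by (simp_all add: measurable_coordinate coordinate_power)
next
  fix w assume "w \<in> paths" then show "continuous_on {0..} (\<lambda>t. w t)" by (simp add: path_continuous)
next
  fix s t :: real and Y :: "path \<Rightarrow> real" and b assume *: "0 \<le> s \<and> s \<le> t \<and> Y \<in> adapted_at s \<and> (\<forall>w\<in>paths. \<bar>Y w\<bar> \<le> b)"
  have st: "0 \<le> s" "s \<le> t" and Y: "Y \<in> adapted_at s"
    and b: "\<forall>w\<in>paths. \<bar>Y w\<bar> \<le> b"
    using * by auto
  note YW = measurable_filtration_W[OF Y]
  have X: "(\<lambda>w. w s) \<in> adapted_at s"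
    using st by (simp add: measurable_coordinate)
  have i: "integrable W (\<lambda>w. w s)" using st coordinate_power[of s 1] by simp
  have "integrable W Y" using integrable_bounded_mult[OF _ YW b, of "\<lambda>_. 1"] by simp
  then show "(\<integral>w. Y w * (w t - w s) \<partial>W) = 0"
    by (rule increment_orthogonal(2)[OF st Y])
  show "(\<integral>w. Y w * w s * (w t - w s) \<partial>W) = 0"
    by (rule increment_orthogonal(2)[OF st borel_measurable_times[OF Y X] integrable_bounded_mult[OF i YW b]])
qed

lemma L2_martingale_square: "L2_martingale (\<lambda>t w. (w t)\<^sup>2 - t)"
  unfolding L2_martingale_def
proof (intro conjI allI impI ballI)
  fix t :: real assume t: "0 \<le> t"
  then have [measurable]: "(\<lambda>w. w t) \<in> adapted_at t"
    by (simp add: measurable_coordinate)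
  show "(\<lambda>w. (w t)\<^sup>2 - t) \<in> adapted_at t" by measurable
  have "integrable W (\<lambda>w. (w t)^4 - 2 * t * (w t)\<^sup>2 + t\<^sup>2)"
    using t coordinate_power by simp
  moreover have "((w t)\<^sup>2 - t)\<^sup>2 = (w t)^4 - 2 * t * (w t)\<^sup>2 + t\<^sup>2" for w :: path
    by (simp add: power2_eq_square power4_eq_xxxx algebra_simps)
  ultimately show "integrable W (\<lambda>w. ((w t)\<^sup>2 - t)\<^sup>2)" by simp
next
  fix w assume "w \<in> paths" then show "continuous_on {0..} (\<lambda>t. (w t)\<^sup>2 - t)"
    by (intro continuous_intros) (simp add: path_continuous)
next
  fix s t :: real and Y :: "path \<Rightarrow> real" and b assume *: "0 \<le> s \<and> s \<le> t \<and> Y \<in> adapted_at s \<and> (\<forall>w\<in>paths. \<bar>Y w\<bar> \<le> b)"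
  have st: "0 \<le> s" "s \<le> t" using * by auto
  have X[measurable]: "(\<lambda>w. w s) \<in> adapted_at s"
    using * by (simp add: measurable_coordinate)
  have Y[measurable]: "Y \<in> adapted_at s" and b: "\<forall>w\<in>paths. \<bar>Y w\<bar> \<le> b"
    using * by auto
  note YW = measurable_filtration_W[OF Y]
  have eq: "(w t)\<^sup>2 - t - ((w s)\<^sup>2 - s) = 2 * w s * (w t - w s) + ((w t - w s)\<^sup>2 - (t - s))" for w :: path
    by (simp add: power2_eq_square algebra_simps)
  \<comment> \<open>The weight \<open>Z\<close> is only integrable, because it is used for
    \<open>Y w * ((w s)\<^sup>2 - s)\<close> as well as for \<open>Y\<close>. The former brings in
    the third moment of \<open>w s\<close>.\<close>
  have key: "(\<integral>w. Z w * ((w t)\<^sup>2 - t - ((w s)\<^sup>2 - s)) \<partial>W) = 0"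
    if Z[measurable]: "Z \<in> adapted_at s"
      and i: "integrable W Z" "integrable W (\<lambda>w. Z w * w s)" for Z
  proof -
    have "integrable W (\<lambda>w. 2 * (Z w * w s))" using i by simp
    note 1 = increment_orthogonal(1,2)[OF st _ this] increment_orthogonal(3,4)[OF st Z i(1)]
    have "(\<integral>w. Z w * ((w t)\<^sup>2 - t - ((w s)\<^sup>2 - s)) \<partial>W) =
      (\<integral>w. 2 * (Z w * w s) * (w t - w s) + Z w * ((w t - w s)\<^sup>2 - (t - s)) \<partial>W)"
      unfolding eq by (intro Bochner_Integration.integral_cong) (auto simp: algebra_simps)
    also have "\<dots> = 0"
      using 1 by (subst Bochner_Integration.integral_add) auto
    finally show ?thesis .
  qed
  have p: "integrable W (\<lambda>w. w s)" "integrable W (\<lambda>w. (w s)\<^sup>2)" "integrable W (\<lambda>w. (w s)^3)"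
    using st coordinate_power[of s 1] coordinate_power[of s 2] coordinate_power[of s 3] by simp_all
  have "integrable W Y" using integrable_bounded_mult[OF _ YW b, of "\<lambda>_. 1"] by simp
  then show "(\<integral>w. Y w * ((w t)\<^sup>2 - t - ((w s)\<^sup>2 - s)) \<partial>W) = 0"
    by (rule key[OF Y _ integrable_bounded_mult[OF p(1) YW b]])
  have eq3: "((w s)\<^sup>2 - s) * w s = (w s)^3 - s * w s" for w :: path
    by (simp add: power2_eq_square power3_eq_cube algebra_simps)
  have "integrable W (\<lambda>w. Y w * ((w s)\<^sup>2 - s))"
    by (rule integrable_bounded_mult[OF _ YW b]) (simp add: p)
  moreover have "integrable W (\<lambda>w. Y w * ((w s)\<^sup>2 - s) * w s)"
    unfolding mult.assoc eq3 by (rule integrable_bounded_mult[OF _ YW b]) (simp add: p)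
  ultimately show "(\<integral>w. Y w * ((w s)\<^sup>2 - s) * ((w t)\<^sup>2 - t - ((w s)\<^sup>2 - s)) \<partial>W) = 0"
    by (rule key[rotated]) simp
qed

end

section \<open>Optional stopping and the lower bound\<close>

text \<open>A stake fixed at \<open>T\<close> is known at time \<open>t\<close> on the event that
  \<open>T\<close> has occurred by then. This supplies the adapted weights for optional
  stopping.\<close>

lemma measurable_before_stopping_time:
  assumes T: "stopping_time path_filtration T"
    and Y: "Y \<in> borel_measurable (stopped_sigma T)"
  shows "(\<lambda>w. if T w \<le> t then Y w else 0 :: real) \<in> borel_measurable (path_filtration t)"
proof -
  interpret filtration paths path_filtration by (rule filtration_path_filtration)
  have le: "{w \<in> paths. T w \<le> t} \<in> sets (path_filtration t)"
    using stopping_timeD[OF T, of t] by (simp add: pred_def)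
  show ?thesis
  proof (rule borel_measurableI)
    fix B :: "real set" assume "open B"
    then have "{w \<in> Y -` B \<inter> space (pre_sigma T). T w \<le> t} \<in> sets (path_filtration t)"
      by (intro sets_pre_sigmaD[OF T] measurable_sets[OF Y]) auto
    moreover have "(\<lambda>w. if T w \<le> t then Y w else 0) -` B \<inter> space (path_filtration t) =
      {w \<in> Y -` B \<inter> space (pre_sigma T). T w \<le> t} \<union> (if 0 \<in> B then space (path_filtration t) - {w \<in> paths. T w \<le> t} else {})"
      by (auto simp: space_pre_sigma split: if_splits)
    ultimately show "(\<lambda>w. if T w \<le> t then Y w else 0) -` B \<inter> space (path_filtration t) \<in> sets (path_filtration t)"
      using le sets.top[of "path_filtration t"] by (auto intro!: sets.Un sets.Diff)
  qed
qed

lemma measurable_pre_sigma_subset: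
  assumes T: "stopping_time path_filtration T"
    and Y: "Y \<in> borel_measurable (stopped_sigma T)"
  shows "Y \<in> borel_measurable path_sigma"
proof -
  interpret filtration paths path_filtration by (rule filtration_path_filtration)
  show ?thesis
  proof (rule measurableI)
    fix B :: "'a set" assume "B \<in> sets borel"
    then have "{w \<in> Y -` B \<inter> space (pre_sigma T). T w \<le> \<top>} \<in> sets (path_filtration \<top>)"
      by (intro sets_pre_sigmaD[OF T] measurable_sets[OF Y]) auto
    then show "Y -` B \<inter> space path_sigma \<in> sets path_sigma"
      by (simp add: space_pre_sigma vimage_def Int_def)
  qed simp
qed

context wiener
begin

lemma L2_martingaleD:
  assumes "L2_martingale N"
  shows "0 \<le> t \<Longrightarrow> N t \<in> adapted_at t"
    "0 \<le> t \<Longrightarrow> N t \<in> borel_measurable W"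
    "0 \<le> t \<Longrightarrow> integrable W (\<lambda>w. (N t w)\<^sup>2)"
    "0 \<le> t \<Longrightarrow> integrable W (N t)"
    "w \<in> paths \<Longrightarrow> continuous_on {0..} (\<lambda>t. N t w)"
proof -
  show 1: "0 \<le> t \<Longrightarrow> N t \<in> adapted_at t" 
    "0 \<le> t \<Longrightarrow> integrable W (\<lambda>w. (N t w)\<^sup>2)"
    "w \<in> paths \<Longrightarrow> continuous_on {0..} (\<lambda>t. N t w)" for t w
    using assms unfolding L2_martingale_def by blast+
  show 2: "0 \<le> t \<Longrightarrow> N t \<in> borel_measurable W" by (rule measurable_filtration_W[OF 1(1)])
  show "0 \<le> t \<Longrightarrow> integrable W (N t)"
    by (rule square_integrable_imp_integrable[OF 2 1(2)])
qed

lemma L2_martingale_orth: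
  assumes "L2_martingale N" "0 \<le> s" "s \<le> t"
    and "Y \<in> adapted_at s" "\<forall>w\<in>paths. \<bar>Y w\<bar> \<le> b"
  shows "(\<integral>w. Y w * (N t w - N s w) \<partial>W) = 0"
    "(\<integral>w. Y w * N s w * (N t w - N s w) \<partial>W) = 0"
  using assms unfolding L2_martingale_def by blast+

text \<open>In the expansion of the nonnegative \<open>Y w * (N t w - N s w)\<^sup>2\<close> the
  cross term integrates to zero. This is the conditional Jensen inequality for the square, tested
  against \<open>Y\<close>.\<close>

lemma L2_martingale_square_mono:
  assumes N: "L2_martingale N" and st: "0 \<le> s" "s \<le> t"
    and Y: "Y \<in> adapted_at s" "\<forall>w\<in>paths. \<bar>Y w\<bar> \<le> b"
    and nonneg: "\<And>w. w \<in> paths \<Longrightarrow> 0 \<le> Y w"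
  shows "(\<integral>w. Y w * (N s w)\<^sup>2 \<partial>W) \<le> (\<integral>w. Y w * (N t w)\<^sup>2 \<partial>W)"
proof -
  have t: "0 \<le> t" using st by simp
  note YW = measurable_filtration_W[OF Y(1)]
  have i: "integrable W (\<lambda>w. Y w * (N s w)\<^sup>2)" "integrable W (\<lambda>w. Y w * (N t w)\<^sup>2)"
    using L2_martingaleD[OF N] st t by (auto intro!: integrable_bounded_mult[OF _ YW Y(2)])
  have "integrable W (\<lambda>w. N s w * N t w)" 
    using L2_martingaleD[OF N] st t by (intro integrable_mult_squares) auto
  then have "integrable W (\<lambda>w. Y w * (N s w * N t w))"
    by (rule integrable_bounded_mult[OF _ YW Y(2)])
  then have i2: "integrable W (\<lambda>w. Y w * N s w * (N t w - N s w))"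
    using Bochner_Integration.integrable_diff[OF _ i(1)] by (simp add: algebra_simps power2_eq_square)
  have "(\<integral>w. Y w * (N s w)\<^sup>2 \<partial>W) = (\<integral>w. Y w * (N s w)\<^sup>2 + 2 * (Y w * N s w * (N t w - N s w)) \<partial>W)"
    using i i2 L2_martingale_orth(2)[OF N st Y] by simp
  also have "\<dots> \<le> (\<integral>w. Y w * (N t w)\<^sup>2 \<partial>W)"
  proof (intro integral_mono)
    fix w assume "w \<in> space W"
    then have "0 \<le> Y w * (N t w - N s w)\<^sup>2" using nonneg space_W by simp
    then show "Y w * (N s w)\<^sup>2 + 2 * (Y w * N s w * (N t w - N s w)) \<le> Y w * (N t w)\<^sup>2"
      by (simp add: power2_eq_square algebra_simps)
  qed (use i i2 in auto)
  finally show ?thesis .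
qed

text \<open>The time \<open>u\<close> is rounded up to a finite grid, which keeps the stake adapted
  and reduces the claim to the martingale property at fixed times. Second moments at the rounded
  times are at most that of \<open>N t\<close>, so the identity survives refinement of the
  grid.\<close>

lemma optional_stopping:
  assumes N: "L2_martingale N" and T: "stopping_time path_filtration T"
    and Y: "Y \<in> borel_measurable (stopped_sigma T)"
    and b: "\<forall>w\<in>paths. \<bar>Y w\<bar> \<le> b" and t: "0 \<le> t"
  defines "u \<equiv> \<lambda>w. enn2real (min (T w) (ennreal t))"
  shows "integrable W (\<lambda>w. Y w * (N t w - N (u w) w))"
    "(\<integral>w. Y w * (N t w - N (u w) w) \<partial>W) = 0"
proof -
  have u: "0 \<le> u w" "u w \<le> t" "ennreal (u w) = min (T w) (ennreal t)" for w
  proof -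
    show "0 \<le> u w" by (simp add: u_def)
    show *: "ennreal (u w) = min (T w) (ennreal t)"
      unfolding u_def by (rule ennreal_enn2real) (simp add: min_less_iff_disj)
    show "u w \<le> t" using t * by (metis ennreal_le_iff min.cobounded2)
  qed
  \<comment> \<open>The case \<open>s = t\<close> is excluded because \<open>u w \<le> t\<close>
    holds even when \<open>T w\<close> is larger.\<close>
  have u_le: "u w \<le> s \<longleftrightarrow> T w \<le> ennreal s" if "0 \<le> s" "s < t" for s w
    using ennreal_le_iff[OF that(1), of "u w"] ennreal_le_iff[OF that(1), of t] that
    by (simp add: u(3) min_le_iff_disj)
  have YW: "Y \<in> borel_measurable W"
    using measurable_pre_sigma_subset[OF T Y] by (rule measurable_filtration_W)
  define s where "s k j = t * real j / real (Suc k)" for k j :: nat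
  \<comment> \<open>\<open>J k w\<close> is the index of the first grid point that is not before
    \<open>u w\<close>.\<close>
  define J where "J k w = (if t = 0 then 0 else nat \<lceil>real (Suc k) * u w / t\<rceil>)" for k :: nat and w
  define I where "I k j w = (if J k w = j then 1 else 0 :: real)" for k j w
  have s: "0 \<le> s k j" "j \<le> Suc k \<Longrightarrow> s k j \<le> t" "s k (Suc k) = t" for k j
  proof -
    show "0 \<le> s k j" "s k (Suc k) = t" using t by (simp_all add: s_def)
    assume "j \<le> Suc k"
    then have "t * (real j / real (Suc k)) \<le> t * 1"
      using t by (intro mult_left_mono) auto
    then show "s k j \<le> t" by (simp add: s_def)
  qed
  have s_less: "s k j < t" if "j \<le> k" "0 < t" for k j
  proof -
    have "t * (real j / real (Suc k)) < t * 1"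
      using that by (intro mult_strict_left_mono) auto
    then show ?thesis by (simp add: s_def)
  qed
  have J_le_iff: "J k w \<le> j \<longleftrightarrow> u w \<le> s k j" for k j w
  proof (cases "t = 0")
    case True
    then show ?thesis using u(2)[of w] by (simp add: J_def s_def)
  next
    case False
    then have "J k w \<le> j \<longleftrightarrow> real (Suc k) * u w / t \<le> real j"
      by (simp add: J_def nat_le_iff ceiling_le_iff)
    also have "\<dots> \<longleftrightarrow> u w \<le> s k j"
      using False t unfolding s_def by (subst pos_divide_le_eq, simp) (subst pos_le_divide_eq, simp, simp only: mult.commute)
    finally show ?thesis .
  qed
  have J_le: "J k w \<le> Suc k" for k w
    unfolding J_le_iff s(3) by (rule u)
  have s_J: "u w \<le> s k (J k w)" "s k (J k w) \<le> u w + t / real (Suc k)" for k w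
  proof -
    show "u w \<le> s k (J k w)" using J_le_iff[of k w "J k w"] by simp
    show "s k (J k w) \<le> u w + t / real (Suc k)"
    proof (cases "J k w")
      case 0
      then show ?thesis using u(1)[of w] t by (simp add: s_def)
    next
      case (Suc j)
      then have "s k j < u w" using J_le_iff[of k w j] by simp
      moreover have "s k (Suc j) = s k j + t / real (Suc k)"
        by (simp add: s_def add_divide_distrib[symmetric] algebra_simps)
      ultimately show ?thesis using Suc by simp
    qed
  qed
  \<comment> \<open>The index \<open>Suc k\<close> is left out: for \<open>t > 0\<close> its event
    contains the paths with \<open>T\<close> beyond \<open>t\<close>, whose stake need not be known
    at \<open>t\<close>. The grid point is then \<open>t\<close> itself and the martingale increment
    vanishes.\<close>
  have I_meas: "(\<lambda>w. Y' w * I k j w) \<in> adapted_at (s k j)"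
    if Y': "Y' \<in> borel_measurable (stopped_sigma T)" and jk: "j \<le> k" "0 < t" for Y' k j
  proof -
    have 1: "(\<lambda>w. if T w \<le> ennreal (s k j) then Y' w else 0) \<in> adapted_at (s k j)"
      by (rule measurable_before_stopping_time[OF T Y'])
    have "(\<lambda>w. if 0 < j \<and> T w \<le> ennreal (s k (j - 1)) then 0 else 1 :: real) \<in> adapted_at (s k j)"
    proof (cases "j = 0")
      case False
      have le: "s k (j - 1) \<le> s k j" using t by (auto simp: s_def intro!: divide_right_mono mult_left_mono)
      have "Measurable.pred (path_filtration (ennreal (s k j))) (\<lambda>w. T w \<le> ennreal (s k (j - 1)))"
        by (rule filtration.stopping_time_le_const[OF filtration_path_filtration T ennreal_leI[OF le]])
      then show ?thesis using False by (intro measurable_If) (auto simp: pred_def)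
    qed simp
    note 2 = borel_measurable_times[OF 1 this]
    show ?thesis
    proof (rule measurable_cong[THEN iffD1, OF _ 2])
      fix w
      have "j - 1 \<le> k" using jk by simp
      then have "J k w = j \<longleftrightarrow> T w \<le> ennreal (s k j) \<and> \<not> (0 < j \<and> T w \<le> ennreal (s k (j - 1)))"
        using u_le[OF s(1) s_less[OF jk], of w] u_le[OF s(1) s_less[of "j - 1" k], of w]
          J_le_iff[of k w j] J_le_iff[of k w "j - 1"] jk
        by auto
      then show "(if T w \<le> ennreal (s k j) then Y' w else 0) * (if 0 < j \<and> T w \<le> ennreal (s k (j - 1)) then 0 else 1) = Y' w * I k j w"
        by (simp add: I_def)
    qed
  qed
  have J_meas: "(\<lambda>w. I k j w) \<in> borel_measurable W" for k j
  proof -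
    have "T \<in> borel_measurable path_sigma"
      using sets_path_filtration_subset by (intro measurable_stopping_time[OF T]) auto
    then have "u \<in> borel_measurable path_sigma" unfolding u_def by measurable
    then have "u \<in> borel_measurable W" by (rule measurable_filtration_W)
    have "J k \<in> measurable W (count_space UNIV)"
      unfolding J_def using \<open>u \<in> borel_measurable W\<close> by measurable
    then show ?thesis unfolding I_def by measurable
  qed
  have I01: "\<bar>I k j w\<bar> \<le> 1" for k j w by (simp add: I_def)
  \<comment> \<open>Exactly one indicator equals \<open>1\<close>, so a value at the random grid
    point becomes a finite sum over fixed times.\<close>
  have sum_I: "(\<Sum>j\<le>Suc k. I k j w * f j) = f (J k w)" for k w and f :: "nat \<Rightarrow> real"
    using sum.delta[of "{..Suc k}" "J k w" f] J_le[of k w] unfolding I_def by (simp add: if_distrib if_distribR eq_commute cong: if_cong)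
  define \<sigma> where "\<sigma> k w = s k (J k w)" for k w
  have N\<sigma>_eq: "N (\<sigma> k w) w = (\<Sum>j\<le>Suc k. I k j w * N (s k j) w)" 
    "(N (\<sigma> k w) w)\<^sup>2 = (\<Sum>j\<le>Suc k. I k j w * (N (s k j) w)\<^sup>2)" for k w
    using sum_I[of k w "\<lambda>j. N (s k j) w"] sum_I[of k w "\<lambda>j. (N (s k j) w)\<^sup>2"] by (simp_all add: \<sigma>_def)
  have N\<sigma>_meas: "(\<lambda>w. N (\<sigma> k w) w) \<in> borel_measurable W" for k
    unfolding N\<sigma>_eq(1) using J_meas L2_martingaleD(2)[OF N s(1)]
    by (intro borel_measurable_sum borel_measurable_times) auto
  have I_sq: "integrable W (\<lambda>w. I k j w * (N r w)\<^sup>2)" if "0 \<le> r" for k j r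
    using L2_martingaleD(3)[OF N that] by (rule integrable_bounded_mult[OF _ J_meas]) (use I01 in blast)
  have N\<sigma>2: "integrable W (\<lambda>w. (N (\<sigma> k w) w)\<^sup>2)" for k
    unfolding N\<sigma>_eq(2) by (intro Bochner_Integration.integrable_sum I_sq s(1))
  have E\<sigma>: "(\<integral>w. (N (\<sigma> k w) w)\<^sup>2 \<partial>W) \<le> (\<integral>w. (N t w)\<^sup>2 \<partial>W)" for k
  proof -
    have "(\<integral>w. (N (\<sigma> k w) w)\<^sup>2 \<partial>W) = (\<Sum>j\<le>Suc k. \<integral>w. I k j w * (N (s k j) w)\<^sup>2 \<partial>W)"
      unfolding N\<sigma>_eq(2) by (intro Bochner_Integration.integral_sum I_sq s(1))
    also have "\<dots> \<le> (\<Sum>j\<le>Suc k. \<integral>w. I k j w * (N t w)\<^sup>2 \<partial>W)"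
    proof (rule sum_mono)
      fix j assume j: "j \<in> {..Suc k}"
      show "(\<integral>w. I k j w * (N (s k j) w)\<^sup>2 \<partial>W) \<le> (\<integral>w. I k j w * (N t w)\<^sup>2 \<partial>W)"
      proof (cases "j = Suc k \<or> t = 0")
        case True
        then have "s k j = t" using s(3) by (auto simp: s_def)
        then show ?thesis by simp
      next
        case False
        then have jk: "j \<le> k" "0 < t" using j t by auto
        show ?thesis
        proof (rule L2_martingale_square_mono[OF N s(1) s(2)])
          show "I k j \<in> adapted_at (s k j)"
            using I_meas[OF _ jk, of "\<lambda>_. 1"] by simp
        qed (use j I01 in \<open>auto simp: I_def\<close>)
      qed
    qed
    also have "\<dots> = (\<integral>w. (\<Sum>j\<le>Suc k. I k j w * (N t w)\<^sup>2) \<partial>W)"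
      by (rule Bochner_Integration.integral_sum[symmetric]) (rule I_sq[OF t])
    also have "\<dots> = (\<integral>w. (N t w)\<^sup>2 \<partial>W)"
      by (simp only: sum_I)
    finally show ?thesis .
  qed
  have b0: "\<forall>w\<in>paths. (Y w)\<^sup>2 \<le> b\<^sup>2"
    using b by (metis abs_ge_zero power2_abs power_mono)
  define f where "f k w = Y w * (N t w - N (\<sigma> k w) w)" for k w
  have f_meas: "f k \<in> borel_measurable W" for k
    unfolding f_def using YW N\<sigma>_meas L2_martingaleD(2)[OF N t] by (intro borel_measurable_times borel_measurable_diff) auto
  have f_bound: "(f k w)\<^sup>2 \<le> b\<^sup>2 * (2 * (N t w)\<^sup>2 + 2 * (N (\<sigma> k w) w)\<^sup>2)" if "w \<in> paths" for k w
  proof -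
    have "(N t w - N (\<sigma> k w) w)\<^sup>2 \<le> 2 * (N t w)\<^sup>2 + 2 * (N (\<sigma> k w) w)\<^sup>2"
      using zero_le_power2[of "N t w + N (\<sigma> k w) w"] by (simp add: power2_eq_square algebra_simps)
    then show ?thesis
      unfolding f_def power_mult_distrib using b0 that by (intro mult_mono) auto
  qed
  have f_dom: "integrable W (\<lambda>w. b\<^sup>2 * (2 * (N t w)\<^sup>2 + 2 * (N (\<sigma> k w) w)\<^sup>2))" for k
    using N\<sigma>2[of k] L2_martingaleD(3)[OF N t] by simp
  have f2: "integrable W (\<lambda>w. (f k w)\<^sup>2)" for k
  proof (rule Bochner_Integration.integrable_bound[OF f_dom])
    show "AE w in W. norm ((f k w)\<^sup>2) \<le> norm (b\<^sup>2 * (2 * (N t w)\<^sup>2 + 2 * (N (\<sigma> k w) w)\<^sup>2))"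
      using f_bound by (intro AE_I2) (simp add: space_W)
    show "(\<lambda>w. (f k w)\<^sup>2) \<in> borel_measurable W" using f_meas by measurable
  qed
  have Ef2: "(\<integral>w. (f k w)\<^sup>2 \<partial>W) \<le> b\<^sup>2 * (4 * (\<integral>w. (N t w)\<^sup>2 \<partial>W))" for k
  proof -
    have "(\<integral>w. (f k w)\<^sup>2 \<partial>W) \<le> (\<integral>w. b\<^sup>2 * (2 * (N t w)\<^sup>2 + 2 * (N (\<sigma> k w) w)\<^sup>2) \<partial>W)"
      using f_bound space_W by (intro integral_mono f2 f_dom) auto
    also have "\<dots> = b\<^sup>2 * (2 * (\<integral>w. (N t w)\<^sup>2 \<partial>W) + 2 * (\<integral>w. (N (\<sigma> k w) w)\<^sup>2 \<partial>W))"
      using N\<sigma>2[of k] L2_martingaleD(3)[OF N t] by simp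
    also have "\<dots> \<le> b\<^sup>2 * (4 * (\<integral>w. (N t w)\<^sup>2 \<partial>W))"
      using E\<sigma>[of k] by (intro mult_left_mono) auto
    finally show ?thesis .
  qed
  have Ef: "(\<integral>w. f k w \<partial>W) = 0" for k
  proof -
    let ?Z = "\<lambda>j w. Y w * I k j w * (N t w - N (s k j) w)"
    have bI: "\<forall>w\<in>paths. \<bar>Y w * I k j w\<bar> \<le> b" for j
      using b by (force simp: I_def)
    have "f k w = (\<Sum>j\<le>Suc k. ?Z j w)" for w
      using sum_I[of k w "\<lambda>j. Y w * (N t w - N (s k j) w)"] by (simp add: f_def \<sigma>_def mult_ac)
    then have "(\<integral>w. f k w \<partial>W) = (\<integral>w. (\<Sum>j\<le>Suc k. ?Z j w) \<partial>W)" by simp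
    also have "\<dots> = (\<Sum>j\<le>Suc k. \<integral>w. ?Z j w \<partial>W)"
      using L2_martingaleD(4)[OF N t] L2_martingaleD(4)[OF N s(1)] YW J_meas
      by (intro Bochner_Integration.integral_sum integrable_bounded_mult[OF _ _ bI]) auto
    also have "\<dots> = 0"
    proof (rule sum.neutral, rule ballI)
      fix j assume j: "j \<in> {..Suc k}"
      show "(\<integral>w. ?Z j w \<partial>W) = 0"
      proof (cases "j = Suc k \<or> t = 0")
        case True
        then have "s k j = t" using s(3) by (auto simp: s_def)
        then show ?thesis by simp
      next
        case False
        then have jk: "j \<le> k" "0 < t" using j t by auto
        show ?thesis
          using j by (intro L2_martingale_orth(1)[OF N s(1) s(2) I_meas[OF Y jk] bI]) auto
      qed
    qed
    finally show ?thesis .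
  qed
  have \<sigma>_lim: "(\<lambda>k. \<sigma> k w) \<longlonglongrightarrow> u w" for w
  proof (rule tendsto_sandwich[of "\<lambda>_. u w" _ _ "\<lambda>k. u w + t / real (Suc k)"])
    show "(\<lambda>k. u w + t / real (Suc k)) \<longlonglongrightarrow> u w"
      using tendsto_add[OF tendsto_const[of "u w"] tendsto_mult[OF tendsto_const[of t] LIMSEQ_inverse_real_of_nat]]
      by (simp add: divide_inverse)
  qed (use s_J in \<open>auto simp: \<sigma>_def\<close>)
  have f_lim: "(\<lambda>k. f k w) \<longlonglongrightarrow> Y w * (N t w - N (u w) w)" if "w \<in> space W" for w
    unfolding f_def
    by (intro tendsto_intros continuous_on_tendsto_compose[OF L2_martingaleD(5)[OF N] \<sigma>_lim])
       (use that space_W u(1) s(1) in \<open>auto simp: \<sigma>_def\<close>)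
  note lim = integral_tendsto_of_L2_bounded[OF f_meas f_lim f2 Ef2]
  show "integrable W (\<lambda>w. Y w * (N t w - N (u w) w))"
    by (rule square_integrable_imp_integrable[OF borel_measurable_LIMSEQ_real[OF f_lim f_meas] lim(1)])
  show "(\<integral>w. Y w * (N t w - N (u w) w) \<partial>W) = 0"
    using lim(2) unfolding Ef by (simp add: LIMSEQ_const_iff)
qed

text \<open>Subtract the statements for \<open>T\<close> and \<open>T'\<close>; a stake known at
  \<open>T\<close> is also known at the later \<open>T'\<close>.\<close>

lemma optional_stopping_increment:
  assumes N: "L2_martingale N"
    and T: "stopping_time path_filtration T" "stopping_time path_filtration T'"
    and le: "\<forall>w\<in>paths. T w \<le> T' w"
    and Y: "Y \<in> borel_measurable (stopped_sigma T)"
    and b: "bounded (Y ` paths)" and t: "0 \<le> t"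
  defines "u \<equiv> \<lambda>w. enn2real (min (T w) (ennreal t))"
    and "u' \<equiv> \<lambda>w. enn2real (min (T' w) (ennreal t))"
  shows "integrable W (\<lambda>w. Y w * (N (u' w) w - N (u w) w))"
    "(\<integral>w. Y w * (N (u' w) w - N (u w) w) \<partial>W) = 0"
proof -
  interpret filtration paths path_filtration by (rule filtration_path_filtration)
  obtain b' where b': "\<forall>w\<in>paths. \<bar>Y w\<bar> \<le> b'"
    using b unfolding bounded_iff by auto
  have Y': "Y \<in> borel_measurable (pre_sigma T')"
    using mono_pre_sigma[OF T] le measurable_mono[of borel borel "pre_sigma T" "pre_sigma T'"] Y
    by (auto simp: space_pre_sigma)
  note 1 = optional_stopping[OF N T(1) Y b' t] optional_stopping[OF N T(2) Y' b' t]
  have eq: "Y w * (N (u' w) w - N (u w) w) =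
    Y w * (N t w - N (u w) w) - Y w * (N t w - N (u' w) w)" for w
    by (simp add: algebra_simps)
  show "integrable W (\<lambda>w. Y w * (N (u' w) w - N (u w) w))"
    unfolding eq using 1 unfolding u_def u'_def by (intro Bochner_Integration.integrable_diff)
  show "(\<integral>w. Y w * (N (u' w) w - N (u w) w) \<partial>W) = 0"
    unfolding eq using 1 unfolding u_def u'_def by (subst Bochner_Integration.integral_diff) auto
qed

end

section \<open>Expectations of elementary capital processes\<close>

definition capital_term :: "strategy \<Rightarrow> real \<Rightarrow> path \<Rightarrow> nat \<Rightarrow> real" where
  "capital_term G t w n =
     stake_M G n w * (w (truncated_time G (Suc n) t w) - w (truncated_time G n t w)) +
     stake_V G n w * (((w (truncated_time G (Suc n) t w))\<^sup>2 - truncated_time G (Suc n) t w) -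
       ((w (truncated_time G n t w))\<^sup>2 - truncated_time G n t w))"

lemma capital_eq_suminf: "capital G c t w = c + (\<Sum>n. capital_term G t w n)"
  by (simp add: capital_def capital_term_def Let_def)

lemma elementary_strategyD:
  assumes "elementary_strategy G"
  shows "stopping_time path_filtration (stop_time G n)"
    "w \<in> paths \<Longrightarrow> m \<le> n \<Longrightarrow> stop_time G m w \<le> stop_time G n w"
    "stake_M G n \<in> borel_measurable (stopped_sigma (stop_time G n))"
    "bounded (stake_M G n ` paths)"
    "stake_V G n \<in> borel_measurable (stopped_sigma (stop_time G n))"
    "bounded (stake_V G n ` paths)"
  using assms unfolding elementary_strategy_def by (auto simp: incseq_def)

lemma capital_term_eq_0:
  "truncated_time G n t w = t \<Longrightarrow> truncated_time G (Suc n) t w = t \<Longrightarrow> capital_term G t w n = 0"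
  by (simp add: capital_term_def)

lemma capital_eventually_sum:
  assumes G: "elementary_strategy G" "w \<in> paths" "0 \<le> t"
  shows "\<forall>\<^sub>F N in sequentially. capital G c t w = c + (\<Sum>n<N. capital_term G t w n)"
proof -
  obtain N0 where N0: "\<And>n. n \<ge> N0 \<Longrightarrow> truncated_time G n t w = t \<and> truncated_time G (Suc n) t w = t"
    using eventually_truncated_time[OF G] unfolding eventually_sequentially by blast
  have "capital G c t w = c + (\<Sum>n<N. capital_term G t w n)" if "N \<ge> N0" for N
    unfolding capital_eq_suminf using N0 that
    by (subst suminf_finite[of "{..<N}"]) (auto intro!: capital_term_eq_0)
  then show ?thesis unfolding eventually_sequentially by blast
qed

text \<open>Thus the partial sums of a nonnegative capital process are nonnegative, as Fatou's lemma
  requires.\<close>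

lemma capital_partial_sum:
  assumes G: "elementary_strategy G" "w \<in> paths" "0 \<le> t"
  shows "c + (\<Sum>n<N. capital_term G t w n) = capital G c (truncated_time G N t w) w"
proof -
  let ?t = "truncated_time G N t w"
  have t': "ennreal ?t = min (stop_time G N w) (ennreal t)"
    unfolding truncated_time_def by (rule ennreal_enn2real) (simp add: min_less_iff_disj)
  have t'0: "0 \<le> ?t" by (simp add: truncated_time_def)
  \<comment> \<open>Freezing the clock at the \<open>N\<close>-th stopping time leaves the first
    \<open>N\<close> terms unchanged and makes all later ones vanish.\<close>
  have early: "truncated_time G n ?t w = truncated_time G n t w" if "n \<le> N" for n
    unfolding truncated_time_def[of G n] t'
    using elementary_strategyD(2)[OF G(1,2) that] by (simp add: min.assoc[symmetric] min_absorb1)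
  have late: "truncated_time G n ?t w = ?t" if "N \<le> n" for n
  proof -
    have "min (stop_time G n w) (min (stop_time G N w) (ennreal t)) = min (stop_time G N w) (ennreal t)"
      using elementary_strategyD(2)[OF G(1,2) that] by (intro min_absorb2) (simp add: min.coboundedI1)
    then show ?thesis
      unfolding truncated_time_def[of G n] t' by (simp add: truncated_time_def)
  qed
  have "(\<Sum>n. capital_term G ?t w n) = (\<Sum>n<N. capital_term G ?t w n)"
    using late by (intro suminf_finite) (auto intro!: capital_term_eq_0)
  also have "\<dots> = (\<Sum>n<N. capital_term G t w n)"
    using early by (intro sum.cong) (auto simp: capital_term_def)
  finally show ?thesis by (simp add: capital_eq_suminf)
qed

context wiener
begin

lemma capital_term_integral:
  assumes G: "elementary_strategy G" and t: "0 \<le> t"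
  shows "integrable W (\<lambda>w. capital_term G t w n)" "(\<integral>w. capital_term G t w n \<partial>W) = 0"
proof -
  note D = elementary_strategyD[OF G]
  have le: "\<forall>w\<in>paths. stop_time G n w \<le> stop_time G (Suc n) w"
    using D(2) by simp
  note 1 = optional_stopping_increment[OF L2_martingale_coordinate D(1)[of n] D(1)[of "Suc n"] le D(3,4)[of n] t]
  note 2 = optional_stopping_increment[OF L2_martingale_square D(1)[of n] D(1)[of "Suc n"] le D(5,6)[of n] t]
  show "integrable W (\<lambda>w. capital_term G t w n)"
    unfolding capital_term_def truncated_time_def by (intro Bochner_Integration.integrable_add 1(1) 2(1))
  show "(\<integral>w. capital_term G t w n \<partial>W) = 0"
    unfolding capital_term_def truncated_time_def
    by (subst Bochner_Integration.integral_add[OF 1(1) 2(1)])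
       (rule trans[OF arg_cong2[where f="(+)", OF 1(2) 2(2)]], simp)
qed

text \<open>The number of nonzero terms depends on the path, so the capital need not be a single
  finite sum. The partial sums are nonnegative with mean exactly \<open>c\<close>, and Fatou's lemma
  leaves an inequality in the limit.\<close>

lemma capital_expectation:
  assumes G: "elementary_strategy G" and t: "0 \<le> t"
    and nonneg: "\<And>t w. 0 \<le> t \<Longrightarrow> w \<in> paths \<Longrightarrow> 0 \<le> capital G c t w"
  shows "capital G c t \<in> borel_measurable W" "(\<integral>\<^sup>+w. ennreal (capital G c t w) \<partial>W) \<le> ennreal c"
proof -
  define S where "S N w = c + (\<Sum>n<N. capital_term G t w n)" for N w
  have S_int: "integrable W (S N)" for N
    unfolding S_def by (intro Bochner_Integration.integrable_add Bochner_Integration.integrable_sum capital_term_integral[OF G t]) auto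
  have S_nonneg: "0 \<le> S N w" if "w \<in> paths" for N w
    unfolding S_def capital_partial_sum[OF G that t]
    using that by (intro nonneg) (auto simp: truncated_time_def)
  have S_exp: "(\<integral>\<^sup>+w. ennreal (S N w) \<partial>W) = ennreal c" for N
  proof -
    have "(\<integral>w. S N w \<partial>W) = (\<integral>w. c \<partial>W) + (\<integral>w. (\<Sum>n<N. capital_term G t w n) \<partial>W)"
      unfolding S_def
      by (intro Bochner_Integration.integral_add Bochner_Integration.integrable_sum capital_term_integral[OF G t]) auto
    also have "(\<integral>w. (\<Sum>n<N. capital_term G t w n) \<partial>W) = (\<Sum>n<N. \<integral>w. capital_term G t w n \<partial>W)"
      by (intro Bochner_Integration.integral_sum capital_term_integral[OF G t])
    finally have "(\<integral>w. S N w \<partial>W) = c"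
      by (simp add: capital_term_integral[OF G t] prob_space)
    then show ?thesis
      using S_nonneg space_W by (subst nn_integral_eq_integral[OF S_int]) auto
  qed
  have lim: "(\<lambda>N. S N w) \<longlonglongrightarrow> capital G c t w" if "w \<in> paths" for w
    unfolding S_def
    by (intro tendsto_eventually eventually_mono[OF capital_eventually_sum[OF G that t, of c]]) (rule sym)
  show "capital G c t \<in> borel_measurable W"
  proof (rule borel_measurable_LIMSEQ_real)
    show "\<And>w. w \<in> space W \<Longrightarrow> (\<lambda>N. S N w) \<longlonglongrightarrow> capital G c t w"
      unfolding space_W by (rule lim)
  qed (rule borel_measurable_integrable[OF S_int])
  have "(\<integral>\<^sup>+w. ennreal (capital G c t w) \<partial>W) = (\<integral>\<^sup>+w. liminf (\<lambda>N. ennreal (S N w)) \<partial>W)"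
    by (intro nn_integral_cong lim_imp_Liminf[symmetric] tendsto_ennrealI lim) (simp_all add: space_W)
  also have "\<dots> \<le> liminf (\<lambda>N. \<integral>\<^sup>+w. ennreal (S N w) \<partial>W)"
    by (intro nn_integral_liminf measurable_compose[OF borel_measurable_integrable[OF S_int]]) simp
  also have "\<dots> = ennreal c"
    by (simp add: S_exp Liminf_const)
  finally show "(\<integral>\<^sup>+w. ennreal (capital G c t w) \<partial>W) \<le> ennreal c" .
qed

end

text \<open>Payoffs are functions rather than sets so that an indicator can be assembled from
  countably many continuous payoffs, each with its own hedge.\<close>

definition hedgeable :: "real \<Rightarrow> (path \<Rightarrow> ennreal) \<Rightarrow> bool" where
  "hedgeable s f \<longleftrightarrow>
     (\<exists>S. positive_capital_process s S \<and> (\<forall>w\<in>paths. f w \<le> Liminf at_top (\<lambda>t. S t w)))"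

text \<open>The function \<open>g\<close> is the lower limit along integer times. Being taken along
  a sequence it is measurable, it is at least the lower limit over all times, and Fatou's lemma
  bounds its mean.\<close>

lemma (in wiener) hedgeable_dominated:
  assumes "hedgeable s f"
  obtains g where "g \<in> borel_measurable path_sigma" "\<And>w. w \<in> paths \<Longrightarrow> f w \<le> g w"
    "(\<integral>\<^sup>+w. g w \<partial>W) \<le> ennreal s"
proof -
  obtain S where S: "positive_capital_process s S" and f: "\<forall>w\<in>paths. f w \<le> Liminf at_top (\<lambda>t. S t w)"
    using assms by (auto simp: hedgeable_def)
  obtain G c where G: "\<And>n. elementary_strategy (G n)"
    and nonneg: "\<And>n t w. 0 \<le> t \<Longrightarrow> w \<in> paths \<Longrightarrow> 0 \<le> capital (G n) (c n) t w"
    and c: "summable c" "s = (\<Sum>n. c n)"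
    and S_eq: "\<And>t w. 0 \<le> t \<Longrightarrow> w \<in> paths \<Longrightarrow> S t w = (\<Sum>n. ennreal (capital (G n) (c n) t w))"
    using S unfolding positive_capital_process_def by blast
  have c0: "0 \<le> c n" for n
    using nonneg[of 0 "restrict (\<lambda>_. 0) {0..}" n] restrict_in_paths[of "\<lambda>_. 0"] by (simp add: capital_0)
  note cap = capital_expectation[OF G _ nonneg]
  define g where "g w = liminf (\<lambda>k. \<Sum>n. ennreal (capital (G n) (c n) (real k) w))" for w
  have meas: "(\<lambda>w. \<Sum>n. ennreal (capital (G n) (c n) (real k) w)) \<in> borel_measurable W" for k
    using cap(1) by (intro borel_measurable_suminf_order) (auto intro!: measurable_compose[OF cap(1)])
  show ?thesis
  proof
    have "g \<in> borel_measurable W"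
      unfolding g_def by (intro borel_measurable_liminf meas)
    then show "g \<in> borel_measurable path_sigma"
      by (simp cong: measurable_cong_sets[OF sets_W refl])
  next
    fix w assume w: "w \<in> paths"
    have "Liminf at_top (\<lambda>t. S t w) \<le> Liminf (filtermap real sequentially) (\<lambda>t. S t w)"
    proof -
      have "Liminf at_top F \<le> Liminf (filtermap real sequentially) F" for F :: "real \<Rightarrow> ennreal"
        unfolding Liminf_def
      proof (rule SUP_subset_mono)
        show "{P. eventually P at_top} \<subseteq> {P. eventually P (filtermap real sequentially)}"
          using filterlim_real_sequentially unfolding filterlim_def le_filter_def by auto
      qed simp
      then show ?thesis .
    qed
    also have "\<dots> = g w"
      unfolding g_def using S_eq[OF _ w] inj_on_of_nat by (subst Liminf_filtermap_eq) auto
    finally show "f w \<le> g w" using f w by (auto intro: order_trans)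
  next
    have "(\<integral>\<^sup>+w. g w \<partial>W) \<le> liminf (\<lambda>k. \<integral>\<^sup>+w. (\<Sum>n. ennreal (capital (G n) (c n) (real k) w)) \<partial>W)"
      unfolding g_def by (intro nn_integral_liminf meas)
    also have "\<dots> \<le> liminf (\<lambda>k::nat. \<Sum>n. ennreal (c n))"
    proof (intro Liminf_mono always_eventually allI)
      fix k
      have "(\<integral>\<^sup>+w. (\<Sum>n. ennreal (capital (G n) (c n) (real k) w)) \<partial>W) =
        (\<Sum>n. \<integral>\<^sup>+w. ennreal (capital (G n) (c n) (real k) w) \<partial>W)"
        by (intro nn_integral_suminf measurable_compose[OF cap(1)]) auto
      also have "\<dots> \<le> (\<Sum>n. ennreal (c n))"
        by (intro suminf_le cap(2)) auto
      finally show "(\<integral>\<^sup>+w. (\<Sum>n. ennreal (capital (G n) (c n) (real k) w)) \<partial>W) \<le> (\<Sum>n. ennreal (c n))" .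
    qed
    also have "\<dots> = ennreal s"
      unfolding c(2) suminf_ennreal2[OF c0 c(1)] by (simp add: Liminf_const)
    finally show "(\<integral>\<^sup>+w. g w \<partial>W) \<le> ennreal s" .
  qed
qed

section \<open>Superhedging prices\<close>

lemma hedgeable_mono:
  "hedgeable s f \<Longrightarrow> (\<And>w. w \<in> paths \<Longrightarrow> g w \<le> f w) \<Longrightarrow> hedgeable s g"
  unfolding hedgeable_def by (meson order_trans)

lemma hedgeable_nonneg: "hedgeable s f \<Longrightarrow> 0 \<le> s"
  unfolding hedgeable_def using positive_capital_process_nonneg by blast

lemma Liminf_add_le_ennreal:
  fixes f g :: "'a \<Rightarrow> ennreal"
  shows "Liminf F f + Liminf F g \<le> Liminf F (\<lambda>x. f x + g x)"
proof -
  let ?E = "{P. eventually P F}"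
  have ne: "?E \<noteq> {}" using eventually_True[of F] by blast
  have PQ: "(INF x\<in>Collect P. f x) + (INF x\<in>Collect Q. g x) \<le> Liminf F (\<lambda>x. f x + g x)"
    if "P \<in> ?E" "Q \<in> ?E" for P Q
  proof -
    have "(INF x\<in>Collect P. f x) + (INF x\<in>Collect Q. g x) \<le> (INF x\<in>{x. P x \<and> Q x}. f x + g x)"
      by (intro INF_greatest add_mono INF_lower) auto
    also have "\<dots> \<le> Liminf F (\<lambda>x. f x + g x)"
      unfolding Liminf_def using that by (intro SUP_upper) (auto intro: eventually_conj)
    finally show ?thesis .
  qed
  have "(INF x\<in>Collect P. f x) + Liminf F g \<le> Liminf F (\<lambda>x. f x + g x)" if "P \<in> ?E" for P
    unfolding Liminf_def[of F g] ennreal_SUP_add_right[OF ne]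
    using PQ[OF that] by (intro SUP_least)
  then show ?thesis
    unfolding Liminf_def[of F f] ennreal_SUP_add_left[OF ne, symmetric]
    by (intro SUP_least)
qed

lemma Liminf_suminf_le:
  fixes f :: "nat \<Rightarrow> 'a \<Rightarrow> ennreal"
  shows "(\<Sum>n. Liminf F (f n)) \<le> Liminf F (\<lambda>x. \<Sum>n. f n x)"
proof -
  have "(\<Sum>n<N. Liminf F (f n)) \<le> Liminf F (\<lambda>x. \<Sum>n<N. f n x)" for N
  proof (induction N)
    case (Suc N)
    then show ?case
      using order_trans[OF add_right_mono[OF Suc] Liminf_add_le_ennreal[of F "\<lambda>x. \<Sum>n<N. f n x" "f N"]] by simp
  qed simp
  also have "Liminf F (\<lambda>x. \<Sum>n<N. f n x) \<le> Liminf F (\<lambda>x. \<Sum>n. f n x)" for N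
    by (intro Liminf_mono always_eventually allI sum_le_suminf) auto
  finally show ?thesis
    unfolding suminf_eq_SUP by (intro SUP_least)
qed

text \<open>Countable subadditivity. The double series of elementary processes is enumerated by
  \<open>prod_decode\<close>, and nonnegativity makes the order of summation irrelevant.\<close>

lemma hedgeable_suminf:
  assumes h: "\<And>n. hedgeable (s n) (f n)" and s: "summable s"
  shows "hedgeable (\<Sum>n. s n) (\<lambda>w. \<Sum>n. f n w)"
proof -
  have "\<forall>n. \<exists>S. positive_capital_process (s n) S \<and> (\<forall>w\<in>paths. f n w \<le> Liminf at_top (\<lambda>t. S t w))"
    using h unfolding hedgeable_def by blast
  then obtain S where S: "\<And>n. positive_capital_process (s n) (S n)"
    and f: "\<And>n w. w \<in> paths \<Longrightarrow> f n w \<le> Liminf at_top (\<lambda>t. S n t w)"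
    by metis
  have "\<forall>n. positive_capital_process (s n) (S n)" using S by blast
  then obtain G c where Gc: "\<forall>n. (\<forall>k. elementary_strategy (G n k)) \<and>
        (\<forall>k. \<forall>t\<ge>0. \<forall>w\<in>paths. 0 \<le> capital (G n k) (c n k) t w) \<and>
        summable (c n) \<and> s n = (\<Sum>k. c n k) \<and>
        (\<forall>t\<ge>0. \<forall>w\<in>paths. S n t w = (\<Sum>k. ennreal (capital (G n k) (c n k) t w)))"
    unfolding positive_capital_process_def choice_iff by (elim exE)
  then have G: "elementary_strategy (G n k)"
    and nonneg: "0 \<le> t \<Longrightarrow> w \<in> paths \<Longrightarrow> 0 \<le> capital (G n k) (c n k) t w"
    and c: "summable (c n)" "s n = (\<Sum>k. c n k)"
    and S_eq: "0 \<le> t \<Longrightarrow> w \<in> paths \<Longrightarrow> S n t w = (\<Sum>k. ennreal (capital (G n k) (c n k) t w))"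
    for n k t w
    by simp_all
  have c0: "0 \<le> c n k" for n k
    using nonneg[of 0 "restrict (\<lambda>_. 0) {0..}" n k] restrict_in_paths[of "\<lambda>_. 0"] by (simp add: capital_0)
  have s0: "0 \<le> s n" for n using hedgeable_nonneg[OF h] .
  define G' where "G' i = (case prod_decode i of (n, k) \<Rightarrow> G n k)" for i
  define c' where "c' i = (case prod_decode i of (n, k) \<Rightarrow> c n k)" for i
  have c'0: "0 \<le> c' i" for i using c0 by (simp add: c'_def split: prod.split)
  have sum_s: "(\<Sum>n. ennreal (s n)) = ennreal (\<Sum>n. s n)"
    by (rule suminf_ennreal2[OF s0 s])
  \<comment> \<open>The rearrangement takes place in \<open>ennreal\<close>, where it is
    unconditional; summability and the real value of the sum are read off afterwards.\<close>
  have c'_sum: "(\<Sum>i. ennreal (c' i)) = ennreal (\<Sum>n. s n)"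
  proof -
    have "(\<Sum>i. (\<lambda>(n, k). ennreal (c n k)) (prod_decode i)) = (\<Sum>n. ennreal (s n))"
      unfolding c(2) suminf_ennreal2[OF c0 c(1), symmetric] by (rule suminf_ennreal_2dimen) simp
    then show ?thesis
      unfolding sum_s by (simp add: c'_def case_prod_unfold)
  qed
  have c'_summable: "summable c'"
    using c'_sum by (intro summable_suminf_not_top c'0) simp
  have "ennreal (\<Sum>i. c' i) = ennreal (\<Sum>n. s n)"
    using c'_sum suminf_ennreal2[OF c'0 c'_summable] by simp
  then have c'_eq: "(\<Sum>n. s n) = (\<Sum>i. c' i)"
    using suminf_nonneg[OF c'_summable c'0] suminf_nonneg[OF s s0] by simp
  have pos: "positive_capital_process (\<Sum>n. s n) (\<lambda>t w. \<Sum>n. S n t w)"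
    unfolding positive_capital_process_def
  proof (intro exI[of _ G'] exI[of _ c'] conjI allI ballI impI)
    fix i show "elementary_strategy (G' i)" using G by (simp add: G'_def split: prod.split)
  next
    fix i and t :: real and w assume "0 \<le> t" "w \<in> paths"
    then show "0 \<le> capital (G' i) (c' i) t w"
      using nonneg by (simp add: G'_def c'_def split: prod.split)
  next
    fix t :: real and w assume t: "0 \<le> t" "w \<in> paths"
    have "(\<Sum>i. (\<lambda>(n, k). ennreal (capital (G n k) (c n k) t w)) (prod_decode i)) = (\<Sum>n. S n t w)"
      unfolding S_eq[OF t] by (rule suminf_ennreal_2dimen) simp
    then show "(\<Sum>n. S n t w) = (\<Sum>i. ennreal (capital (G' i) (c' i) t w))"
      by (simp add: c'_def G'_def case_prod_unfold)
  qed (use c'_summable c'_eq in auto)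
  have "(\<Sum>n. f n w) \<le> Liminf at_top (\<lambda>t. \<Sum>n. S n t w)" if "w \<in> paths" for w
    by (rule order_trans[OF suminf_le[OF f[OF that]] Liminf_suminf_le]) auto
  with pos show ?thesis
    unfolding hedgeable_def by blast
qed

text \<open>Pads a single strategy to the infinite series that a positive capital process demands.
  The times \<open>n\<close> are there because the stopping times must tend to infinity.\<close>

definition null_strategy :: strategy where
  "null_strategy = \<lparr>stop_time = \<lambda>n _. of_nat n, stake_M = \<lambda>_ _. 0, stake_V = \<lambda>_ _. 0\<rparr>"

lemma elementary_null_strategy: "elementary_strategy null_strategy"
proof -
  have "(\<lambda>n. of_nat n :: ennreal) \<longlonglongrightarrow> \<top>"
    by (rule of_nat_tendsto_top_ennreal)
  then show ?thesis
    by (auto simp: null_strategy_def elementary_strategy_def stopping_time_const mono_def image_constant_conv)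
qed

lemma capital_null_strategy: "capital null_strategy c t w = c"
  by (simp add: capital_def null_strategy_def)

lemma hedgeable_single:
  assumes G: "elementary_strategy G"
    and nonneg: "\<And>t w. 0 \<le> t \<Longrightarrow> w \<in> paths \<Longrightarrow> 0 \<le> capital G c t w"
    and f: "\<And>t w. T \<le> t \<Longrightarrow> 0 \<le> t \<Longrightarrow> w \<in> paths \<Longrightarrow> f w \<le> ennreal (capital G c t w)"
  shows "hedgeable c f"
proof -
  let ?G = "\<lambda>n::nat. if n = 0 then G else null_strategy"
  let ?c = "\<lambda>n::nat. if n = 0 then c else 0"
  have single: "(\<Sum>n. ennreal (capital (?G n) (?c n) t w)) = ennreal (capital G c t w)" for t w
    by (subst suminf_finite[of "{0}"]) (auto simp: capital_null_strategy)
  have "positive_capital_process c (\<lambda>t w. ennreal (capital G c t w))"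
    unfolding positive_capital_process_def
  proof (intro exI[of _ ?G] exI[of _ ?c] conjI allI ballI impI)
    show "summable ?c" by (rule summable_finite[of "{0}"]) auto
    show "c = (\<Sum>n. ?c n)" by (subst suminf_finite[of "{0}"]) auto
  qed (use G nonneg single in \<open>auto simp: elementary_null_strategy capital_null_strategy\<close>)
  moreover have "f w \<le> Liminf at_top (\<lambda>t. ennreal (capital G c t w))" if "w \<in> paths" for w
    using f that by (intro Liminf_bounded) (auto intro!: eventually_at_top_linorderI[of "max 0 T"])
  ultimately show ?thesis
    unfolding hedgeable_def by blast
qed

lemma upper_prob_le: "hedgeable s (indicator E) \<Longrightarrow> upper_prob E \<le> s"
  unfolding upper_prob_def hedgeable_def superhedges_def
proof (rule cInf_lower)
  show "bdd_below {s. \<exists>S. positive_capital_process s S \<and>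
      (\<forall>w\<in>paths. indicator E w \<le> Liminf at_top (\<lambda>t. S t w))}"
    by (rule bdd_belowI[of _ 0]) (elim CollectE exE conjE, rule positive_capital_process_nonneg)
qed simp

lemma upper_prob_greatest:
  assumes "\<And>s. hedgeable s (indicator E) \<Longrightarrow> b \<le> s"
  shows "b \<le> upper_prob E"
  unfolding upper_prob_def
proof (rule cInf_greatest)
  show "{s. \<exists>S. positive_capital_process s S \<and> superhedges S E} \<noteq> {}"
    using positive_capital_process_one by blast
qed (use assms in \<open>auto simp: hedgeable_def superhedges_def\<close>)

lemma upper_prob_approx:
  assumes "upper_prob E < s"
  obtains s' where "hedgeable s' (indicator E)" "s' < s"
  using upper_prob_greatest[of E s] assms by (meson not_le)

lemma hedgeable_add:
  assumes "hedgeable s f" "hedgeable t g"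
  shows "hedgeable (s + t) (\<lambda>w. f w + g w)"
proof -
  have 0: "hedgeable 0 (\<lambda>_. 0)"
    by (rule hedgeable_single[OF elementary_null_strategy, of _ 0]) (auto simp: capital_null_strategy)
  let ?s = "\<lambda>n::nat. if n = 0 then s else if n = 1 then t else 0"
  let ?f = "\<lambda>(n::nat) w. if n = 0 then f w else if n = 1 then g w else 0"
  have "hedgeable (\<Sum>n. ?s n) (\<lambda>w. \<Sum>n. ?f n w)"
    using assms 0 by (intro hedgeable_suminf) (auto intro!: summable_finite[of "{0,1}"] split: if_splits)
  moreover have "(\<Sum>n. ?s n) = s + t" by (subst suminf_finite[of "{0,1}"]) auto
  moreover have "(\<Sum>n. ?f n w) = f w + g w" for w by (subst suminf_finite[of "{0,1}"]) auto
  ultimately show ?thesis by simp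
qed

section \<open>Rebalancing times\<close>

text \<open>For \<open>h > 0\<close> this is strictly later than \<open>s\<close> even if
  \<open>s\<close> is a grid point, so every step advances time.\<close>

definition next_grid :: "real \<Rightarrow> real \<Rightarrow> real" where
  "next_grid h s = (real_of_int \<lfloor>s / h\<rfloor> + 1) * h"

text \<open>The non-strict condition \<open>h \<le> \<bar>w r - w s\<bar>\<close> makes the set
  closed for continuous paths, so its infimum is attained. Attainment allows the exit to be
  recognized from the path up to that moment, as the raw filtration demands.\<close>

definition exit_times :: "real \<Rightarrow> real \<Rightarrow> path \<Rightarrow> real set" where
  "exit_times h s w = {r. s \<le> r \<and> (r = next_grid h s \<or> r \<le> next_grid h s \<and> h \<le> \<bar>w r - w s\<bar>)}"

definition next_time :: "real \<Rightarrow> real \<Rightarrow> path \<Rightarrow> real" where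
  "next_time h s w = Inf (exit_times h s w)"

lemma next_grid_gt: "0 < h \<Longrightarrow> s < next_grid h s"
proof -
  assume h: "0 < h"
  have "s / h < real_of_int \<lfloor>s / h\<rfloor> + 1" by linarith
  then have "s / h * h < (real_of_int \<lfloor>s / h\<rfloor> + 1) * h"
    using h by (rule mult_strict_right_mono)
  then show ?thesis using h by (simp add: next_grid_def)
qed

lemma next_grid_le: "0 < h \<Longrightarrow> next_grid h s \<le> s + h"
proof -
  assume h: "0 < h"
  have "(real_of_int \<lfloor>s / h\<rfloor> + 1) * h \<le> (s / h + 1) * h"
    using h by (intro mult_right_mono) linarith+
  then show ?thesis using h by (simp add: next_grid_def distrib_right)
qed

lemma next_grid_le_multiple:
  assumes "0 < h" "s < real j * h"
  shows "next_grid h s \<le> real j * h"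
proof -
  have "s / h < real j" using assms by (simp add: pos_divide_less_eq)
  then have "\<lfloor>s / h\<rfloor> < int j" by (simp add: floor_less_iff)
  then have "real_of_int \<lfloor>s / h\<rfloor> + 1 \<le> real j" by linarith
  then show ?thesis
    unfolding next_grid_def using assms by (intro mult_right_mono) auto
qed

lemma next_grid_multiple: "0 < h \<Longrightarrow> next_grid h (real_of_int i * h) = (real_of_int i + 1) * h"
  by (simp add: next_grid_def)

lemma
  assumes w: "w \<in> paths" and h: "0 < h" and s: "0 \<le> s"
  shows next_time_mem: "next_time h s w \<in> exit_times h s w"
    and next_time_lower: "r \<in> exit_times h s w \<Longrightarrow> next_time h s w \<le> r"
proof -
  have grid: "next_grid h s \<in> exit_times h s w"
    using next_grid_gt[OF h, of s] by (simp add: exit_times_def)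
  have bdd: "bdd_below (exit_times h s w)"
    by (rule bdd_belowI[of _ s]) (simp add: exit_times_def)
  have eq: "exit_times h s w = insert (next_grid h s) ({s..next_grid h s} \<inter> (\<lambda>r. \<bar>w r - w s\<bar>) -` {h..})"
    using next_grid_gt[OF h, of s] by (auto simp: exit_times_def)
  have "continuous_on {s..next_grid h s} (\<lambda>r. \<bar>w r - w s\<bar>)"
    using continuous_on_subset[OF path_continuous[OF w], of "{s..next_grid h s}"] s
    by (intro continuous_intros) auto
  then have "closed ({s..next_grid h s} \<inter> (\<lambda>r. \<bar>w r - w s\<bar>) -` {h..})"
    by (rule continuous_closed_preimage) auto
  then have "closed (exit_times h s w)"
    unfolding eq by (rule closed_insert)
  then show "next_time h s w \<in> exit_times h s w"
    unfolding next_time_def using grid bdd by (intro closed_contains_Inf) auto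
  show "r \<in> exit_times h s w \<Longrightarrow> next_time h s w \<le> r"
    unfolding next_time_def using bdd by (intro cInf_lower)
qed

lemma
  assumes w: "w \<in> paths" and h: "0 < h" and s: "0 \<le> s"
  shows next_time_gt: "s < next_time h s w"
    and next_time_le_grid: "next_time h s w \<le> next_grid h s"
    and next_time_cases: "next_time h s w = next_grid h s \<or> h \<le> \<bar>w (next_time h s w) - w s\<bar>"
    and next_time_close: "s \<le> r \<Longrightarrow> r \<le> next_time h s w \<Longrightarrow> \<bar>w r - w s\<bar> \<le> h"
proof -
  note mem = next_time_mem[OF assms] and low = next_time_lower[OF assms]
  have grid: "s < next_grid h s" by (rule next_grid_gt[OF h])
  have "next_time h s w \<noteq> s" using mem grid h by (auto simp: exit_times_def)
  then show gt: "s < next_time h s w" using mem by (auto simp: exit_times_def)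
  show le: "next_time h s w \<le> next_grid h s" using mem by (auto simp: exit_times_def)
  show "next_time h s w = next_grid h s \<or> h \<le> \<bar>w (next_time h s w) - w s\<bar>"
    using mem by (auto simp: exit_times_def)
  have less: "\<bar>w r - w s\<bar> \<le> h" if "r \<in> {s..<next_time h s w}" for r
    using low[of r] le that by (force simp: exit_times_def)
  \<comment> \<open>Strictly before the exit the displacement is below \<open>h\<close>; continuity
    carries the weak bound to the exit time.\<close>
  have closure: "closure {s..<next_time h s w} = {s..next_time h s w}"
    using gt by simp
  have "continuous_on {s..next_time h s w} (\<lambda>r. \<bar>w r - w s\<bar>)"
    using continuous_on_subset[OF path_continuous[OF w], of "{s..next_time h s w}"] s
    by (intro continuous_intros) auto
  then show "s \<le> r \<Longrightarrow> r \<le> next_time h s w \<Longrightarrow> \<bar>w r - w s\<bar> \<le> h"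
    using continuous_le_on_closure[of "{s..<next_time h s w}" "\<lambda>r. \<bar>w r - w s\<bar>" r h] less
    unfolding closure by auto
qed

text \<open>Whether \<open>r\<close> is an exit time depends on the path only up to
  \<open>r\<close>, so both paths have the same exit times up to \<open>t\<close>, and attained
  infima can be compared.\<close>

lemma next_time_agree:
  assumes w: "w \<in> paths" "w' \<in> paths" and h: "0 < h" and s: "0 \<le> s"
    and agree: "agree_upto t w w'" and le: "next_time h s w \<le> t"
  shows "next_time h s w' = next_time h s w"
proof (rule antisym)
  have eq: "r \<in> exit_times h s w' \<longleftrightarrow> r \<in> exit_times h s w" if "r \<le> t" for r
  proof (cases "s \<le> r")
    case True
    then have "w r = w' r" "w s = w' s"
      using agree_uptoD[OF agree] that s by auto
    then show ?thesis by (simp add: exit_times_def)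
  qed (simp add: exit_times_def)
  show 1: "next_time h s w' \<le> next_time h s w"
    using next_time_mem[OF w(1) h s] eq[OF le] by (intro next_time_lower[OF w(2) h s]) simp
  show "next_time h s w \<le> next_time h s w'"
    using next_time_mem[OF w(2) h s] eq[of "next_time h s w'"] 1 le
    by (intro next_time_lower[OF w(1) h s]) auto
qed

text \<open>The right-hand side involves only countably many values of the path.\<close>

lemma next_time_le_iff:
  assumes w: "w \<in> paths" and h: "0 < h" and s: "0 \<le> s"
  shows "next_time h s w \<le> t \<longleftrightarrow> next_grid h s \<le> t \<or>
    (s \<le> t \<and> (\<forall>m::nat. \<exists>i j::nat. h - 1 / real (Suc m) < \<bar>w (max s (min (real i / real (Suc j)) t)) - w s\<bar>))"
  (is "_ \<longleftrightarrow> _ \<or> _ \<and> ?R")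
proof (cases "next_grid h s \<le> t \<or> t < s")
  case True
  then show ?thesis
    using next_time_le_grid[OF assms] next_time_gt[OF assms] by auto
next
  case False
  then have t: "s \<le> t" "t < next_grid h s" by auto
  have cont: "continuous_on {s..t} (\<lambda>r. \<bar>w r - w s\<bar>)"
    using continuous_on_subset[OF path_continuous[OF w], of "{s..t}"] s
    by (intro continuous_intros) auto
  have "next_time h s w \<le> t \<longleftrightarrow> (\<exists>r\<in>{s..t}. h \<le> \<bar>w r - w s\<bar>)"
  proof
    assume "next_time h s w \<le> t"
    then show "\<exists>r\<in>{s..t}. h \<le> \<bar>w r - w s\<bar>"
      using next_time_cases[OF assms] next_time_gt[OF assms] t by (intro bexI[of _ "next_time h s w"]) auto
  next
    assume "\<exists>r\<in>{s..t}. h \<le> \<bar>w r - w s\<bar>"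
    then obtain r where r: "r \<in> {s..t}" "h \<le> \<bar>w r - w s\<bar>" by blast
    then have "r \<in> exit_times h s w" using t by (simp add: exit_times_def)
    from next_time_lower[OF assms this] show "next_time h s w \<le> t" using r by simp
  qed
  also have "\<dots> \<longleftrightarrow> ?R"
  proof
    assume "\<exists>r\<in>{s..t}. h \<le> \<bar>w r - w s\<bar>"
    then obtain r where r: "s \<le> r" "r \<le> t" "h \<le> \<bar>w r - w s\<bar>" by auto
    show ?R
    proof
      fix m :: nat
      define q where "q j = real (nat \<lfloor>real (Suc j) * r\<rfloor>) / real (Suc j)" for j
      have "q = (\<lambda>j. real_of_int \<lfloor>real (Suc j) * r\<rfloor> / real (Suc j))"
        using r s by (auto simp: q_def of_nat_nat)
      then have lim: "q \<longlonglongrightarrow> r"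
        using floor_quotient_tendsto[OF _ inverse_Suc_tendsto, of r] by simp
      have "(\<lambda>j. max s (min (q j) t)) \<longlonglongrightarrow> max s (min r t)"
        by (intro tendsto_max tendsto_min tendsto_const lim)
      then have "(\<lambda>j. max s (min (q j) t)) \<longlonglongrightarrow> r"
        using r by simp
      then have "(\<lambda>j. \<bar>w (max s (min (q j) t)) - w s\<bar>) \<longlonglongrightarrow> \<bar>w r - w s\<bar>"
        using r t by (intro continuous_on_tendsto_compose[OF cont]) (auto intro!: always_eventually)
      moreover have "h - 1 / real (Suc m) < \<bar>w r - w s\<bar>"
        using r(3) zero_less_divide_1_iff[of "real (Suc m)"] by linarith
      ultimately have "\<forall>\<^sub>F j in sequentially. h - 1 / real (Suc m) < \<bar>w (max s (min (q j) t)) - w s\<bar>"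
        by (rule order_tendstoD)
      then obtain j where "h - 1 / real (Suc m) < \<bar>w (max s (min (q j) t)) - w s\<bar>"
        unfolding eventually_sequentially by blast
      then show "\<exists>i j::nat. h - 1 / real (Suc m) < \<bar>w (max s (min (real i / real (Suc j)) t)) - w s\<bar>"
        unfolding q_def by blast
    qed
  next
    assume R: ?R
    \<comment> \<open>The witnesses in \<open>R\<close> vary with \<open>m\<close>; a maximum over
      the compact interval dominates all of them at once.\<close>
    obtain r where r: "r \<in> {s..t}" and max: "\<And>r'. r' \<in> {s..t} \<Longrightarrow> \<bar>w r' - w s\<bar> \<le> \<bar>w r - w s\<bar>"
      using continuous_attains_sup[OF _ _ cont] t by auto
    have lower: "h - 1 / real (Suc m) \<le> \<bar>w r - w s\<bar>" for m
    proof -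
      obtain i j where "h - 1 / real (Suc m) < \<bar>w (max s (min (real i / real (Suc j)) t)) - w s\<bar>"
        using R by blast
      also have "\<dots> \<le> \<bar>w r - w s\<bar>" using t by (intro max) auto
      finally show ?thesis by simp
    qed
    have "(\<lambda>m. h - 1 / real (Suc m)) \<longlonglongrightarrow> h"
      using tendsto_diff[OF tendsto_const LIMSEQ_inverse_real_of_nat, of h]
      by (simp add: inverse_eq_divide)
    then have "h \<le> \<bar>w r - w s\<bar>"
      by (rule LIMSEQ_le_const2) (use lower in auto)
    with r show "\<exists>r\<in>{s..t}. h \<le> \<bar>w r - w s\<bar>" by blast
  qed
  finally show ?thesis using t by auto
qed

lemma measurable_next_grid: "next_grid h \<in> borel_measurable borel"
  unfolding next_grid_def[abs_def] by measurable

lemma measurable_next_time: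
  assumes T: "T \<in> borel_measurable path_sigma" and nonneg: "\<And>w. w \<in> paths \<Longrightarrow> 0 \<le> T w" and h: "0 < h"
  shows "(\<lambda>w. next_time h (T w) w) \<in> borel_measurable path_sigma"
proof (rule borel_measurableI_le)
  fix t
  have at_max: "(\<lambda>w. w (max (T w) (min q t))) \<in> borel_measurable path_sigma" for q
    using T nonneg by (intro measurable_coordinate_at[where X="\<lambda>w. w"]) (auto simp: le_max_iff_disj)
  have at_T: "(\<lambda>w. w (T w)) \<in> borel_measurable path_sigma"
    using T nonneg by (intro measurable_coordinate_at[where X="\<lambda>w. w"]) auto
  have "{w \<in> space path_sigma. next_grid h (T w) \<le> t \<or>
    (T w \<le> t \<and> (\<forall>m::nat. \<exists>i j::nat. h - 1 / real (Suc m) < \<bar>w (max (T w) (min (real i / real (Suc j)) t)) - w (T w)\<bar>))} \<in> sets path_sigma"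
  proof -
    note [measurable] = T at_T at_max
    note [measurable] = measurable_compose[OF T measurable_next_grid]
    show ?thesis by measurable
  qed
  also have "{w \<in> space path_sigma. next_grid h (T w) \<le> t \<or>
    (T w \<le> t \<and> (\<forall>m::nat. \<exists>i j::nat. h - 1 / real (Suc m) < \<bar>w (max (T w) (min (real i / real (Suc j)) t)) - w (T w)\<bar>))}
    = {w \<in> space path_sigma. next_time h (T w) w \<le> t}"
    using next_time_le_iff[OF _ h nonneg] by (intro Collect_cong conj_cong) auto
  finally show "{w \<in> space path_sigma. next_time h (T w) w \<le> t} \<in> sets path_sigma" .
qed

primrec trading_time :: "real \<Rightarrow> nat \<Rightarrow> path \<Rightarrow> real" where
  "trading_time h 0 w = 0"
| "trading_time h (Suc n) w = next_time h (trading_time h n w) w"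

context
  fixes h :: real
  assumes h: "0 < h"
begin

lemma trading_time_nonneg: "w \<in> paths \<Longrightarrow> 0 \<le> trading_time h n w"
proof (induction n)
  case (Suc n)
  then show ?case using next_time_gt[OF Suc.prems h, of "trading_time h n w"] by simp
qed simp

lemma trading_time_less: "w \<in> paths \<Longrightarrow> trading_time h n w < trading_time h (Suc n) w"
  using next_time_gt[OF _ h trading_time_nonneg] by simp

lemma trading_time_mono: "w \<in> paths \<Longrightarrow> incseq (\<lambda>n. trading_time h n w)"
  using trading_time_less by (intro incseq_SucI) (auto intro: less_imp_le)

lemma trading_time_agree:
  assumes "w \<in> paths" "w' \<in> paths" "agree_upto t w w'" "trading_time h n w \<le> t"
  shows "trading_time h n w' = trading_time h n w"
  using assms(4)
proof (induction n)
  case (Suc n)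
  then have "trading_time h n w' = trading_time h n w"
    using trading_time_less[OF assms(1), of n] by simp
  then show ?case
    using next_time_agree[OF assms(1,2) h trading_time_nonneg[OF assms(1)] assms(3)] Suc.prems by simp
qed simp

lemma measurable_trading_time: "trading_time h n \<in> borel_measurable path_sigma"
proof (induction n)
  case (Suc n)
  then show ?case using measurable_next_time[OF Suc trading_time_nonneg h] by simp
qed simp

text \<open>Each step moves the path by at most \<open>h\<close>. The bound is needed because the
  stake on the path contains its current value, while stakes must be bounded.\<close>

lemma trading_time_coordinate_bound: "w \<in> paths \<Longrightarrow> \<bar>w (trading_time h n w)\<bar> \<le> real n * h"
proof (induction n)
  case (Suc n)
  have "\<bar>w (trading_time h (Suc n) w) - w (trading_time h n w)\<bar> \<le> h"
    using next_time_close[OF Suc.prems h trading_time_nonneg[OF Suc.prems]] trading_time_less[OF Suc.prems, of n] by simp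
  then show ?case using Suc by (simp add: algebra_simps)
qed (simp add: path_0)

text \<open>On a bounded time interval only finitely many steps end because the path moved by \<open>h\<close>, and
  two consecutive grid steps advance time by \<open>h\<close>.\<close>

lemma trading_time_unbounded:
  assumes w: "w \<in> paths"
  shows "\<exists>n. t < trading_time h n w"
proof (rule ccontr)
  let ?\<tau> = "\<lambda>n. trading_time h n w"
  assume "\<nexists>n. t < ?\<tau> n"
  then have "\<And>n. ?\<tau> n \<le> t" by (simp add: not_less)
  then obtain l where l: "?\<tau> \<longlonglongrightarrow> l"
    using incseq_convergent[OF trading_time_mono[OF w]] by blast
  have "0 \<le> l"
    by (rule LIMSEQ_le_const[OF l]) (use trading_time_nonneg[OF w] in auto)
  then have "(\<lambda>n. w (?\<tau> n)) \<longlonglongrightarrow> w l"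
    using trading_time_nonneg[OF w] by (intro continuous_on_tendsto_compose[OF path_continuous[OF w] l]) auto
  from tendsto_diff[OF LIMSEQ_Suc[OF this] this] have "(\<lambda>n. w (?\<tau> (Suc n)) - w (?\<tau> n)) \<longlonglongrightarrow> 0" by simp
  from LIMSEQ_D[OF this h] obtain n0 where n0: "\<And>n. n \<ge> n0 \<Longrightarrow> \<bar>w (?\<tau> (Suc n)) - w (?\<tau> n)\<bar> < h" by auto
  have grid: "?\<tau> (Suc n) = next_grid h (?\<tau> n)" if "n \<ge> n0" for n
    using next_time_cases[OF w h trading_time_nonneg[OF w, of n]] n0[OF that] by auto
  have step: "?\<tau> (Suc (Suc n)) = ?\<tau> (Suc n) + h" if "n \<ge> n0" for n
  proof -
    have "?\<tau> (Suc n) = real_of_int (\<lfloor>?\<tau> n / h\<rfloor> + 1) * h"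
      using grid[OF that] by (simp add: next_grid_def)
    moreover have "?\<tau> (Suc (Suc n)) = next_grid h (?\<tau> (Suc n))"
      using grid[of "Suc n"] that by simp
    ultimately show ?thesis
      using next_grid_multiple[OF h, of "\<lfloor>?\<tau> n / h\<rfloor> + 1"] by (simp add: distrib_right)
  qed
  from tendsto_diff[OF LIMSEQ_Suc[OF LIMSEQ_Suc[OF l]] LIMSEQ_Suc[OF l]]
  have "(\<lambda>n. ?\<tau> (Suc (Suc n)) - ?\<tau> (Suc n)) \<longlonglongrightarrow> 0" by simp
  moreover have "(\<lambda>n. ?\<tau> (Suc (Suc n)) - ?\<tau> (Suc n)) \<longlonglongrightarrow> h"
    by (rule tendsto_eventually) (use step in \<open>auto simp: eventually_sequentially intro!: exI[of _ n0]\<close>)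
  ultimately show False
    using LIMSEQ_unique h by fastforce
qed

lemma trading_time_tendsto:
  assumes w: "w \<in> paths"
  shows "(\<lambda>n. ennreal (trading_time h n w)) \<longlonglongrightarrow> \<top>"
proof -
  have "filterlim (\<lambda>n. trading_time h n w) at_top sequentially"
    unfolding filterlim_at_top
  proof
    fix t
    obtain n0 where "t < trading_time h n0 w" using trading_time_unbounded[OF w] by blast
    then have "t \<le> trading_time h n w" if "n \<ge> n0" for n
      using incseqD[OF trading_time_mono[OF w] that] by simp
    then show "\<forall>\<^sub>F n in sequentially. t \<le> trading_time h n w"
      unfolding eventually_sequentially by blast
  qed
  then show ?thesis
    by (simp only: ennreal_tendsto_top_eq_at_top)
qed

end

section \<open>Hedging a second-order expansion\<close>

text \<open>Conditions under which values at the trading times are legitimate stakes: measurability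
  along measurable times, nonanticipation for Galmarino's test, and a bound uniform in time and
  path.\<close>

locale stake_process =
  fixes C :: real and m :: "real \<Rightarrow> path \<Rightarrow> real"
  assumes measurable: "T \<in> borel_measurable path_sigma \<Longrightarrow> (\<And>w. w \<in> paths \<Longrightarrow> 0 \<le> T w) \<Longrightarrow>
      (\<lambda>w. m (T w) w) \<in> borel_measurable path_sigma"
    and nonanticipating: "w \<in> paths \<Longrightarrow> w' \<in> paths \<Longrightarrow> 0 \<le> t \<Longrightarrow> agree_upto t w w' \<Longrightarrow> m t w' = m t w"
    and bound: "w \<in> paths \<Longrightarrow> 0 \<le> t \<Longrightarrow> \<bar>m t w\<bar> \<le> C"

lemma stake_process_add:
  assumes "stake_process C m" "stake_process C' m'"
  shows "stake_process (C + C') (\<lambda>t w. m t w + m' t w)"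
proof
  fix T :: "path \<Rightarrow> real" assume T: "T \<in> borel_measurable path_sigma" "\<And>w. w \<in> paths \<Longrightarrow> 0 \<le> T w"
  then show "(\<lambda>w. m (T w) w + m' (T w) w) \<in> borel_measurable path_sigma"
    using stake_process.measurable[OF assms(1)] stake_process.measurable[OF assms(2)]
    by (intro borel_measurable_add) auto
next
  fix w w' and t :: real assume *: "w \<in> paths" "w' \<in> paths" "0 \<le> t" "agree_upto t w w'"
  show "m t w' + m' t w' = m t w + m' t w"
    using stake_process.nonanticipating[OF assms(1) *] stake_process.nonanticipating[OF assms(2) *] by simp
next
  fix w and t :: real assume *: "w \<in> paths" "0 \<le> t"
  show "\<bar>m t w + m' t w\<bar> \<le> C + C'"
    using stake_process.bound[OF assms(1) *] stake_process.bound[OF assms(2) *] by linarith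
qed

lemma stake_process_mult:
  fixes g :: "real \<Rightarrow> real"
  assumes m: "stake_process C m" and C: "0 \<le> C"
    and g: "g \<in> borel_measurable borel" "\<And>t. 0 \<le> t \<Longrightarrow> \<bar>g t\<bar> \<le> b" and le: "b * C \<le> C'"
  shows "stake_process C' (\<lambda>t w. g t * m t w)"
proof
  fix T :: "path \<Rightarrow> real" assume T: "T \<in> borel_measurable path_sigma" "\<And>w. w \<in> paths \<Longrightarrow> 0 \<le> T w"
  then show "(\<lambda>w. g (T w) * m (T w) w) \<in> borel_measurable path_sigma"
    using stake_process.measurable[OF m] by (intro borel_measurable_times measurable_compose[OF _ g(1)]) auto
next
  fix w w' and t :: real assume *: "w \<in> paths" "w' \<in> paths" "0 \<le> t" "agree_upto t w w'"
  show "g t * m t w' = g t * m t w"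
    using stake_process.nonanticipating[OF m *] by simp
next
  fix w and t :: real assume *: "w \<in> paths" "0 \<le> t"
  have "\<bar>g t * m t w\<bar> \<le> b * C"
    unfolding abs_mult using stake_process.bound[OF m *] g(2)[OF *(2)] by (intro mult_mono) auto
  then show "\<bar>g t * m t w\<bar> \<le> C'" using le by linarith
qed

lemma stake_process_scale:
  "stake_process C m \<Longrightarrow> 0 \<le> C \<Longrightarrow> stake_process (\<bar>a\<bar> * C) (\<lambda>t w. a * m t w)"
  by (rule stake_process_mult[where b="\<bar>a\<bar>"]) auto

text \<open>The one-step remainder in Ito's formula for a solution of the backward heat equation:
  \<open>m\<close> plays the first and \<open>v\<close> half the second space derivative, and the
  time derivative \<open>- v\<close> is contained in the last term.\<close>

definition second_order_error ::
    "(real \<Rightarrow> path \<Rightarrow> real) \<Rightarrow> (real \<Rightarrow> path \<Rightarrow> real) \<Rightarrow> (real \<Rightarrow> path \<Rightarrow> real) \<Rightarrow> real \<Rightarrow> real \<Rightarrow> path \<Rightarrow> real" where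
  "second_order_error Z m v s t w =
     Z t w - Z s w - m s w * (w t - w s) - v s w * ((w t - w s)\<^sup>2 - (t - s))"

text \<open>The restrictions on \<open>s\<close>, \<open>t\<close> and the displacement are those
  valid within one trading step. They let a remainder of higher order be written as \<open>h\<close>
  times a quadratic one.\<close>

locale nearly_hedges =
  fixes Z :: "real \<Rightarrow> path \<Rightarrow> real" and C :: real and m v :: "real \<Rightarrow> path \<Rightarrow> real" and h :: real
  assumes error: "w \<in> paths \<Longrightarrow> 0 \<le> s \<Longrightarrow> s \<le> t \<Longrightarrow> t \<le> next_grid h s \<Longrightarrow> \<bar>w t - w s\<bar> \<le> h \<Longrightarrow>
    \<bar>second_order_error Z m v s t w\<bar> \<le> C * h * ((w t - w s)\<^sup>2 + (t - s))"

text \<open>As \<open>(\<Delta>w)\<^sup>2 = \<Delta>(w\<^sup>2) - 2w\<Delta>w\<close>, the squared increment can be traded, and an additional stake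
  \<open>C h\<close> on it covers the error of the second-order expansion.\<close>

definition hedging_strategy ::
    "real \<Rightarrow> (real \<Rightarrow> path \<Rightarrow> real) \<Rightarrow> (real \<Rightarrow> path \<Rightarrow> real) \<Rightarrow> real \<Rightarrow> real \<Rightarrow> strategy" where
  "hedging_strategy C m v h T =
     \<lparr>stop_time = \<lambda>n w. ennreal (trading_time h n w),
      stake_M = \<lambda>n w. let s = trading_time h n w in
        if s < T then m s w - 2 * w s * (v s w + C * h) else 0,
      stake_V = \<lambda>n w. let s = trading_time h n w in if s < T then v s w + C * h else 0\<rparr>"

lemma elementary_hedging_strategy:
  assumes h: "0 < h" and m: "stake_process C m" and v: "stake_process C v" and C: "0 \<le> C"
  shows "elementary_strategy (hedging_strategy C m v h T)"
proof -
  let ?\<tau> = "\<lambda>n. trading_time h n"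
  note nonneg = trading_time_nonneg[OF h] and meas = measurable_trading_time[OF h]
  have st: "stopping_time path_filtration (\<lambda>w. ennreal (?\<tau> n w))" for n
    by (rule stopping_time_pathI[OF meas nonneg trading_time_agree[OF h]])
  have pre: "f \<in> borel_measurable (stopped_sigma (\<lambda>w. ennreal (?\<tau> n w)))"
    if "f \<in> borel_measurable path_sigma"
      "\<And>w w'. w \<in> paths \<Longrightarrow> w' \<in> paths \<Longrightarrow> agree_upto (?\<tau> n w) w w' \<Longrightarrow> f w' = f w" for f :: "path \<Rightarrow> real" and n
    by (rule measurable_pre_sigma_pathI[OF st nonneg trading_time_agree[OF h] that])
  define M where "M n w = (if ?\<tau> n w < T then m (?\<tau> n w) w - 2 * w (?\<tau> n w) * (v (?\<tau> n w) w + C * h) else 0)" for n w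
  define V where "V n w = (if ?\<tau> n w < T then v (?\<tau> n w) w + C * h else 0)" for n w
  have less: "{w \<in> space path_sigma. ?\<tau> n w < T} \<in> sets path_sigma" for n
    using borel_measurable_less[OF meas borel_measurable_const] .
  have w\<tau>: "(\<lambda>w. w (?\<tau> n w)) \<in> borel_measurable path_sigma" for n
    by (rule measurable_coordinate_at[where X="\<lambda>w. w", OF _ meas]) (use nonneg in auto)
  have m\<tau>: "(\<lambda>w. m (?\<tau> n w) w) \<in> borel_measurable path_sigma" for n
    by (rule stake_process.measurable[OF m meas nonneg])
  have v\<tau>: "(\<lambda>w. v (?\<tau> n w) w) \<in> borel_measurable path_sigma" for n
    by (rule stake_process.measurable[OF v meas nonneg])
  have M_meas: "M n \<in> borel_measurable path_sigma" and V_meas: "V n \<in> borel_measurable path_sigma" for n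
    unfolding M_def V_def
    by (intro measurable_If borel_measurable_diff borel_measurable_times borel_measurable_add
        borel_measurable_const less w\<tau> m\<tau> v\<tau>)+
  have same: "?\<tau> n w' = ?\<tau> n w" "m (?\<tau> n w) w' = m (?\<tau> n w) w" "v (?\<tau> n w) w' = v (?\<tau> n w) w" "w' (?\<tau> n w) = w (?\<tau> n w)"
    if "w \<in> paths" "w' \<in> paths" "agree_upto (?\<tau> n w) w w'" for n w w'
    using trading_time_agree[OF h that order_refl] stake_process.nonanticipating[OF m that(1,2) nonneg[OF that(1)] that(3)]
      stake_process.nonanticipating[OF v that(1,2) nonneg[OF that(1)] that(3)] agree_uptoD[OF that(3) nonneg[OF that(1)]]
    by auto
  have Ch: "0 \<le> C * h" using C h by simp
  have V_bound: "\<bar>V n w\<bar> \<le> C + C * h" if "w \<in> paths" for n w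
    using stake_process.bound[OF v that nonneg[OF that, of n]] C Ch by (auto simp: V_def abs_le_iff)
  \<comment> \<open>The bound grows with \<open>n\<close>, which is harmless: an elementary strategy
    needs each stake bounded, not all of them uniformly.\<close>
  have M_bound: "\<bar>M n w\<bar> \<le> C + 2 * (real n * h) * (C + C * h)" if "w \<in> paths" for n w
  proof (cases "?\<tau> n w < T")
    case True
    have "\<bar>M n w\<bar> \<le> \<bar>m (?\<tau> n w) w\<bar> + 2 * \<bar>w (?\<tau> n w)\<bar> * \<bar>v (?\<tau> n w) w + C * h\<bar>"
      using True abs_triangle_ineq4[of "m (?\<tau> n w) w" "2 * w (?\<tau> n w) * (v (?\<tau> n w) w + C * h)"]
      by (simp add: M_def abs_mult)
    also have "\<dots> \<le> C + 2 * (real n * h) * (C + C * h)"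
      using stake_process.bound[OF m that nonneg[OF that, of n]] trading_time_coordinate_bound[OF h that, of n]
        V_bound[OF that, of n] True h
      by (intro add_mono mult_mono) (auto simp: V_def)
    finally show ?thesis .
  qed (use C h in \<open>simp add: M_def\<close>)
  have "bounded (M n ` paths)" "bounded (V n ` paths)" for n
    using M_bound[of _ n] V_bound[of _ n] unfolding bounded_iff by (auto intro!: exI)
  moreover have "M n \<in> borel_measurable (stopped_sigma (\<lambda>w. ennreal (?\<tau> n w)))" for n
  proof (rule pre[OF M_meas])
    fix w w' assume "w \<in> paths" "w' \<in> paths" "agree_upto (?\<tau> n w) w w'"
    note same = same[OF this]
    show "M n w' = M n w" unfolding M_def same ..
  qed
  moreover have "V n \<in> borel_measurable (stopped_sigma (\<lambda>w. ennreal (?\<tau> n w)))" for n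
  proof (rule pre[OF V_meas])
    fix w w' assume "w \<in> paths" "w' \<in> paths" "agree_upto (?\<tau> n w) w w'"
    note same = same[OF this]
    show "V n w' = V n w" unfolding V_def same ..
  qed
  moreover have "incseq (\<lambda>n. ennreal (?\<tau> n w))" if "w \<in> paths" for w
    using trading_time_mono[OF h that] by (auto simp: incseq_def ennreal_leI)
  moreover have "stake_M (hedging_strategy C m v h T) = M" "stake_V (hedging_strategy C m v h T) = V"
    "stop_time (hedging_strategy C m v h T) = (\<lambda>n w. ennreal (?\<tau> n w))"
    by (simp_all add: hedging_strategy_def M_def V_def Let_def fun_eq_iff)
  ultimately show ?thesis
    unfolding elementary_strategy_def using st trading_time_tendsto[OF h] by simp
qed

text \<open>The extra stake earns \<open>C * h * (D\<^sup>2 - (r - s))\<close> in a step, and a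
  charge of \<open>2 * C * h * (r - s)\<close> raises this to the error bound
  \<open>C * h * (D\<^sup>2 + (r - s))\<close>. The charges telescope to at most
  \<open>2 * C * h * T\<close>.\<close>

lemma capital_hedging_strategy:
  assumes h: "0 < h" and m: "stake_process C m" and v: "stake_process C v" and C: "0 \<le> C"
    and hedge: "nearly_hedges Z C m v h"
    and T: "T = real j * h" and const: "\<And>w t. w \<in> paths \<Longrightarrow> T \<le> t \<Longrightarrow> Z t w = Z T w"
    and w: "w \<in> paths" and t: "0 \<le> t"
  shows "c + (Z t w - Z 0 w) - 2 * C * h * T \<le> capital (hedging_strategy C m v h T) c t w"
proof -
  let ?G = "hedging_strategy C m v h T"
  let ?\<tau> = "\<lambda>n. trading_time h n w"
  have G: "elementary_strategy ?G" by (rule elementary_hedging_strategy[OF h m v C])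
  note nonneg = trading_time_nonneg[OF h w]
  have T0: "0 \<le> T" using h by (simp add: T)
  define u where "u n = min (?\<tau> n) t" for n
  have u: "truncated_time ?G n t w = u n" for n
    using nonneg[of n] t by (simp add: truncated_time_def hedging_strategy_def u_def min_def ennreal_le_iff)
  \<comment> \<open>The minima with \<open>T\<close> end the charge where trading ends.\<close>
  have step: "Z (u (Suc n)) w - Z (u n) w - 2 * C * h * (min (u (Suc n)) T - min (u n) T) \<le> capital_term ?G t w n" for n
  proof -
    have less: "?\<tau> n < ?\<tau> (Suc n)" by (rule trading_time_less[OF h w])
    consider "t \<le> ?\<tau> n" | "?\<tau> n < t" "T \<le> ?\<tau> n" | "?\<tau> n < t" "?\<tau> n < T" by linarith
    then show ?thesis
    proof cases
      case 1
      then have "u n = t" "u (Suc n) = t" using less by (simp_all add: u_def)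
      then show ?thesis by (simp add: capital_term_eq_0 u)
    next
      case 2
      then have "u n = ?\<tau> n" "T \<le> u n" "T \<le> u (Suc n)" using less by (auto simp: u_def)
      then have "Z (u (Suc n)) w = Z (u n) w" "min (u (Suc n)) T = T" "min (u n) T = T"
        using const[OF w, of "u n"] const[OF w, of "u (Suc n)"] by auto
      moreover have "capital_term ?G t w n = 0"
        using 2 by (simp add: capital_term_def hedging_strategy_def Let_def)
      ultimately show ?thesis by simp
    next
      case 3
      define s where "s = ?\<tau> n"
      define r where "r = u (Suc n)"
      have un: "u n = s" using 3 by (simp add: u_def s_def)
      have s: "0 \<le> s" "s \<le> r" using nonneg less 3 by (auto simp: s_def r_def u_def)
      have r_next: "r \<le> next_time h s w" by (simp add: r_def u_def s_def)
      also have "\<dots> \<le> next_grid h s" by (rule next_time_le_grid[OF w h s(1)])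
      finally have r_grid: "r \<le> next_grid h s" .
      \<comment> \<open>As \<open>T\<close> is a multiple of \<open>h\<close>, no trading step
        straddles it.\<close>
      also have "\<dots> \<le> T" unfolding T using 3 by (intro next_grid_le_multiple[OF h]) (simp add: s_def T)
      finally have rT: "r \<le> T" .
      define D where "D = w r - w s"
      have close: "\<bar>D\<bar> \<le> h"
        unfolding D_def by (rule next_time_close[OF w h s(1,2) r_next])
      have "capital_term ?G t w n = m s w * D + (v s w + C * h) * (D\<^sup>2 - (r - s))"
        unfolding capital_term_def u un r_def[symmetric]
        using 3 by (simp add: hedging_strategy_def Let_def s_def[symmetric] D_def power2_eq_square algebra_simps)
      moreover have "\<bar>Z r w - Z s w - m s w * D - v s w * (D\<^sup>2 - (r - s))\<bar> \<le> C * h * (D\<^sup>2 + (r - s))"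
        unfolding D_def second_order_error_def[symmetric] by (rule nearly_hedges.error[OF hedge w s r_grid close[unfolded D_def]])
      ultimately have "Z r w - Z s w - 2 * C * h * (r - s) \<le> capital_term ?G t w n"
        by (simp add: abs_le_iff algebra_simps)
      then show ?thesis using rT s by (simp add: un r_def[symmetric])
    qed
  qed
  have sum: "Z (u N) w - Z (u 0) w - 2 * C * h * (min (u N) T - min (u 0) T) \<le> (\<Sum>n<N. capital_term ?G t w n)" for N
  proof (induction N)
    case (Suc N)
    then show ?case using step[of N] by (simp add: algebra_simps)
  qed simp
  obtain N0 where N0: "t < ?\<tau> N0" using trading_time_unbounded[OF h w] by blast
  have "\<forall>\<^sub>F N in sequentially. N0 \<le> N \<and> capital ?G c t w = c + (\<Sum>n<N. capital_term ?G t w n)"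
    using capital_eventually_sum[OF G w t] eventually_ge_at_top[of N0] by eventually_elim simp
  then obtain N where N: "N0 \<le> N" "capital ?G c t w = c + (\<Sum>n<N. capital_term ?G t w n)"
    unfolding eventually_sequentially by blast
  have "u N = t" using N0 incseqD[OF trading_time_mono[OF h w] N(1)] by (simp add: u_def)
  moreover have "u 0 = 0" using t by (simp add: u_def)
  moreover have "2 * C * h * min t T \<le> 2 * C * h * T" using C h by (intro mult_left_mono) auto
  ultimately show ?thesis using sum[of N] N(2) T0 by simp
qed

text \<open>The capital \<open>e\<close> pays the charge \<open>2 * C * h * T\<close> once the mesh
  is small, and refining a dyadic mesh keeps \<open>T\<close> on the grid. Nonnegativity of
  \<open>Z\<close> at all times, not merely of \<open>X\<close>, keeps the capital nonnegative
  throughout.\<close>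

lemma nearly_hedges_hedgeable:
  assumes m: "stake_process C m" and v: "stake_process C v" and C: "0 \<le> C"
    and hedge: "\<And>k. k0 \<le> k \<Longrightarrow> nearly_hedges Z C m v (1 / 2 ^ k)"
    and T: "T = real j / 2 ^ k0" and X: "\<And>w t. w \<in> paths \<Longrightarrow> T \<le> t \<Longrightarrow> Z t w = X w"
    and nonneg: "\<And>w t. w \<in> paths \<Longrightarrow> 0 \<le> t \<Longrightarrow> 0 \<le> Z t w"
    and z: "\<And>w. w \<in> paths \<Longrightarrow> Z 0 w = z" and e: "0 < e"
  shows "hedgeable (z + e) (\<lambda>w. ennreal (X w))"
proof -
  have T0: "0 \<le> T" by (simp add: T)
  have "(\<lambda>k. (2 * C * T) * (1 / 2 ^ k)) \<longlonglongrightarrow> (2 * C * T) * 0"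
    using LIMSEQ_realpow_zero[of "1 / 2 :: real"] by (intro tendsto_mult tendsto_const) (simp add: power_one_over)
  then have "\<forall>\<^sub>F k in sequentially. (2 * C * T) * (1 / 2 ^ k) < e"
    using e by (intro order_tendstoD(2)) auto
  with eventually_ge_at_top[of k0] have "\<forall>\<^sub>F k in sequentially. k0 \<le> k \<and> (2 * C * T) * (1 / 2 ^ k) < e"
    by eventually_elim simp
  then obtain k where k: "k0 \<le> k" "(2 * C * T) * (1 / 2 ^ k) < e"
    unfolding eventually_sequentially by blast
  define h :: real where "h = 1 / 2 ^ k"
  have h: "0 < h" by (simp add: h_def)
  have Tk: "T = real (j * 2 ^ (k - k0)) * h"
  proof -
    have "(2::real) ^ k = 2 ^ k0 * 2 ^ (k - k0)"
      using k(1) by (simp flip: power_add)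
    then show ?thesis by (simp add: T h_def)
  qed
  have cap: "Z t w \<le> capital (hedging_strategy C m v h T) (z + e) t w" if "w \<in> paths" "0 \<le> t" for w t
  proof -
    have "z + e + (Z t w - Z 0 w) - 2 * C * h * T \<le> capital (hedging_strategy C m v h T) (z + e) t w"
      using X by (intro capital_hedging_strategy[OF h m v C hedge[OF k(1), folded h_def] Tk _ that]) auto
    moreover have "2 * C * h * T \<le> e" using k(2) by (simp add: h_def mult_ac)
    ultimately show ?thesis using z[OF that(1)] by simp
  qed
  show ?thesis
  proof (rule hedgeable_single[OF elementary_hedging_strategy[OF h m v C]])
    show "0 \<le> capital (hedging_strategy C m v h T) (z + e) t w" if "0 \<le> t" "w \<in> paths" for t w
      using cap[OF that(2,1)] nonneg[OF that(2,1)] by simp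
    show "ennreal (X w) \<le> ennreal (capital (hedging_strategy C m v h T) (z + e) t w)"
      if "T \<le> t" "0 \<le> t" "w \<in> paths" for t w
      using cap[OF that(3,2)] X[OF that(3,1)] by (intro ennreal_leI) simp
  qed
qed

section \<open>Replication\<close>

text \<open>For \<open>s < t\<close> the path follows \<open>w\<close> up to \<open>s\<close>, is
  linear up to \<open>t\<close> and constant afterwards; for standard normal \<open>x\<close> its
  increment has the law of a Brownian increment. For \<open>s = t\<close> the quotient is
  \<open>0\<close> and the path is merely stopped.\<close>

definition extend_path :: "real \<Rightarrow> real \<Rightarrow> real \<Rightarrow> path \<Rightarrow> path" where
  "extend_path s t x w = restrict (\<lambda>r. w (min r s) + sqrt (t - s) * x * ((min r t - min r s) / (t - s))) {0..}"

lemma extend_path_in_paths: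
  assumes "w \<in> paths" "0 \<le> s" "s \<le> t"
  shows "extend_path s t x w \<in> paths"
  unfolding extend_path_def
proof (rule restrict_in_paths)
  have "continuous_on {0..} (\<lambda>r. w (min r s))"
    using assms by (intro continuous_on_compose2[OF path_continuous, of w _ "\<lambda>r. min r s"])
      (auto intro: continuous_on_min continuous_on_id continuous_on_const)
  moreover have "continuous_on {0..} (\<lambda>r. sqrt (t - s) * x * ((min r t - min r s) * inverse (t - s)))"
    by (intro continuous_on_mult continuous_on_const continuous_on_diff continuous_on_min continuous_on_id)
  ultimately show "continuous_on {0..} (\<lambda>r. w (min r s) + sqrt (t - s) * x * ((min r t - min r s) / (t - s)))"
    unfolding divide_inverse by (rule continuous_on_add)
qed (use assms in \<open>simp add: path_0\<close>)

lemma extend_path_before: "0 \<le> r \<Longrightarrow> r \<le> s \<Longrightarrow> s \<le> t \<Longrightarrow> extend_path s t x w r = w r"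
  by (simp add: extend_path_def)

lemma extend_path_at: "0 \<le> s \<Longrightarrow> s \<le> t \<Longrightarrow> extend_path s t x w t = w s + sqrt (t - s) * x"
  by (cases "s = t") (simp_all add: extend_path_def)

text \<open>On each cell of a dyadic grid the value of \<open>Z\<close> is the mean of its values after a Gaussian
  extension of the path, whence \<open>Z\<close> inherits nonnegativity from \<open>X\<close> along all paths, not only
  almost surely.\<close>

locale replication =
  fixes z :: real and X :: "path \<Rightarrow> real" and Z :: "real \<Rightarrow> path \<Rightarrow> real" and C :: real
    and m v :: "real \<Rightarrow> path \<Rightarrow> real" and k0 j :: nat
  assumes stakes: "stake_process C m" "stake_process C v" "0 \<le> C"
    and hedges: "k0 \<le> k \<Longrightarrow> nearly_hedges Z C m v (1 / 2 ^ k)"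
    and terminal: "w \<in> paths \<Longrightarrow> real j / 2 ^ k0 \<le> t \<Longrightarrow> Z t w = X w"
    and initial: "w \<in> paths \<Longrightarrow> Z 0 w = z"
    and mean: "k0 \<le> k \<Longrightarrow> w \<in> paths \<Longrightarrow> 0 \<le> s \<Longrightarrow> s \<le> t \<Longrightarrow> t \<le> next_grid (1 / 2 ^ k) s \<Longrightarrow>
        has_bochner_integral std_normal_distribution (\<lambda>x. Z t (extend_path s t x w)) (Z s w)"

definition replicable :: "real \<Rightarrow> (path \<Rightarrow> real) \<Rightarrow> bool" where
  "replicable z X \<longleftrightarrow> (\<exists>Z C m v k0 j. replication z X Z C m v k0 j)"

lemma replicableI: "replication z X Z C m v k0 j \<Longrightarrow> replicable z X"
  unfolding replicable_def by (intro exI)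

lemma nearly_hedges_add:
  assumes "nearly_hedges Z C m v h" "nearly_hedges Z' C' m' v' h"
  shows "nearly_hedges (\<lambda>t w. Z t w + Z' t w) (C + C') (\<lambda>t w. m t w + m' t w) (\<lambda>t w. v t w + v' t w) h"
    (is "nearly_hedges ?Z _ ?m ?v h")
proof
  fix w s t assume *: "w \<in> paths" "0 \<le> s" "s \<le> t" "t \<le> next_grid h s" "\<bar>w t - w s\<bar> \<le> h"
  let ?q = "(w t - w s)\<^sup>2 + (t - s)"
  have "second_order_error ?Z ?m ?v s t w =
    second_order_error Z m v s t w + second_order_error Z' m' v' s t w"
    by (simp add: second_order_error_def algebra_simps)
  also have "\<bar>\<dots>\<bar> \<le> C * h * ?q + C' * h * ?q"
    by (rule order_trans[OF abs_triangle_ineq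
        add_mono[OF nearly_hedges.error[OF assms(1) *] nearly_hedges.error[OF assms(2) *]]])
  finally show "\<bar>second_order_error ?Z ?m ?v s t w\<bar>
    \<le> (C + C') * h * ?q"
    by (simp add: distrib_right)
qed

lemma nearly_hedges_scale:
  assumes "nearly_hedges Z C m v h"
  shows "nearly_hedges (\<lambda>t w. a * Z t w) (\<bar>a\<bar> * C) (\<lambda>t w. a * m t w) (\<lambda>t w. a * v t w) h"
    (is "nearly_hedges ?Z _ ?m ?v h")
proof
  fix w s t assume *: "w \<in> paths" "0 \<le> s" "s \<le> t" "t \<le> next_grid h s" "\<bar>w t - w s\<bar> \<le> h"
  have "second_order_error ?Z ?m ?v s t w =
    a * second_order_error Z m v s t w"
    by (simp add: second_order_error_def algebra_simps)
  then show "\<bar>second_order_error ?Z ?m ?v s t w\<bar>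
    \<le> \<bar>a\<bar> * C * h * ((w t - w s)\<^sup>2 + (t - s))"
    using nearly_hedges.error[OF assms *] by (simp add: abs_mult mult.assoc mult_left_mono)
qed

lemma replicable_add:
  assumes "replicable z X" "replicable z' X'"
  shows "replicable (z + z') (\<lambda>w. X w + X' w)"
proof -
  obtain Z C m v k0 j where 1: "replication z X Z C m v k0 j"
    using assms(1) unfolding replicable_def by (elim exE)
  obtain Z' C' m' v' k0' j' where 2: "replication z' X' Z' C' m' v' k0' j'"
    using assms(2) unfolding replicable_def by (elim exE)
  interpret P: replication z X Z C m v k0 j by (rule 1)
  interpret Q: replication z' X' Z' C' m' v' k0' j' by (rule 2)
  define k1 where "k1 = max k0 k0'"
  \<comment> \<open>This makes the common horizon \<open>real j + real j'\<close>, which is beyond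
    both given horizons.\<close>
  define j1 where "j1 = j * 2 ^ k1 + j' * 2 ^ k1"
  have k1: "k0 \<le> k1" "k0' \<le> k1" by (auto simp: k1_def)
  have eq: "real j1 / 2 ^ k1 = real j + real j'" by (simp add: j1_def add_divide_distrib)
  have le: "real i / 2 ^ k \<le> real i" for i k :: nat
    using divide_left_mono[of 1 "2 ^ k" "real i"] by simp
  have j1: "real j / 2 ^ k0 \<le> real j1 / 2 ^ k1" "real j' / 2 ^ k0' \<le> real j1 / 2 ^ k1"
    unfolding eq using le[of j k0] le[of j' k0'] by linarith+
  have "replication (z + z') (\<lambda>w. X w + X' w) (\<lambda>t w. Z t w + Z' t w) (C + C')
    (\<lambda>t w. m t w + m' t w) (\<lambda>t w. v t w + v' t w) k1 j1" (is "replication _ _ ?Z _ ?m ?v _ _")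
  proof (rule replication.intro)
    fix k assume k: "k1 \<le> k"
    show "nearly_hedges ?Z (C + C') ?m ?v (1 / 2 ^ k)"
      by (rule nearly_hedges_add[OF P.hedges[OF order_trans[OF k1(1) k]] Q.hedges[OF order_trans[OF k1(2) k]]])
    fix w s t assume *: "w \<in> paths" "0 \<le> s" "s \<le> t" "t \<le> next_grid (1 / 2 ^ k) s"
    show "has_bochner_integral std_normal_distribution (\<lambda>x. Z t (extend_path s t x w) + Z' t (extend_path s t x w)) (Z s w + Z' s w)"
      by (rule has_bochner_integral_add[OF P.mean[OF order_trans[OF k1(1) k] *] Q.mean[OF order_trans[OF k1(2) k] *]])
  next
    fix w t assume "w \<in> paths" "real j1 / 2 ^ k1 \<le> t"
    then show "Z t w + Z' t w = X w + X' w"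
      using P.terminal[of w t] Q.terminal[of w t] j1 by simp
  next
    show "stake_process (C + C') ?m" "stake_process (C + C') ?v"
      using P.stakes Q.stakes by (auto intro: stake_process_add)
  qed (use P.stakes(3) P.initial Q.stakes(3) Q.initial in auto)
  then show ?thesis by (rule replicableI)
qed

lemma replicable_scale:
  assumes "replicable z X"
  shows "replicable (a * z) (\<lambda>w. a * X w)"
proof -
  obtain Z C m v k0 j where 1: "replication z X Z C m v k0 j"
    using assms(1) unfolding replicable_def by (elim exE)
  interpret replication z X Z C m v k0 j by (rule 1)
  have "replication (a * z) (\<lambda>w. a * X w) (\<lambda>t w. a * Z t w) (\<bar>a\<bar> * C) (\<lambda>t w. a * m t w) (\<lambda>t w. a * v t w) k0 j"
  proof (rule replication.intro)
    fix k assume k: "k0 \<le> k"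
    show "nearly_hedges (\<lambda>t w. a * Z t w) (\<bar>a\<bar> * C) (\<lambda>t w. a * m t w) (\<lambda>t w. a * v t w) (1 / 2 ^ k)"
      by (rule nearly_hedges_scale[OF hedges[OF k]])
    fix w s t assume *: "w \<in> paths" "0 \<le> s" "s \<le> t" "t \<le> next_grid (1 / 2 ^ k) s"
    show "has_bochner_integral std_normal_distribution (\<lambda>x. a * Z t (extend_path s t x w)) (a * Z s w)"
      by (rule has_bochner_integral_mult_right[OF mean[OF k *]])
  next
    show "stake_process (\<bar>a\<bar> * C) (\<lambda>t w. a * m t w)" "stake_process (\<bar>a\<bar> * C) (\<lambda>t w. a * v t w)"
      using stakes by (auto intro: stake_process_scale)
  qed (use stakes(3) terminal initial in auto)
  then show ?thesis by (rule replicableI)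
qed

text \<open>Backward induction over grid cells from the horizon, where \<open>Z\<close> equals
  \<open>X\<close>: one cell earlier \<open>Z t w\<close> is a mean of values at the next grid
  point. The path is arbitrary in the induction because these values belong to extended
  paths.\<close>

lemma replication_nonneg:
  assumes R: "replication z X Z C m v k0 j" and X: "\<And>w. w \<in> paths \<Longrightarrow> 0 \<le> X w"
  shows "w \<in> paths \<Longrightarrow> 0 \<le> t \<Longrightarrow> (real j - real i) * (1 / 2 ^ k0) \<le> t \<Longrightarrow> 0 \<le> Z t w"
proof (induction i arbitrary: t w)
  case 0
  then show ?case using replication.terminal[OF R, of w t] X[of w] by simp
next
  case (Suc i)
  define h :: real where "h = 1 / 2 ^ k0"
  have h: "0 < h" by (simp add: h_def)
  define r where "r = next_grid h t"
  have r: "t < r" unfolding r_def by (rule next_grid_gt[OF h])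
  have "real_of_int (int j - int (Suc i)) \<le> t / h"
  proof -
    have "(real j - real (Suc i)) * h \<le> t" using Suc.prems(3) by (simp only: h_def)
    then show ?thesis using h by (simp add: pos_le_divide_eq)
  qed
  then have "int j - int (Suc i) \<le> \<lfloor>t / h\<rfloor>" by (simp only: le_floor_iff)
  then have "real j - real i \<le> real_of_int \<lfloor>t / h\<rfloor> + 1" by linarith
  then have "(real j - real i) * h \<le> r"
    unfolding r_def next_grid_def using h by (intro mult_right_mono) auto
  then have "(real j - real i) * (1 / 2 ^ k0) \<le> r" by (simp add: h_def)
  moreover have "0 \<le> r" using r Suc.prems(2) by simp
  ultimately have nonneg: "0 \<le> Z r (extend_path t r x w)" for x
    using extend_path_in_paths[OF Suc.prems(1,2) less_imp_le[OF r]] by (intro Suc.IH)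
  have "has_bochner_integral std_normal_distribution (\<lambda>x. Z r (extend_path t r x w)) (Z t w)"
    using replication.mean[OF R order_refl Suc.prems(1,2) less_imp_le[OF r]] by (simp add: r_def h_def)
  from has_bochner_integral_integral_eq[OF this, symmetric] show ?case
    using nonneg by (simp add: integral_nonneg_AE)
qed

lemma replicable_hedgeable:
  assumes "replicable z X" and X: "\<And>w. w \<in> paths \<Longrightarrow> 0 \<le> X w" and e: "0 < e"
  shows "hedgeable (z + e) (\<lambda>w. ennreal (X w))"
proof -
  obtain Z C m v k0 j where R: "replication z X Z C m v k0 j"
    using assms(1) unfolding replicable_def by (elim exE)
  interpret replication z X Z C m v k0 j by (rule R)
  show ?thesis
  proof (rule nearly_hedges_hedgeable[OF stakes hedges refl terminal _ initial e])
    \<comment> \<open>With \<open>j\<close> cells counted back from the horizon the condition on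
      \<open>t\<close> is just \<open>0 \<le> t\<close>.\<close>
    show "0 \<le> Z t w" if "w \<in> paths" "0 \<le> t" for w t
      using replication_nonneg[OF R X that, of j] that by simp
  qed
qed

text \<open>Applied with \<open>y = g * x\<close> and \<open>b = g\<^sup>2 * (t - s) / 2\<close>.
  Pairing \<open>b\<close> with \<open>y\<^sup>2 / 2\<close> reflects the heat equation. The three
  errors are the cubic remainder of the cosine, the change of the cosine in the term linear in
  \<open>b\<close>, and the quadratic remainder of the exponential.\<close>

lemma taylor_exp_cos:
  fixes \<alpha> y b \<beta> :: real
  assumes b: "0 \<le> b" "b \<le> \<beta>"
  shows "\<bar>exp b * cos (\<alpha> + y) - cos \<alpha> + y * sin \<alpha> + cos \<alpha> * (y\<^sup>2 / 2 - b)\<bar> \<le> \<bar>y\<bar> ^ 3 + b * \<bar>y\<bar> + b\<^sup>2 * exp \<beta>"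
proof -
  have cis: "iexp \<alpha> = Complex (cos \<alpha>) (sin \<alpha>)" for \<alpha> :: real
    by (simp add: cis_conv_exp[symmetric] complex_eq_iff)
  have 1: "\<bar>cos (\<alpha> + y) - cos \<alpha> + y * sin \<alpha> + cos \<alpha> * (y\<^sup>2 / 2)\<bar> \<le> \<bar>y\<bar> ^ 3"
  proof -
    let ?w = "iexp y - (\<Sum>k\<le>2. (\<i> * complex_of_real y) ^ k / fact k)"
    have "cmod ?w \<le> \<bar>y\<bar> ^ Suc 2 / fact (Suc 2)" by (rule iexp_approx1)
    also have "\<dots> \<le> \<bar>y\<bar> ^ Suc 2"
      using divide_left_mono[OF fact_ge_1[of "Suc 2"], of "\<bar>y\<bar> ^ Suc 2"] by simp
    also have "\<dots> = \<bar>y\<bar> ^ 3" by simp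
    finally have "cmod (iexp \<alpha> * ?w) \<le> \<bar>y\<bar> ^ 3" by (simp add: norm_mult)
    moreover have "Re (iexp \<alpha> * ?w) = cos (\<alpha> + y) - cos \<alpha> + y * sin \<alpha> + cos \<alpha> * (y\<^sup>2 / 2)"
      by (simp add: cis eval_nat_numeral cos_add algebra_simps power2_eq_square)
    ultimately show ?thesis using abs_Re_le_cmod[of "iexp \<alpha> * ?w"] by linarith
  qed
  have 2: "\<bar>cos (\<alpha> + y) - cos \<alpha>\<bar> \<le> \<bar>y\<bar>"
  proof -
    let ?w = "iexp y - (\<Sum>k\<le>0. (\<i> * complex_of_real y) ^ k / fact k)"
    have "cmod ?w \<le> \<bar>y\<bar> ^ Suc 0 / fact (Suc 0)" by (rule iexp_approx1)
    then have "cmod (iexp \<alpha> * ?w) \<le> \<bar>y\<bar>" by (simp add: norm_mult)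
    moreover have "Re (iexp \<alpha> * ?w) = cos (\<alpha> + y) - cos \<alpha>"
      by (simp add: cis cos_add algebra_simps)
    ultimately show ?thesis using abs_Re_le_cmod[of "iexp \<alpha> * ?w"] by linarith
  qed
  obtain t where t: "\<bar>t\<bar> \<le> \<bar>b\<bar>" "exp b = (\<Sum>m<2. b ^ m / fact m) + exp t / fact 2 * b ^ 2"
    using Maclaurin_exp_le[of b 2] by blast
  define q where "q = exp t / 2 * b\<^sup>2"
  have eb: "exp b = 1 + b + q" using t(2) by (simp add: q_def eval_nat_numeral)
  have "exp t \<le> exp \<beta>" using t(1) b by simp
  then have "exp t / 2 \<le> exp \<beta>" using exp_gt_zero[of t] by linarith
  then have q: "0 \<le> q" "q \<le> b\<^sup>2 * exp \<beta>"
    unfolding q_def mult.commute[of "b\<^sup>2"] by (simp, intro mult_right_mono) auto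
  have 3: "\<bar>q * cos (\<alpha> + y)\<bar> \<le> q"
    using q(1) mult_left_mono[OF abs_cos_le_one[of "\<alpha> + y"] q(1)] by (simp add: abs_mult)
  have 4: "\<bar>b * (cos (\<alpha> + y) - cos \<alpha>)\<bar> \<le> b * \<bar>y\<bar>"
    using mult_left_mono[OF 2 b(1)] b(1) by (simp add: abs_mult)
  have "exp b * cos (\<alpha> + y) - cos \<alpha> + y * sin \<alpha> + cos \<alpha> * (y\<^sup>2 / 2 - b) =
    (cos (\<alpha> + y) - cos \<alpha> + y * sin \<alpha> + cos \<alpha> * (y\<^sup>2 / 2)) + b * (cos (\<alpha> + y) - cos \<alpha>) + q * cos (\<alpha> + y)"
    by (simp add: eb algebra_simps)
  then show ?thesis using 1 3 4 q(2) by linarith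
qed

text \<open>The real part of the characteristic function after rotation by
  \<open>iexp a\<close>.\<close>

lemma std_normal_cos:
  "has_bochner_integral std_normal_distribution (\<lambda>x. cos (a + u * x)) (cos a * exp (- u\<^sup>2 / 2))"
proof -
  interpret real_distribution std_normal_distribution by (rule real_dist_normal_dist)
  have int: "integrable std_normal_distribution (\<lambda>x. iexp a * iexp (u * x))"
    by (intro integrable_const_bound[of _ 1]) (auto simp: norm_mult)
  have "has_bochner_integral std_normal_distribution (\<lambda>x. iexp a * iexp (u * x)) (iexp a * char std_normal_distribution u)"
    unfolding has_bochner_integral_iff char_def
    using int by (auto intro!: integral_mult_right_zero)
  then have "has_bochner_integral std_normal_distribution (\<lambda>x. Re (iexp a * iexp (u * x))) (Re (iexp a * char std_normal_distribution u))"
    by (rule has_bochner_integral_bounded_linear[OF bounded_linear_Re])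
  moreover have "Re (iexp a * iexp (u * x)) = cos (a + u * x)" for x
    unfolding cis_conv_exp[symmetric] cis_mult by simp
  moreover have "Re (iexp a * char std_normal_distribution u) = cos a * exp (- u\<^sup>2 / 2)"
    unfolding char_std_normal_distribution cis_conv_exp[symmetric] by simp
  ultimately show ?thesis by simp
qed

section \<open>Trigonometric functionals\<close>

definition dyadics :: "real set" where
  "dyadics = {real i / 2 ^ k | i k :: nat. True}"

text \<open>Refining a dyadic grid keeps its points, so one threshold works for all finer
  meshes.\<close>

lemma finite_dyadics_common:
  assumes "finite S" "S \<subseteq> dyadics"
  shows "\<exists>k0::nat. \<forall>k\<ge>k0. \<forall>s\<in>S. \<exists>i::nat. s = real i * (1 / 2 ^ k)"
  using assms
proof (induction S)
  case (insert s S)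
  then obtain k0 :: nat where k0: "\<forall>k\<ge>k0. \<forall>s\<in>S. \<exists>i::nat. s = real i * (1 / 2 ^ k)" by auto
  obtain i k1 :: nat where s: "s = real i / 2 ^ k1" using insert.prems by (auto simp: dyadics_def)
  have "\<exists>i'::nat. s = real i' * (1 / 2 ^ k)" if "k1 \<le> k" for k
  proof
    have "(2::real) ^ k = 2 ^ k1 * 2 ^ (k - k1)" using that by (simp flip: power_add)
    then show "s = real (i * 2 ^ (k - k1)) * (1 / 2 ^ k)" by (simp add: s)
  qed
  then have "\<forall>k\<ge>max k0 k1. \<forall>s\<in>insert s S. \<exists>i::nat. s = real i * (1 / 2 ^ k)"
    using k0 by simp
  then show ?case by blast
qed simp

text \<open>The cosine of \<open>\<theta> + \<Sum> v\<^sub>s w(s) = \<theta> + \<integral> g dw\<close> with \<open>g(t) = \<Sum>\<^bsub>s>t\<^esub> v\<^sub>s\<close> is replicated by the martingale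
  \<open>cos(\<theta> + \<integral>\<^sub>0\<^sup>t g dw) exp(- \<integral>\<^sub>t\<^sup>\<infinity> g\<^sup>2/2)\<close>; \<open>tail_variance\<close> is the last integral of \<open>g\<^sup>2\<close>.\<close>

context
  fixes S :: "real set" and c \<theta> :: real and v :: "real \<Rightarrow> real"
  assumes S: "finite S" "S \<subseteq> dyadics"
begin

definition phase :: "real \<Rightarrow> path \<Rightarrow> real" where
  "phase t w = \<theta> + (\<Sum>s\<in>S. v s * w (min s t))"

definition integrand :: "real \<Rightarrow> real" where
  "integrand t = (\<Sum>s\<in>S. if t < s then v s else 0)"

text \<open>The minimum is the length of time after \<open>t\<close> that precedes both
  \<open>s\<close> and \<open>r\<close>; it arises when the square of the integrand is expanded and
  integrated termwise.\<close>

definition tail_variance :: "real \<Rightarrow> real" where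
  "tail_variance t = (\<Sum>s\<in>S. \<Sum>r\<in>S. v s * v r * min (max 0 (s - t)) (max 0 (r - t)))"

definition cos_mart :: "real \<Rightarrow> path \<Rightarrow> real" where
  "cos_mart t w = c * exp (- tail_variance t / 2) * cos (phase t w)"

definition sin_mart :: "real \<Rightarrow> path \<Rightarrow> real" where
  "sin_mart t w = c * exp (- tail_variance t / 2) * sin (phase t w)"

lemma S_nonneg: "s \<in> S \<Longrightarrow> 0 \<le> s"
  using S(2) by (auto simp: dyadics_def)

text \<open>With no marked time inside the cell the integrand is constant there, and its integral
  against the path is a product.\<close>

lemma phase_cell:
  assumes cell: "\<forall>q\<in>S. q \<le> s \<or> t \<le> q" and st: "s \<le> t"
  shows "phase t w = phase s w + integrand s * (w t - w s)"
proof -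
  have "v q * w (min q t) = v q * w (min q s) + (if s < q then v q else 0) * (w t - w s)" if "q \<in> S" for q
    using cell st that by (cases "s < q") (auto simp: min_def algebra_simps)
  then have "(\<Sum>q\<in>S. v q * w (min q t)) = (\<Sum>q\<in>S. v q * w (min q s) + (if s < q then v q else 0) * (w t - w s))"
    by (intro sum.cong) auto
  then show ?thesis
    by (simp add: phase_def integrand_def sum.distrib sum_distrib_right)
qed

lemma tail_variance_cell:
  assumes cell: "\<forall>q\<in>S. q \<le> s \<or> t \<le> q" and st: "s \<le> t"
  shows "tail_variance s = tail_variance t + (integrand s)\<^sup>2 * (t - s)"
proof -
  let ?l = "\<lambda>q. if s < q then v q else 0"
  have "v q * v r * min (max 0 (q - s)) (max 0 (r - s)) =
    v q * v r * min (max 0 (q - t)) (max 0 (r - t)) + ?l q * ?l r * (t - s)" if "q \<in> S" "r \<in> S" for q r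
  proof -
    have "min (max 0 (q - s)) (max 0 (r - s)) = min (max 0 (q - t)) (max 0 (r - t)) + (if s < q \<and> s < r then t - s else 0)"
      using cell st that by (force simp: min_def max_def)
    then show ?thesis by (simp add: distrib_left)
  qed
  then have "tail_variance s = (\<Sum>q\<in>S. \<Sum>r\<in>S. v q * v r * min (max 0 (q - t)) (max 0 (r - t)) + ?l q * ?l r * (t - s))"
    unfolding tail_variance_def by (intro sum.cong) auto
  also have "\<dots> = tail_variance t + (\<Sum>q\<in>S. \<Sum>r\<in>S. ?l q * ?l r) * (t - s)"
    by (simp add: tail_variance_def sum.distrib sum_distrib_right)
  also have "(\<Sum>q\<in>S. \<Sum>r\<in>S. ?l q * ?l r) = (integrand s)\<^sup>2"
    unfolding integrand_def power2_eq_square sum_product ..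
  finally show ?thesis .
qed

lemma phase_agree: "agree_upto t w w' \<Longrightarrow> 0 \<le> t \<Longrightarrow> phase t w = phase t w'"
  unfolding phase_def using S_nonneg
  by (intro arg_cong2[where f="(+)"] sum.cong refl arg_cong2[where f="(*)"] agree_uptoD) auto

lemma measurable_phase:
  assumes T: "T \<in> borel_measurable path_sigma" and nonneg: "\<And>w. w \<in> paths \<Longrightarrow> 0 \<le> T w"
  shows "(\<lambda>w. phase (T w) w) \<in> borel_measurable path_sigma"
proof -
  have "(\<lambda>w. w (min s (T w))) \<in> borel_measurable path_sigma" if "s \<in> S" for s
    using T nonneg S_nonneg[OF that]
    by (intro measurable_coordinate_at[where X="\<lambda>w. w"] borel_measurable_min) auto
  then show ?thesis
    unfolding phase_def
    by (intro borel_measurable_add borel_measurable_const borel_measurable_sum borel_measurable_times)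
qed

lemma measurable_integrand: "integrand \<in> borel_measurable borel"
  unfolding integrand_def[abs_def] by measurable

lemma measurable_tail_variance: "tail_variance \<in> borel_measurable borel"
  unfolding tail_variance_def[abs_def] by measurable

definition weight :: real where "weight = (\<Sum>s\<in>S. \<bar>v s\<bar>)"
text \<open>Bounds the prefactor of both martingales at all nonnegative times, through an estimate
  of the absolute value of \<open>tail_variance\<close>.\<close>

definition amplitude :: real where "amplitude = \<bar>c\<bar> * exp ((\<Sum>s\<in>S. \<Sum>r\<in>S. \<bar>v s\<bar> * \<bar>v r\<bar> * s) / 2)"

lemma weight_nonneg: "0 \<le> weight"
  by (simp add: weight_def sum_nonneg)

lemma integrand_bound: "\<bar>integrand t\<bar> \<le> weight"
  unfolding integrand_def weight_def by (intro order_trans[OF sum_abs] sum_mono) auto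

lemma amplitude_bound:
  assumes "0 \<le> t"
  shows "\<bar>c * exp (- tail_variance t / 2)\<bar> \<le> amplitude"
proof -
  have "\<bar>v s * v r * min (max 0 (s - t)) (max 0 (r - t))\<bar> \<le> \<bar>v s\<bar> * \<bar>v r\<bar> * s" if "s \<in> S" "r \<in> S" for s r
    unfolding abs_mult using S_nonneg[OF that(1)] assms by (intro mult_left_mono) auto
  then have "\<bar>tail_variance t\<bar> \<le> (\<Sum>s\<in>S. \<Sum>r\<in>S. \<bar>v s\<bar> * \<bar>v r\<bar> * s)"
    unfolding tail_variance_def by (intro order_trans[OF sum_abs] sum_mono) auto
  then have "exp (- tail_variance t / 2) \<le> exp ((\<Sum>s\<in>S. \<Sum>r\<in>S. \<bar>v s\<bar> * \<bar>v r\<bar> * s) / 2)"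
    by (intro exp_le_cancel_iff[THEN iffD2]) linarith
  then show ?thesis
    by (simp add: amplitude_def abs_mult mult_left_mono)
qed

lemma cos_mart_bound: "0 \<le> t \<Longrightarrow> \<bar>cos_mart t w\<bar> \<le> amplitude"
  unfolding cos_mart_def abs_mult[of _ "cos _"]
  using mult_mono[OF amplitude_bound[of t] abs_cos_le_one[of "phase t w"]] order_trans[OF abs_ge_zero amplitude_bound[of t]] by simp

lemma sin_mart_bound: "0 \<le> t \<Longrightarrow> \<bar>sin_mart t w\<bar> \<le> amplitude"
  unfolding sin_mart_def abs_mult[of _ "sin _"]
  using mult_mono[OF amplitude_bound[of t] abs_sin_le_one[of "phase t w"]] order_trans[OF abs_ge_zero amplitude_bound[of t]] by simp

text \<open>A single constant has to bound both stakes and the expansion error: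
  \<open>weight\<close> and \<open>weight ^ 2\<close> cover the stakes, the last two summands the
  Taylor remainder.\<close>

definition cos_error :: real where
  "cos_error = amplitude * (1 + weight + weight ^ 2 + 2 * weight ^ 3 + weight ^ 4 * exp (weight ^ 2))"

lemma amplitude_nonneg: "0 \<le> amplitude"
  by (simp add: amplitude_def)

lemma stake_amplitude: "stake_process amplitude cos_mart" "stake_process amplitude sin_mart"
proof -
  have meas: "(\<lambda>w. cos_mart (T w) w) \<in> borel_measurable path_sigma"
    "(\<lambda>w. sin_mart (T w) w) \<in> borel_measurable path_sigma"
    if "T \<in> borel_measurable path_sigma" "\<And>w. w \<in> paths \<Longrightarrow> 0 \<le> T w" for T
  proof -
    note [measurable] = measurable_phase[OF that] measurable_compose[OF that(1) measurable_tail_variance]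
    show "(\<lambda>w. cos_mart (T w) w) \<in> borel_measurable path_sigma"
      "(\<lambda>w. sin_mart (T w) w) \<in> borel_measurable path_sigma"
      unfolding cos_mart_def sin_mart_def by measurable
  qed
  have agree: "cos_mart t w' = cos_mart t w" "sin_mart t w' = sin_mart t w"
    if "agree_upto t w w'" "0 \<le> t" for t w w'
    using phase_agree[OF that] by (simp_all add: cos_mart_def sin_mart_def)
  show "stake_process amplitude cos_mart" "stake_process amplitude sin_mart"
    unfolding stake_process_def by (auto intro: meas agree cos_mart_bound sin_mart_bound)
qed

text \<open>The derivative of \<open>cos_mart\<close> in the current value of the path;
  \<open>cos_square_stake\<close> is half the second derivative.\<close>

abbreviation (input) cos_stake :: "real \<Rightarrow> path \<Rightarrow> real" where
  "cos_stake t w \<equiv> - integrand t * sin_mart t w"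

abbreviation (input) cos_square_stake :: "real \<Rightarrow> path \<Rightarrow> real" where
  "cos_square_stake t w \<equiv> - (1 / 2) * (integrand t)\<^sup>2 * cos_mart t w"

lemma stake_cos: "stake_process cos_error cos_stake" "stake_process cos_error cos_square_stake"
proof -
  have n: "0 \<le> weight" "0 \<le> weight ^ 2" "0 \<le> weight ^ 3" "0 \<le> weight ^ 4 * exp (weight ^ 2)"
    using weight_nonneg by auto
  have le: "weight * amplitude \<le> cos_error" "weight\<^sup>2 * amplitude \<le> cos_error"
    unfolding cos_error_def mult.commute[of _ amplitude]
    using n by (auto intro!: mult_left_mono amplitude_nonneg)
  show "stake_process cos_error cos_stake"
  proof (rule stake_process_mult[OF stake_amplitude(2) amplitude_nonneg _ _ le(1)])
    show "(\<lambda>t. - integrand t) \<in> borel_measurable borel"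
      using measurable_integrand by (rule borel_measurable_uminus)
  qed (simp add: integrand_bound)
  show "stake_process cos_error cos_square_stake"
  proof (rule stake_process_mult[OF stake_amplitude(1) amplitude_nonneg _ _ le(2)])
    show "(\<lambda>t. - (1 / 2) * (integrand t)\<^sup>2) \<in> borel_measurable borel"
      by (intro borel_measurable_times borel_measurable_power borel_measurable_const measurable_integrand)
    fix t
    have "\<bar>- (1 / 2) * (integrand t)\<^sup>2\<bar> = (integrand t)\<^sup>2 / 2"
      by (simp add: abs_mult)
    moreover have "(integrand t)\<^sup>2 \<le> weight\<^sup>2"
      using power_mono[OF integrand_bound abs_ge_zero, of t 2] by simp
    ultimately show "\<bar>- (1 / 2) * (integrand t)\<^sup>2\<bar> \<le> weight\<^sup>2"
      using zero_le_power2[of "integrand t"] by linarith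
  qed
qed

lemma grid_cell:
  assumes "0 < h" "\<forall>q\<in>S. \<exists>i::nat. q = real i * h" "s \<le> t" "t \<le> next_grid h s"
  shows "\<forall>q\<in>S. q \<le> s \<or> t \<le> q"
proof
  fix q assume "q \<in> S"
  then obtain i :: nat where "q = real i * h" using assms(2) by blast
  then show "q \<le> s \<or> t \<le> q"
    using next_grid_le_multiple[OF assms(1), of s i] assms(4) by (cases "s < q") auto
qed

text \<open>Within a cell the phase moves linearly with the path and the prefactor grows by
  \<open>exp b\<close>, so the remainder is the one in \<open>taylor_exp_cos\<close>. The bounds
  \<open>\<bar>x\<bar> \<le> h\<close> and \<open>t - s \<le> h\<close> extract a factor
  \<open>h\<close> from each of its terms.\<close>

lemma cos_nearly_hedges:
  assumes h: "0 < h" "h \<le> 1" and grid: "\<forall>q\<in>S. \<exists>i::nat. q = real i * h"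
  shows "nearly_hedges cos_mart cos_error cos_stake
    cos_square_stake h"
proof
  fix w s t assume "w \<in> paths" and *: "0 \<le> s" "s \<le> t" "t \<le> next_grid h s" "\<bar>w t - w s\<bar> \<le> h"
  have st: "0 \<le> s" "s \<le> t" "t - s \<le> h"
    using * next_grid_le[OF h(1), of s] by auto
  note cell = grid_cell[OF h(1) grid *(2,3)]
  define x where "x = w t - w s"
  define g where "g = integrand s"
  define y where "y = g * x"
  define b where "b = g\<^sup>2 * (t - s) / 2"
  define A where "A = c * exp (- tail_variance s / 2)"
  define \<Gamma> where "\<Gamma> = weight"
  have \<Gamma>: "0 \<le> \<Gamma>" "\<bar>g\<bar> \<le> \<Gamma>" using weight_nonneg integrand_bound by (auto simp: \<Gamma>_def g_def)
  have x: "\<bar>x\<bar> \<le> h" using * by (simp add: x_def)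
  have g2: "g\<^sup>2 \<le> \<Gamma>\<^sup>2" using power_mono[OF \<Gamma>(2) abs_ge_zero, of 2] by simp
  have b_le: "b \<le> \<Gamma>\<^sup>2 * (t - s)"
  proof -
    have "g\<^sup>2 * (t - s) \<le> \<Gamma>\<^sup>2 * (t - s)" using g2 st by (intro mult_right_mono) auto
    moreover have "0 \<le> g\<^sup>2 * (t - s)" using st by simp
    ultimately show ?thesis unfolding b_def by linarith
  qed
  have b0: "0 \<le> b" using st by (simp add: b_def)
  \<comment> \<open>Here \<open>h \<le> 1\<close> enters: it bounds the exponent \<open>b\<close>
    independently of the mesh.\<close>
  have "\<Gamma>\<^sup>2 * (t - s) \<le> \<Gamma>\<^sup>2 * 1" using st h by (intro mult_left_mono) auto
  then have b_exp: "b \<le> \<Gamma>\<^sup>2" using b_le by simp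
  have "exp (- tail_variance t / 2) = exp (- tail_variance s / 2) * exp b"
    using tail_variance_cell[OF cell st(2)] by (simp add: b_def g_def mult_exp_exp diff_divide_distrib)
  then have Zt: "cos_mart t w = A * (exp b * cos (phase s w + y))"
    by (simp add: cos_mart_def A_def phase_cell[OF cell st(2)] y_def x_def g_def)
  have Zs: "cos_mart s w = A * cos (phase s w)" "sin_mart s w = A * sin (phase s w)"
    by (simp_all add: cos_mart_def sin_mart_def A_def)
  have "second_order_error cos_mart cos_stake cos_square_stake s t w =
    A * (exp b * cos (phase s w + y) - cos (phase s w) + y * sin (phase s w) + cos (phase s w) * (y\<^sup>2 / 2 - b))"
    unfolding second_order_error_def Zt Zs g_def[symmetric] x_def[symmetric] y_def b_def power_mult_distrib
    by (simp add: algebra_simps add_divide_distrib diff_divide_distrib)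
  also have "\<bar>\<dots>\<bar> \<le> amplitude * (\<bar>y\<bar> ^ 3 + b * \<bar>y\<bar> + b\<^sup>2 * exp (\<Gamma>\<^sup>2))"
    unfolding abs_mult
    using amplitude_bound[OF st(1)] amplitude_nonneg
    by (intro mult_mono taylor_exp_cos[OF b0 b_exp]) (auto simp: A_def)
  also have "\<dots> \<le> amplitude * ((2 * \<Gamma> ^ 3 + \<Gamma> ^ 4 * exp (\<Gamma>\<^sup>2)) * h * (x\<^sup>2 + (t - s)))"
  proof (intro mult_left_mono amplitude_nonneg)
    have y: "\<bar>y\<bar> \<le> \<Gamma> * \<bar>x\<bar>" using \<Gamma> by (simp add: y_def abs_mult mult_right_mono)
    have "\<bar>y\<bar> ^ 3 \<le> (\<Gamma> * \<bar>x\<bar>) ^ 3" using y by (intro power_mono) auto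
    also have "\<dots> = \<Gamma> ^ 3 * x\<^sup>2 * \<bar>x\<bar>" by (simp add: power_mult_distrib power3_eq_cube power2_eq_square mult_ac flip: abs_mult)
    also have "\<dots> \<le> \<Gamma> ^ 3 * x\<^sup>2 * h" using x \<Gamma> by (intro mult_left_mono) auto
    finally have 1: "\<bar>y\<bar> ^ 3 \<le> \<Gamma> ^ 3 * x\<^sup>2 * h" .
    have "\<bar>y\<bar> \<le> \<Gamma> * h" using y mult_left_mono[OF x \<Gamma>(1)] by linarith
    then have "b * \<bar>y\<bar> \<le> (\<Gamma>\<^sup>2 * (t - s)) * (\<Gamma> * h)" using b_le b0 \<Gamma> st by (intro mult_mono) auto
    then have 2: "b * \<bar>y\<bar> \<le> \<Gamma> ^ 3 * (t - s) * h" by (simp add: power2_eq_square power3_eq_cube mult_ac)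
    have "b\<^sup>2 \<le> (\<Gamma>\<^sup>2 * (t - s)) * (\<Gamma>\<^sup>2 * (t - s))"
      unfolding power2_eq_square[of b] using b_le b0 st by (intro mult_mono) auto
    also have "\<dots> = \<Gamma> ^ 4 * (t - s) * (t - s)" by (simp add: power2_eq_square power4_eq_xxxx mult_ac)
    also have "\<dots> \<le> \<Gamma> ^ 4 * (t - s) * h" using st by (intro mult_left_mono) auto
    finally have 3: "b\<^sup>2 * exp (\<Gamma>\<^sup>2) \<le> \<Gamma> ^ 4 * (t - s) * h * exp (\<Gamma>\<^sup>2)" by (intro mult_right_mono) auto
    have "0 \<le> \<Gamma> ^ 3 * (t - s) * h" "0 \<le> \<Gamma> ^ 3 * x\<^sup>2 * h" "0 \<le> \<Gamma> ^ 4 * exp (\<Gamma>\<^sup>2) * h * x\<^sup>2"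
      using \<Gamma> st h by auto
    then show "\<bar>y\<bar> ^ 3 + b * \<bar>y\<bar> + b\<^sup>2 * exp (\<Gamma>\<^sup>2) \<le> (2 * \<Gamma> ^ 3 + \<Gamma> ^ 4 * exp (\<Gamma>\<^sup>2)) * h * (x\<^sup>2 + (t - s))"
      using 1 2 3 by (simp add: algebra_simps)
  qed
  also have "\<dots> = amplitude * (2 * \<Gamma> ^ 3 + \<Gamma> ^ 4 * exp (\<Gamma>\<^sup>2)) * (h * (x\<^sup>2 + (t - s)))" by (simp add: mult_ac)
  also have "\<dots> \<le> cos_error * (h * (x\<^sup>2 + (t - s)))"
    unfolding cos_error_def \<Gamma>_def[symmetric] using \<Gamma> st h amplitude_nonneg
    by (intro mult_right_mono mult_left_mono) auto
  finally show "\<bar>second_order_error cos_mart cos_stake cos_square_stake s t w\<bar>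
      \<le> cos_error * h * ((w t - w s)\<^sup>2 + (t - s))"
    by (simp add: x_def mult.assoc)
qed

text \<open>Averaging over the Gaussian increment damps the cosine by exactly the ratio of the
  prefactors at \<open>s\<close> and \<open>t\<close>.\<close>

lemma cos_extension:
  assumes h: "0 < h" and grid: "\<forall>q\<in>S. \<exists>i::nat. q = real i * h"
    and st: "0 \<le> s" "s \<le> t" "t \<le> next_grid h s"
  shows "has_bochner_integral std_normal_distribution (\<lambda>x. cos_mart t (extend_path s t x w)) (cos_mart s w)"
proof -
  note cell = grid_cell[OF h grid st(2,3)]
  let ?u = "integrand s * sqrt (t - s)"
  have "agree_upto s (extend_path s t x w) w" for x
    using st by (simp add: agree_upto_def extend_path_before)
  then have "phase t (extend_path s t x w) = phase s w + ?u * x" for x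
    using phase_cell[OF cell st(2)] phase_agree st by (simp add: extend_path_at extend_path_before)
  then have "(\<lambda>x. cos_mart t (extend_path s t x w)) = (\<lambda>x. c * exp (- tail_variance t / 2) * cos (phase s w + ?u * x))"
    by (simp add: cos_mart_def)
  moreover have "cos_mart s w = c * exp (- tail_variance t / 2) * (cos (phase s w) * exp (- ?u\<^sup>2 / 2))"
  proof -
    have "exp (- tail_variance s / 2) = exp (- tail_variance t / 2) * exp (- ?u\<^sup>2 / 2)"
      using tail_variance_cell[OF cell st(2)] st
      by (simp add: mult_exp_exp power_mult_distrib add_divide_distrib)
    then show ?thesis by (simp add: cos_mart_def)
  qed
  ultimately show ?thesis
    using has_bochner_integral_mult_right[OF std_normal_cos[of "phase s w" ?u], of "c * exp (- tail_variance t / 2)"] by simp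
qed

lemma replicable_cos: "\<exists>z. replicable z (\<lambda>w. c * cos (\<theta> + (\<Sum>s\<in>S. v s * w s)))"
proof -
  obtain k0 :: nat where k0: "\<forall>k\<ge>k0. \<forall>s\<in>S. \<exists>i::nat. s = real i * (1 / 2 ^ k)"
    using finite_dyadics_common[OF S] by blast
  \<comment> \<open>Puts the horizon \<open>real j / 2 ^ k0\<close> at or beyond every marked time;
    inserting \<open>0\<close> covers an empty \<open>S\<close>.\<close>
  define j where "j = nat \<lceil>2 ^ k0 * Max (insert 0 S)\<rceil>"
  have j: "s \<le> real j / 2 ^ k0" if "s \<in> S" for s
  proof -
    have "2 ^ k0 * s \<le> 2 ^ k0 * Max (insert 0 S)" using S(1) that by (intro mult_left_mono Max_ge) auto
    also have "\<dots> \<le> real j" unfolding j_def by (rule real_nat_ceiling_ge)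
    finally show ?thesis by (simp add: pos_le_divide_eq mult.commute)
  qed
  \<comment> \<open>All paths vanish at time \<open>0\<close>, so the zero path yields the common
    initial value.\<close>
  have "replication (cos_mart 0 (restrict (\<lambda>_. 0) {0..})) (\<lambda>w. c * cos (\<theta> + (\<Sum>s\<in>S. v s * w s))) cos_mart cos_error
    cos_stake cos_square_stake k0 j"
  proof (rule replication.intro[OF stake_cos])
    show "0 \<le> cos_error"
      unfolding cos_error_def using amplitude_nonneg weight_nonneg by (intro mult_nonneg_nonneg add_nonneg_nonneg) auto
  next
    fix k assume "k0 \<le> k"
    then have grid: "\<forall>q\<in>S. \<exists>i::nat. q = real i * (1 / 2 ^ k)" using k0 by blast
    show "nearly_hedges cos_mart cos_error cos_stake
      cos_square_stake (1 / 2 ^ k)"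
      by (rule cos_nearly_hedges[OF _ _ grid]) auto
    fix w s t assume "0 \<le> s" "s \<le> t" "t \<le> next_grid (1 / 2 ^ k) s"
    then show "has_bochner_integral std_normal_distribution (\<lambda>x. cos_mart t (extend_path s t x w)) (cos_mart s w)"
      by (rule cos_extension[OF _ grid, rotated]) simp
  next
    fix w t assume "real j / 2 ^ k0 \<le> t"
    then have t: "s \<le> t" if "s \<in> S" for s using j[OF that] by simp
    then have "tail_variance t = 0" unfolding tail_variance_def by (intro sum.neutral) auto
    moreover have "phase t w = \<theta> + (\<Sum>s\<in>S. v s * w s)"
      unfolding phase_def using t by (simp add: min_absorb1)
    ultimately show "cos_mart t w = c * cos (\<theta> + (\<Sum>s\<in>S. v s * w s))"
      by (simp add: cos_mart_def)
  next
    fix w assume "w \<in> paths"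
    then have "agree_upto 0 w (restrict (\<lambda>_. 0) {0..})"
      by (auto simp: agree_upto_def path_0 dest: order_antisym)
    then show "cos_mart 0 w = cos_mart 0 (restrict (\<lambda>_. 0) {0..})"
      using phase_agree[of 0 w] by (simp add: cos_mart_def)
  qed
  then show ?thesis by (blast intro: replicableI)
qed

end

lemma replicable_const: "replicable b (\<lambda>_. b)"
proof -
  interpret real_distribution std_normal_distribution by (rule real_dist_normal_dist)
  have "has_bochner_integral std_normal_distribution (\<lambda>_. b) b"
    using has_bochner_integral_integrable[of std_normal_distribution "\<lambda>_. b"] prob_space by simp
  then have "replication b (\<lambda>_. b) (\<lambda>_ _. b) 0 (\<lambda>_ _. 0) (\<lambda>_ _. 0) 0 0"
    by (intro replication.intro) (auto simp: stake_process_def nearly_hedges_def second_order_error_def)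
  then show ?thesis by (rule replicableI)
qed

section \<open>The algebra of trigonometric polynomials\<close>

inductive trig :: "(path \<Rightarrow> real) \<Rightarrow> bool" where
  trig_cos: "finite S \<Longrightarrow> S \<subseteq> dyadics \<Longrightarrow> trig (\<lambda>w. c * cos (\<theta> + (\<Sum>s\<in>S. v s * w s)))"
| trig_add: "trig X \<Longrightarrow> trig Y \<Longrightarrow> trig (\<lambda>w. X w + Y w)"

lemma trig_replicable: "trig X \<Longrightarrow> \<exists>z. replicable z X"
  by (induction rule: trig.induct) (blast intro: replicable_cos replicable_add)+

lemma trig_const: "trig (\<lambda>_. a)"
  using trig_cos[of "{}" a 0 undefined] by simp

text \<open>Product-to-sum formula, after both families of frequencies are extended by zero to the
  union of their times.\<close>

lemma trig_mult_cos:
  assumes "finite S" "S \<subseteq> dyadics" "trig Y"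
  shows "trig (\<lambda>w. (c * cos (\<theta> + (\<Sum>s\<in>S. v s * w s))) * Y w)"
  using assms(3)
proof (induction rule: trig.induct)
  case (trig_cos S' c' \<theta>' v')
  let ?U = "S \<union> S'"
  let ?l = "\<lambda>s. if s \<in> S then v s else 0" and ?l' = "\<lambda>s. if s \<in> S' then v' s else 0"
  have U: "finite ?U" "?U \<subseteq> dyadics" using assms(1,2) trig_cos by auto
  have sum: "(\<Sum>s\<in>S. v s * w s) = (\<Sum>s\<in>?U. ?l s * w s)" "(\<Sum>s\<in>S'. v' s * w s) = (\<Sum>s\<in>?U. ?l' s * w s)" for w :: path
    using U(1) by (auto intro!: sum.mono_neutral_cong_left)
  have "(c * cos (\<theta> + (\<Sum>s\<in>S. v s * w s))) * (c' * cos (\<theta>' + (\<Sum>s\<in>S'. v' s * w s))) =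
    (c * c' / 2) * cos ((\<theta> - \<theta>') + (\<Sum>s\<in>?U. (?l s - ?l' s) * w s)) +
    (c * c' / 2) * cos ((\<theta> + \<theta>') + (\<Sum>s\<in>?U. (?l s + ?l' s) * w s))" for w :: path
  proof -
    have "(\<Sum>s\<in>?U. (?l s - ?l' s) * w s) = (\<Sum>s\<in>?U. ?l s * w s) - (\<Sum>s\<in>?U. ?l' s * w s)"
      by (simp add: left_diff_distrib sum_subtractf)
    moreover have "(\<Sum>s\<in>?U. (?l s + ?l' s) * w s) = (\<Sum>s\<in>?U. ?l s * w s) + (\<Sum>s\<in>?U. ?l' s * w s)"
      by (simp add: distrib_right sum.distrib)
    moreover have "(c * cos a) * (c' * cos b) = (c * c' / 2) * cos (a - b) + (c * c' / 2) * cos (a + b)" for a b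
      by (simp add: cos_add cos_diff algebra_simps)
    ultimately show ?thesis
      unfolding sum by (simp only: add_diff_add add.assoc add.left_commute[of _ \<theta>'])
  qed
  then show ?case
    using trig.trig_add[OF trig.trig_cos[OF U, of "c * c' / 2" "\<theta> - \<theta>'" "\<lambda>s. ?l s - ?l' s"]
        trig.trig_cos[OF U, of "c * c' / 2" "\<theta> + \<theta>'" "\<lambda>s. ?l s + ?l' s"]] by simp
next
  case (trig_add X Y)
  then show ?case using trig.trig_add by (simp only: distrib_left)
qed

lemma trig_mult: "trig X \<Longrightarrow> trig Y \<Longrightarrow> trig (\<lambda>w. X w * Y w)"
proof (induction rule: trig.induct)
  case (trig_add X X')
  then show ?case using trig.trig_add[of "\<lambda>w. X w * Y w" "\<lambda>w. X' w * Y w"] by (simp only: distrib_right)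
qed (rule trig_mult_cos)

lemma trig_bounded: "trig X \<Longrightarrow> \<exists>b. \<forall>w. \<bar>X w\<bar> \<le> b"
proof (induction rule: trig.induct)
  case (trig_cos S c \<theta> v)
  have "\<bar>c * cos a\<bar> \<le> \<bar>c\<bar>" for a :: real
    using mult_left_mono[OF abs_cos_le_one[of a], of "\<bar>c\<bar>"] by (simp add: abs_mult)
  then show ?case by blast
next
  case (trig_add X Y)
  then obtain b b' where "\<And>w. \<bar>X w\<bar> \<le> b" "\<And>w. \<bar>Y w\<bar> \<le> b'" by blast
  then have "\<bar>X w + Y w\<bar> \<le> b + b'" for w by (rule order_trans[OF abs_triangle_ineq add_mono])
  then show ?case by blast
qed

lemma trig_measurable: "trig X \<Longrightarrow> X \<in> borel_measurable path_sigma"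
proof (induction rule: trig.induct)
  case (trig_cos S c \<theta> v)
  have "(\<lambda>w. w s) \<in> borel_measurable path_sigma" if "s \<in> S" for s
    using that trig_cos(2) by (intro measurable_coordinate) (auto simp: dyadics_def)
  then have "(\<lambda>w. \<theta> + (\<Sum>s\<in>S. v s * w s)) \<in> borel_measurable path_sigma"
    by (intro borel_measurable_add borel_measurable_sum borel_measurable_times borel_measurable_const)
  from measurable_compose[OF this, of "\<lambda>x. c * cos x" borel] show ?case by measurable
next
  case (trig_add X Y)
  show ?case using trig_add.IH by (rule borel_measurable_add)
qed

text \<open>The price \<open>z\<close> of \<open>X\<close> is its expectation, since neither \<open>X\<close> nor \<open>b - X\<close> can be hedged below
  its expectation.\<close>

lemma (in wiener) trig_hedgeable:
  assumes X: "trig X" and nonneg: "\<And>w. w \<in> paths \<Longrightarrow> 0 \<le> X w" and e: "0 < e"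
  shows "hedgeable ((\<integral>w. X w \<partial>W) + e) (\<lambda>w. ennreal (X w))"
proof -
  obtain z where z: "replicable z X" using trig_replicable[OF X] by blast
  obtain b where b: "\<And>w. \<bar>X w\<bar> \<le> b" using trig_bounded[OF X] by blast
  have XW: "X \<in> borel_measurable W" by (rule measurable_filtration_W[OF trig_measurable[OF X]])
  have int: "integrable W X"
    using integrable_bounded_mult[of "\<lambda>_. 1" X b] XW b by simp
  have price: "(\<integral>w. Y w \<partial>W) \<le> z'"
    if Y: "replicable z' Y" "\<And>w. w \<in> paths \<Longrightarrow> 0 \<le> Y w" "integrable W Y" for Y z'
  proof (rule field_le_epsilon)
    fix e' :: real assume e': "0 < e'"
    have hd: "hedgeable (z' + e') (\<lambda>w. ennreal (Y w))" by (rule replicable_hedgeable[OF Y(1,2) e'])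
    obtain g where g: "g \<in> borel_measurable path_sigma" "\<And>w. w \<in> paths \<Longrightarrow> ennreal (Y w) \<le> g w"
      "(\<integral>\<^sup>+w. g w \<partial>W) \<le> ennreal (z' + e')"
      using hedgeable_dominated[OF hd] by blast
    have "ennreal (\<integral>w. Y w \<partial>W) = (\<integral>\<^sup>+w. ennreal (Y w) \<partial>W)"
      using Y(2,3) by (intro nn_integral_eq_integral[symmetric]) (auto simp: space_W)
    also have "\<dots> \<le> (\<integral>\<^sup>+w. g w \<partial>W)" using g(2) by (intro nn_integral_mono) (simp add: space_W)
    also have "\<dots> \<le> ennreal (z' + e')" by (rule g(3))
    finally show "(\<integral>w. Y w \<partial>W) \<le> z' + e'" using hedgeable_nonneg[OF hd] by simp
  qed
  have b0: "0 \<le> b" using b[of undefined] by linarith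
  have "replicable (b + (- 1) * z) (\<lambda>w. b + (- 1) * X w)"
    by (rule replicable_add[OF replicable_const replicable_scale[OF z]])
  then have "(\<integral>w. b + (- 1) * X w \<partial>W) \<le> b + (- 1) * z"
    using b int by (intro price) (auto simp: abs_le_iff)
  then have "z \<le> (\<integral>w. X w \<partial>W)" using int by (simp add: prob_space)
  then have "z = (\<integral>w. X w \<partial>W)" using price[OF z nonneg int] by simp
  then show ?thesis
    using replicable_hedgeable[OF z nonneg e] by simp
qed

section \<open>From trigonometric functionals to measurable sets\<close>

text \<open>The frequencies \<open>1/(l + 1)\<close> tend to zero, so the bounded coordinates of this map determine the
  path although each of them is periodic in the path's value.\<close>

definition trig_map :: "path \<Rightarrow> (nat \<times> nat \<times> nat \<times> bool) \<Rightarrow> real" where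
  "trig_map w = (\<lambda>(i, k, l, b). cos (w (real i / 2 ^ k) / real (Suc l) - (if b then pi / 2 else 0)))"

definition unit_cube :: "((nat \<times> nat \<times> nat \<times> bool) \<Rightarrow> real) set" where
  "unit_cube = PiE UNIV (\<lambda>_. {-1..1})"

lemma compact_unit_cube: "compact unit_cube"
proof -
  have "compactin (product_topology (\<lambda>_. euclidean) UNIV) unit_cube"
    unfolding unit_cube_def compactin_PiE by (simp add: compactin_euclidean_iff)
  then show ?thesis
    by (simp add: euclidean_product_topology compactin_euclidean_iff)
qed

lemma trig_map_in_cube: "trig_map w \<in> unit_cube"
  by (auto simp: unit_cube_def trig_map_def)

lemma trig_trig_map: "trig (\<lambda>w. trig_map w n)"
proof (cases n)
  case (fields i k l b)
  have "{real i / 2 ^ k} \<subseteq> dyadics" by (auto simp: dyadics_def)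
  from trig_cos[OF _ this, of 1 "if b then - (pi / 2) else 0" "\<lambda>_. 1 / real (Suc l)"]
  show ?thesis
    by (auto simp: fields trig_map_def algebra_simps split: if_splits)
qed

lemma measurable_trig_map: "trig_map \<in> borel_measurable path_sigma"
  by (rule measurable_coordinatewise_then_product) (rule trig_measurable[OF trig_trig_map])

text \<open>Stone-Weierstrass for the algebra of continuous functions on the cube whose composite
  with \<open>trig_map\<close> is a trigonometric polynomial. It contains the coordinates, which
  separate points.\<close>

lemma trig_dense:
  assumes f: "continuous_on unit_cube f" and e: "0 < e"
  shows "\<exists>g. trig (\<lambda>w. g (trig_map w)) \<and> (\<forall>x\<in>unit_cube. \<bar>f x - g x\<bar> < e)"
proof -
  interpret function_ring_on "{p. continuous_on unit_cube p \<and> trig (\<lambda>w. p (trig_map w))}" unit_cube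
  proof
    fix x y :: "(nat \<times> nat \<times> nat \<times> bool) \<Rightarrow> real" assume "x \<noteq> y"
    then obtain n where n: "x n \<noteq> y n" unfolding fun_eq_iff by blast
    have "continuous_on unit_cube (\<lambda>x. x n)"
      by (rule continuous_on_subset[OF continuous_on_product_coordinates]) auto
    then show "\<exists>f\<in>{p. continuous_on unit_cube p \<and> trig (\<lambda>w. p (trig_map w))}. f x \<noteq> f y"
      using n trig_trig_map by (intro bexI[of _ "\<lambda>x. x n"]) auto
  qed (auto simp: compact_unit_cube intro: trig_mult trig.trig_add trig_const continuous_on_add continuous_on_mult)
  show ?thesis
    using Stone_Weierstrass_basic[OF f e] by auto
qed

context wiener
begin

lemma continuous_hedgeable:
  fixes f :: "((nat \<times> nat \<times> nat \<times> bool) \<Rightarrow> real) \<Rightarrow> real"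
  assumes f: "continuous_on UNIV f" "\<And>x. 0 \<le> f x" "\<And>x. f x \<le> 1" and e: "0 < e"
  shows "hedgeable ((\<integral>w. f (trig_map w) \<partial>W) + e) (\<lambda>w. ennreal (f (trig_map w)))"
proof -
  \<comment> \<open>Approximating \<open>f + d\<close> within \<open>d\<close> puts \<open>g\<close>
    between \<open>f\<close> and \<open>f + 2 * d\<close>, so \<open>g\<close> is a nonnegative
    payoff above \<open>f\<close> on the image of \<open>trig_map\<close>. The choice
    \<open>e / 3\<close> leaves a positive remainder of \<open>e\<close> for hedging
    \<open>g\<close>.\<close>
  define d where "d = e / 3"
  have d: "0 < d" using e by (simp add: d_def)
  have "continuous_on unit_cube (\<lambda>x. f x + d)"
    by (intro continuous_on_add continuous_on_const continuous_on_subset[OF f(1)]) auto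
  from trig_dense[OF this d] obtain g where g: "trig (\<lambda>w. g (trig_map w))"
    "\<forall>x\<in>unit_cube. \<bar>f x + d - g x\<bar> < d" by blast
  have bounds: "f (trig_map w) \<le> g (trig_map w)" "g (trig_map w) \<le> f (trig_map w) + 2 * d" for w
    using g(2)[rule_format, OF trig_map_in_cube[of w]] by linarith+
  have f_meas: "(\<lambda>w. f (trig_map w)) \<in> borel_measurable W"
    by (rule measurable_compose[OF measurable_filtration_W[OF measurable_trig_map]])
       (rule borel_measurable_continuous_onI[OF f(1)])
  have f_int: "integrable W (\<lambda>w. f (trig_map w))"
    using integrable_bounded_mult[of "\<lambda>_. 1", OF _ f_meas, of 1] f(2,3) by simp
  obtain b where b: "\<And>w. \<bar>g (trig_map w)\<bar> \<le> b" using trig_bounded[OF g(1)] by blast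
  have g_int: "integrable W (\<lambda>w. g (trig_map w))"
    using integrable_bounded_mult[of "\<lambda>_. 1", OF _ measurable_filtration_W[OF trig_measurable[OF g(1)]], of b] b by simp
  have "(\<integral>w. g (trig_map w) \<partial>W) \<le> (\<integral>w. f (trig_map w) + 2 * d \<partial>W)"
    using bounds f_int g_int by (intro integral_mono) auto
  also have "\<dots> = (\<integral>w. f (trig_map w) \<partial>W) + 2 * d" using f_int by (simp add: prob_space)
  finally have pos: "0 < (\<integral>w. f (trig_map w) \<partial>W) + e - (\<integral>w. g (trig_map w) \<partial>W)"
    using d by (simp add: d_def)
  have "hedgeable ((\<integral>w. f (trig_map w) \<partial>W) + e) (\<lambda>w. ennreal (g (trig_map w)))"
    using trig_hedgeable[OF g(1) order_trans[OF f(2) bounds(1)] pos] by simp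
  then show ?thesis
    by (rule hedgeable_mono) (use bounds in \<open>auto intro: ennreal_leI\<close>)
qed

text \<open>The indicator of an open set is the sum of the nonnegative continuous increments
  \<open>g n\<close> of truncated distance functions. The increments are hedged separately, with
  errors that form a geometric series of sum \<open>e\<close>.\<close>

lemma upper_prob_open_le:
  assumes U: "open U" and e: "0 < e"
  shows "upper_prob (trig_map -` U \<inter> paths) \<le> measure W (trig_map -` U \<inter> paths) + e"
proof (cases "U = UNIV")
  \<comment> \<open>Treated apart because \<open>infdist\<close> to the empty set is
    \<open>0\<close>, so the approximating functions would vanish.\<close>
  case True
  have "hedgeable 1 (indicator paths)"
    using positive_capital_process_one(1) positive_capital_process_one(2)[of paths] unfolding hedgeable_def superhedges_def by blast
  then show ?thesis
    using True e upper_prob_le[of 1 paths] prob_space space_W by simp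
next
  case False
  let ?\<Phi> = trig_map
  let ?A = "?\<Phi> -` U \<inter> paths"
  have A: "?A \<in> sets W"
    using measurable_sets[OF measurable_trig_map, of U] U sets_W by simp
  have closed: "closed (- U)" "- U \<noteq> {}" using U False by auto
  define f where "f n x = min 1 (real n * infdist x (- U))" for n x
  have f01: "0 \<le> f n x" "f n x \<le> 1" for n x by (auto simp: f_def infdist_nonneg)
  have f_mono: "f n x \<le> f (Suc n) x" for n x
    unfolding f_def by (intro min.mono order_refl mult_right_mono) (auto simp: infdist_nonneg)
  have f_cont: "continuous_on UNIV (f n)" for n
    unfolding f_def by (intro continuous_on_min continuous_on_const continuous_on_mult continuous_on_infdist continuous_on_id)
  have f_lim: "(\<lambda>n. f n x) \<longlonglongrightarrow> indicator U x" for x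
  proof (cases "x \<in> U")
    case True
    then have "0 < infdist x (- U)"
      using infdist_pos_not_in_closed[OF closed] by simp
    then obtain n0 :: nat where n0: "1 < real n0 * infdist x (- U)"
      using reals_Archimedean3 by blast
    have "f n x = 1" if "n \<ge> n0" for n
    proof -
      have "real n0 * infdist x (- U) \<le> real n * infdist x (- U)"
        using that by (intro mult_right_mono) (auto simp: infdist_nonneg)
      then show ?thesis using n0 by (simp add: f_def)
    qed
    then show ?thesis
      using True by (intro tendsto_eventually) (auto simp: eventually_sequentially)
  next
    case False
    then show ?thesis by (simp add: f_def)
  qed
  define g where "g n x = f (Suc n) x - f n x" for n x
  have g01: "0 \<le> g n x" "g n x \<le> 1" for n x
    using f_mono[of n x] f01[of n x] f01[of "Suc n" x] by (auto simp: g_def)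
  have g_cont: "continuous_on UNIV (g n)" for n
    unfolding g_def by (intro continuous_on_diff f_cont)
  have g_sums: "(\<lambda>n. g n x) sums indicator U x" for x
    using telescope_sums[OF f_lim[of x]] by (simp add: g_def f_def)
  have f_int: "integrable W (\<lambda>w. f n (?\<Phi> w))" for n
  proof -
    have "(\<lambda>w. f n (?\<Phi> w)) \<in> borel_measurable W"
      by (rule measurable_compose[OF measurable_filtration_W[OF measurable_trig_map]])
         (rule borel_measurable_continuous_onI[OF f_cont])
    then show ?thesis
      using integrable_bounded_mult[of "\<lambda>_. 1" "\<lambda>w. f n (?\<Phi> w)" 1] f01 by simp
  qed
  define s where "s n = (\<integral>w. g n (?\<Phi> w) \<partial>W)" for n
  have s_sum: "(\<Sum>n<N. s n) \<le> measure W ?A" for N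
  proof -
    have "(\<Sum>n<N. s n) = (\<Sum>n<N. (\<integral>w. f (Suc n) (?\<Phi> w) \<partial>W) - (\<integral>w. f n (?\<Phi> w) \<partial>W))"
      unfolding s_def g_def using f_int by simp
    also have "\<dots> = (\<integral>w. f N (?\<Phi> w) \<partial>W) - (\<integral>w. f 0 (?\<Phi> w) \<partial>W)"
      by (rule sum_lessThan_telescope)
    also have "\<dots> = (\<integral>w. f N (?\<Phi> w) \<partial>W)" by (simp add: f_def)
    also have "\<dots> \<le> (\<integral>w. indicator ?A w \<partial>W)"
    proof (intro integral_mono f_int)
      show "integrable W (indicator ?A :: path \<Rightarrow> real)"
        using A by (intro integrable_real_indicator) (auto simp: emeasure_eq_measure)
      fix w assume "w \<in> space W"
      then show "f N (?\<Phi> w) \<le> indicator ?A w"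
        using f01 by (cases "?\<Phi> w \<in> U") (auto simp: space_W f_def indicator_def)
    qed
    also have "\<dots> = measure W ?A" using A by simp
    finally show ?thesis .
  qed
  have s0: "0 \<le> s n" for n unfolding s_def by (intro integral_nonneg_AE AE_I2 g01)
  have s_summable: "summable s"
    by (rule summableI_nonneg_bounded[OF s0 s_sum])
  have s_le: "(\<Sum>n. s n) \<le> measure W ?A"
    by (rule suminf_le_const[OF s_summable s_sum])
  have geo: "(\<lambda>n. e * (1 / 2) ^ Suc n) sums e"
    using sums_mult[OF power_half_series, of e] by simp
  have "hedgeable (\<Sum>n. s n + e * (1 / 2) ^ Suc n) (\<lambda>w. \<Sum>n. ennreal (g n (?\<Phi> w)))"
  proof (rule hedgeable_suminf)
    show "hedgeable (s n + e * (1 / 2) ^ Suc n) (\<lambda>w. ennreal (g n (?\<Phi> w)))" for n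
      unfolding s_def using e by (intro continuous_hedgeable g_cont g01) simp
    show "summable (\<lambda>n. s n + e * (1 / 2) ^ Suc n)"
      by (rule summable_add[OF s_summable sums_summable[OF geo]])
  qed
  moreover have "(\<Sum>n. s n + e * (1 / 2) ^ Suc n) = (\<Sum>n. s n) + e"
    using suminf_add[OF s_summable sums_summable[OF geo]] sums_unique[OF geo] by simp
  moreover have "(\<Sum>n. ennreal (g n (?\<Phi> w))) = indicator U (?\<Phi> w)" for w
    unfolding suminf_ennreal2[OF g01(1) sums_summable[OF g_sums]] sums_unique[OF g_sums, symmetric]
    by (simp add: indicator_def)
  ultimately have "hedgeable ((\<Sum>n. s n) + e) (\<lambda>w. indicator U (?\<Phi> w))" by simp
  then have "hedgeable ((\<Sum>n. s n) + e) (indicator ?A)"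
    by (rule hedgeable_mono) (simp add: indicator_def)
  from upper_prob_le[OF this] show ?thesis using s_le by linarith
qed

end

text \<open>Recovers a path value from its sines at frequencies tending to zero;
  \<open>\<bar>sin y - y\<bar> \<le> y\<^sup>2\<close> gives the rate.\<close>

lemma sin_quotient_tendsto: "(\<lambda>l. real (Suc l) * sin (x / real (Suc l))) \<longlonglongrightarrow> x"
proof (rule LIM_zero_cancel, rule Lim_null_comparison)
  show "\<forall>\<^sub>F l in sequentially. norm (real (Suc l) * sin (x / real (Suc l)) - x) \<le> x\<^sup>2 * inverse (real (Suc l))"
  proof (intro always_eventually allI)
    fix l :: nat
    define n where "n = real (Suc l)"
    have n: "0 < n" by (simp add: n_def)
    define y where "y = x / n"
    have "\<bar>sin y - y\<bar> \<le> y\<^sup>2"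
    proof -
      have "cmod (iexp y - (\<Sum>k\<le>1. (\<i> * complex_of_real y) ^ k / fact k)) \<le> \<bar>y\<bar> ^ Suc 1 / fact (Suc 1)"
        by (rule iexp_approx1)
      also have "\<dots> \<le> y\<^sup>2" by (simp add: power2_eq_square)
      finally have "\<bar>Im (iexp y - (\<Sum>k\<le>1. (\<i> * complex_of_real y) ^ k / fact k))\<bar> \<le> y\<^sup>2"
        using abs_Im_le_cmod order_trans by blast
      then show ?thesis by (simp add: Im_exp)
    qed
    then have "n * \<bar>sin y - y\<bar> \<le> n * y\<^sup>2" using n by (intro mult_left_mono) auto
    moreover have "n * sin y - x = n * (sin y - y)" using n by (simp add: y_def algebra_simps)
    moreover have "n * y\<^sup>2 = x\<^sup>2 * inverse n" using n by (simp add: y_def power2_eq_square divide_inverse)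
    ultimately show "norm (real (Suc l) * sin (x / real (Suc l)) - x) \<le> x\<^sup>2 * inverse (real (Suc l))"
      using n unfolding n_def[symmetric] y_def[symmetric] by (simp add: abs_mult)
  qed
  show "(\<lambda>l. x\<^sup>2 * inverse (real (Suc l))) \<longlonglongrightarrow> 0"
    using tendsto_mult[OF tendsto_const LIMSEQ_inverse_real_of_nat, of "x\<^sup>2"] by simp
qed

text \<open>Dyadic coordinates are limits of functions of \<open>trig_map\<close>, and continuity of
  the paths gives the remaining coordinates. Every event is thus pulled back from a Borel set, and
  topological regularity becomes available.\<close>

lemma path_sigma_trig_map:
  assumes "A \<in> sets path_sigma"
  obtains B where "B \<in> sets borel" "A = trig_map -` B \<inter> paths"
proof -
  let ?N = "vimage_algebra paths trig_map borel"
  have \<Phi>: "trig_map \<in> borel_measurable ?N"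
    by (rule measurable_vimage_algebra1) auto
  have coord: "(\<lambda>w. trig_map w n) \<in> borel_measurable ?N" for n
    by (rule measurable_compose[OF \<Phi>]) (rule borel_measurable_continuous_onI[OF continuous_on_product_coordinates])
  have dyadic: "(\<lambda>w. w (real i / 2 ^ k)) \<in> borel_measurable ?N" for i k :: nat
  proof (rule borel_measurable_LIMSEQ_real)
    show "(\<lambda>w. real (Suc l) * trig_map w (i, k, l, True)) \<in> borel_measurable ?N" for l
      by (intro borel_measurable_times borel_measurable_const coord)
    \<comment> \<open>The flag \<open>True\<close> shifts the cosine by \<open>pi / 2\<close>, which
      turns it into a sine.\<close>
    show "(\<lambda>l. real (Suc l) * trig_map w (i, k, l, True)) \<longlonglongrightarrow> w (real i / 2 ^ k)" for w
      using sin_quotient_tendsto[of "w (real i / 2 ^ k)"] by (simp add: trig_map_def cos_diff)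
  qed
  have "(\<lambda>w. w) \<in> ?N \<rightarrow>\<^sub>M path_sigma"
  proof (rule measurable_into_path_sigma)
    fix s :: real assume s: "0 \<le> s"
    define q where "q k = real (nat \<lfloor>2 ^ k * s\<rfloor>) / 2 ^ k" for k :: nat
    show "(\<lambda>w. w s) \<in> borel_measurable ?N"
    proof (rule borel_measurable_LIMSEQ_real)
      show "(\<lambda>w. w (q k)) \<in> borel_measurable ?N" for k unfolding q_def by (rule dyadic)
      have "q = (\<lambda>k. real_of_int \<lfloor>2 ^ k * s\<rfloor> / 2 ^ k)"
        using s by (auto simp: q_def of_nat_nat)
      then have lim: "q \<longlonglongrightarrow> s"
        using floor_quotient_tendsto[of "\<lambda>k. 2 ^ k" s] LIMSEQ_realpow_zero[of "1 / 2 :: real"]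
        by (simp add: power_one_over)
      fix w assume "w \<in> space ?N"
      then have w: "w \<in> paths" by simp
      show "(\<lambda>k. w (q k)) \<longlonglongrightarrow> w s"
        by (rule continuous_on_tendsto_compose[OF path_continuous[OF w] lim]) (use s in \<open>auto simp: q_def\<close>)
    qed
  qed simp
  from measurable_sets[OF this assms] have "A \<inter> paths \<in> sets ?N" by simp
  moreover have "A \<inter> paths = A" using sets.sets_into_space[OF assms] by auto
  ultimately have "A \<in> {trig_map -` B \<inter> paths | B. B \<in> sets borel}"
    by (simp add: sets_vimage_algebra2)
  then show ?thesis using that by blast
qed

section \<open>Identification with Wiener measure and Caratheodory measurability\<close>

lemma upper_prob_mono: "E \<subseteq> F \<Longrightarrow> upper_prob E \<le> upper_prob F"
  by (rule upper_prob_greatest, rule upper_prob_le, erule hedgeable_mono) (auto simp: indicator_def)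

context wiener
begin

text \<open>The law of \<open>trig_map\<close> is a finite Borel measure on a countable product of
  lines, hence outer regular. An open superset of \<open>B\<close> costs at most
  \<open>e / 2\<close> more, and hedging it costs another \<open>e / 2\<close>.\<close>

lemma upper_prob_le_measure:
  assumes A: "A \<in> sets path_sigma"
  shows "upper_prob A \<le> measure W A"
proof (rule field_le_epsilon)
  fix e :: real assume e: "0 < e"
  obtain B where B: "B \<in> sets borel" "A = trig_map -` B \<inter> paths"
    using path_sigma_trig_map[OF A] .
  let ?D = "distr W borel trig_map"
  have \<Phi>: "trig_map \<in> borel_measurable W"
    by (rule measurable_filtration_W[OF measurable_trig_map])
  interpret D: prob_space ?D by (rule prob_space_distr[OF \<Phi>])
  have D: "measure ?D C = measure W (trig_map -` C \<inter> paths)" if "C \<in> sets borel" for C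
    using measure_distr[OF \<Phi> that] by (simp add: space_W)
  have "(INF U\<in>{U. B \<subseteq> U \<and> open U}. emeasure ?D U) = emeasure ?D B"
    using outer_regular[of ?D B] B(1) D.emeasure_finite by simp
  also have "\<dots> < emeasure ?D B + ennreal (e / 2)"
    unfolding D.emeasure_eq_measure using e by (simp add: ennreal_less_iff flip: ennreal_plus)
  finally have "(INF U\<in>{U. B \<subseteq> U \<and> open U}. emeasure ?D U) < emeasure ?D B + ennreal (e / 2)" .
  then obtain U where U: "B \<subseteq> U" "open U" "emeasure ?D U < emeasure ?D B + ennreal (e / 2)"
    unfolding INF_less_iff by blast
  then have "measure ?D U < measure ?D B + e / 2"
    using e by (simp add: D.emeasure_eq_measure ennreal_less_iff flip: ennreal_plus)
  then have W: "measure W (trig_map -` U \<inter> paths) < measure W A + e / 2"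
    using D[of U] D[of B] B U(2) by simp
  have "upper_prob A \<le> upper_prob (trig_map -` U \<inter> paths)"
    using U(1) B(2) by (intro upper_prob_mono) auto
  also have "\<dots> \<le> measure W (trig_map -` U \<inter> paths) + e / 2"
    using e by (intro upper_prob_open_le U(2)) simp
  finally show "upper_prob A \<le> measure W A + e" using W by simp
qed

text \<open>Markov's inequality for the dominating \<open>g\<close>. The cover stands in for a
  possibly nonmeasurable \<open>E\<close>, so that additivity of \<open>W\<close> can be used for
  arbitrary sets of paths.\<close>

lemma hedgeable_measurable_cover:
  assumes "hedgeable s (indicator E)" "E \<subseteq> paths"
  obtains B where "B \<in> sets path_sigma" "E \<subseteq> B" "measure W B \<le> s"
proof -
  obtain g where g: "g \<in> borel_measurable path_sigma" "\<And>w. w \<in> paths \<Longrightarrow> indicator E w \<le> g w"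
    "(\<integral>\<^sup>+w. g w \<partial>W) \<le> ennreal s"
    using hedgeable_dominated[OF assms(1)] by blast
  define B where "B = {w \<in> space path_sigma. 1 \<le> g w}"
  have B: "B \<in> sets path_sigma"
    unfolding B_def by (rule borel_measurable_le[OF borel_measurable_const g(1)])
  have "E \<subseteq> B"
  proof
    fix w assume "w \<in> E"
    then show "w \<in> B" using g(2)[of w] assms(2) by (auto simp: B_def)
  qed
  moreover have "measure W B \<le> s"
  proof -
    have "ennreal (measure W B) = (\<integral>\<^sup>+w. indicator B w \<partial>W)"
      using B sets_W by (simp add: emeasure_eq_measure)
    also have "\<dots> \<le> (\<integral>\<^sup>+w. g w \<partial>W)"
      by (intro nn_integral_mono) (auto simp: B_def indicator_def)
    also have "\<dots> \<le> ennreal s" by (rule g(3))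
    finally show ?thesis using hedgeable_nonneg[OF assms(1)] by simp
  qed
  ultimately show ?thesis using B that by blast
qed

lemma upper_prob_eq_measure:
  assumes A: "A \<in> sets path_sigma"
  shows "upper_prob A = measure W A"
proof (rule antisym[OF upper_prob_le_measure[OF A]])
  show "measure W A \<le> upper_prob A"
  proof (rule upper_prob_greatest)
    fix s assume "hedgeable s (indicator A)"
    then obtain B where B: "B \<in> sets path_sigma" "A \<subseteq> B" "measure W B \<le> s"
      using hedgeable_measurable_cover[of s A] sets.sets_into_space[OF A] by auto
    have "measure W A \<le> measure W B"
      using B sets_W by (intro finite_measure_mono) auto
    then show "measure W A \<le> s" using B(3) by simp
  qed
qed

lemma upper_prob_measurable:
  assumes A: "A \<in> sets path_sigma"
  shows "upper_prob_measurable A"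
  unfolding upper_prob_measurable_def
proof (intro allI impI antisym)
  fix E assume E: "E \<subseteq> paths"
  show "upper_prob E \<le> upper_prob (E \<inter> A) + upper_prob (E \<inter> (paths - A))"
  proof (rule field_le_epsilon)
    fix e :: real assume e: "0 < e"
    obtain s where s: "hedgeable s (indicator (E \<inter> A))" "s < upper_prob (E \<inter> A) + e / 2"
      using e by (auto intro: upper_prob_approx[of "E \<inter> A" "upper_prob (E \<inter> A) + e / 2"])
    obtain t where t: "hedgeable t (indicator (E \<inter> (paths - A)))" "t < upper_prob (E \<inter> (paths - A)) + e / 2"
      using e by (auto intro: upper_prob_approx[of "E \<inter> (paths - A)" "upper_prob (E \<inter> (paths - A)) + e / 2"])
    have "hedgeable (s + t) (indicator E)"
      using hedgeable_add[OF s(1) t(1)] by (rule hedgeable_mono) (auto simp: indicator_def)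
    from upper_prob_le[OF this]
    show "upper_prob E \<le> upper_prob (E \<inter> A) + upper_prob (E \<inter> (paths - A)) + e" using s(2) t(2) by simp
  qed
  show "upper_prob (E \<inter> A) + upper_prob (E \<inter> (paths - A)) \<le> upper_prob E"
  proof (rule upper_prob_greatest)
    fix s assume "hedgeable s (indicator E)"
    then obtain B where B: "B \<in> sets path_sigma" "E \<subseteq> B" "measure W B \<le> s"
      using hedgeable_measurable_cover[OF _ E] by blast
    have "upper_prob (E \<inter> A) \<le> measure W (B \<inter> A)"
      using upper_prob_mono[of "E \<inter> A" "B \<inter> A"] upper_prob_eq_measure[of "B \<inter> A"] A B by auto
    moreover have "upper_prob (E \<inter> (paths - A)) \<le> measure W (B - A)"
      using upper_prob_mono[of "E \<inter> (paths - A)" "B - A"] upper_prob_eq_measure[of "B - A"] A B by auto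
    moreover have "measure W B = measure W (B \<inter> A) + measure W (B - A)"
      using A B sets_W by (subst finite_measure_Union[symmetric]) (auto simp: Int_Diff_Un)
    ultimately show "upper_prob (E \<inter> A) + upper_prob (E \<inter> (paths - A)) \<le> s" using B(3) by simp
  qed
qed

end

theorem theorem1:
  fixes M :: "'a measure" and B :: "real \<Rightarrow> 'a \<Rightarrow> real" and W :: "path measure"
  assumes "standard_brownian_motion M B"
    and "W = path_law M B"
  shows "(\<forall>A\<in>sets path_sigma. upper_prob_measurable A) \<and>
         (\<forall>A\<in>sets path_sigma. upper_prob A = measure W A) \<and>
         (\<forall>A\<in>sets path_sigma. upper_prob A = lower_prob A \<and> lower_prob A = measure W A)"
proof -
  interpret wiener W
    unfolding assms(2) by (rule wiener_path_law[OF assms(1)])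
  have "lower_prob A = measure W A" if "A \<in> sets path_sigma" for A
    using upper_prob_eq_measure[of "paths - A"] sets.compl_sets[OF that] prob_compl[of A] that sets_W
    by (simp add: lower_prob_def space_W)
  then show ?thesis
    using upper_prob_measurable upper_prob_eq_measure by simp
qed

end
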